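(* Let $b_0>0$ and $\frac12<\alpha<1$, let $A$ be the self-adjoint Jacobi operator in $\ell^2(\mathbb{N}_0)$ with zero diagonal and off-diagonal weights $b_0$, $b_{2k-1}=b_{2k}=k^\alpha$ ($k=1,2,3,\dots$), and let $f$ be its spectral density. Then: (i) if $\frac12<\alpha<\frac23$, then $\lim_{x\to0}f(x)=+\infty$; (ii) if $\alpha=\frac23$, then $\lim_{x\to0}f(x)$ exists and equals a finite constant $f_0\neq0$; (iii) if $\frac23<\alpha<1$, then $\lim_{x\to0}f(x)=0$. Here the limits are taken over $x\neq0$.
   Context: The Jacobi matrix is the infinite symmetric tridiagonal matrix with rows and columns indexed by $n=0,1,2,\dots$, zero diagonal entries, and entries $b_n$ in positions $(n,n+1)$ and $(n+1,n)$, where $b_0>0$ and $b_{2k-1}=b_{2k}=k^\alpha$ for $k\ge1$. For $\alpha\in(1/2,1)$ it defines an unbounded self-adjoint operator $A$ in $\ell^2(\mathbb{N}_0)$. Let $e_0=(1,0,0,\dots)$, let $E_A$ be the spectral measure (projection-valued) of $A$, and let $\sigma(B)=\langle E_A(B)e_0,e_0\rangle$ be the scalar spectral measure of $A$ (a probability measure on $\mathbb{R}$). The spectral density $f$ is the density with respect to Lebesgue measure of the absolutely continuous part of $\sigma$ (there may be an atom of $\sigma$ at $x=0$). On $\mathbb{R}\setminus\{0\}$ the density $f$ agrees almost everywhere with a positive continuous function, and $f(x)$ for $x\neq0$ denotes the value of this continuous representative. *)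

theory Defs
  imports "HOL-Analysis.Analysis"
begin

text \<open>
  The complex Hilbert space \<open>\<ell>\<^sup>2(\<nat>\<^sub>0)\<close> is the carrier set \<open>l2\<close> inside the function type
  \<open>nat \<Rightarrow> complex\<close>; the inner product is linear in the first argument.  Linear maps are
  functions on sequences of which only the values on the relevant domain matter.
\<close>

definition l2 :: "(nat \<Rightarrow> complex) set" where
  "l2 = {u. summable (\<lambda>n. (cmod (u n))\<^sup>2)}"

definition l2_inner :: "(nat \<Rightarrow> complex) \<Rightarrow> (nat \<Rightarrow> complex) \<Rightarrow> complex" where
  "l2_inner u v = (\<Sum>n. u n * cnj (v n))"

definition l2_norm :: "(nat \<Rightarrow> complex) \<Rightarrow> real" where
  "l2_norm u = sqrt (\<Sum>n. (cmod (u n))\<^sup>2)"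

definition e0 :: "nat \<Rightarrow> complex" where
  "e0 = (\<lambda>n. if n = 0 then 1 else 0)"

definition jacobi_map :: "(nat \<Rightarrow> real) \<Rightarrow> (nat \<Rightarrow> complex) \<Rightarrow> (nat \<Rightarrow> complex)" where
  "jacobi_map b u = (\<lambda>n. (if n = 0 then 0 else of_real (b (n - 1)) * u (n - 1))
                          + of_real (b n) * u (n + 1))"

text \<open>
  The Jacobi operator is taken on its maximal domain.  If \<open>\<Sum>n. 1 / b n\<close> diverges (Carleman's
  condition), as for weights of order \<open>n\<^sup>\<alpha>\<close> with \<open>\<alpha> \<le> 1\<close>, this operator is self-adjoint and
  is the closure of its restriction to finitely supported sequences.
\<close>

definition jacobi_dom :: "(nat \<Rightarrow> real) \<Rightarrow> (nat \<Rightarrow> complex) set" where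
  "jacobi_dom b = {u \<in> l2. jacobi_map b u \<in> l2}"

definition orthogonal_projection :: "((nat \<Rightarrow> complex) \<Rightarrow> (nat \<Rightarrow> complex)) \<Rightarrow> bool" where
  "orthogonal_projection P \<longleftrightarrow>
     (\<forall>u\<in>l2. P u \<in> l2) \<and>
     (\<forall>u\<in>l2. \<forall>v\<in>l2. \<forall>c. P (\<lambda>n. c * u n + v n) = (\<lambda>n. c * P u n + P v n)) \<and>
     (\<forall>u\<in>l2. P (P u) = P u) \<and>
     (\<forall>u\<in>l2. \<forall>v\<in>l2. l2_inner (P u) v = l2_inner u (P v))"

text \<open>Countable additivity is in the strong operator topology.\<close>

definition projection_valued_measure ::
  "(real set \<Rightarrow> (nat \<Rightarrow> complex) \<Rightarrow> (nat \<Rightarrow> complex)) \<Rightarrow> bool" where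
  "projection_valued_measure E \<longleftrightarrow>
     (\<forall>B\<in>sets borel. orthogonal_projection (E B)) \<and>
     (\<forall>u\<in>l2. E {} u = (\<lambda>n. 0)) \<and>
     (\<forall>u\<in>l2. E UNIV u = u) \<and>
     (\<forall>B\<in>sets borel. \<forall>C\<in>sets borel. \<forall>u\<in>l2. E (B \<inter> C) u = E B (E C u)) \<and>
     (\<forall>F :: nat \<Rightarrow> real set. range F \<subseteq> sets borel \<longrightarrow> disjoint_family F \<longrightarrow>
        (\<forall>u\<in>l2. (\<lambda>N. l2_norm (\<lambda>n. E (\<Union>i. F i) u n - (\<Sum>i<N. E (F i) u n))) \<longlonglongrightarrow> 0))"

text \<open>The finite Borel measure \<open>B \<mapsto> \<langle>E(B)u, u\<rangle>\<close>, whose values are real and nonnegative.\<close>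

definition scalar_measure ::
  "(real set \<Rightarrow> (nat \<Rightarrow> complex) \<Rightarrow> (nat \<Rightarrow> complex)) \<Rightarrow> (nat \<Rightarrow> complex) \<Rightarrow> real measure" where
  "scalar_measure E u = measure_of UNIV (sets borel) (\<lambda>B. ennreal (Re (l2_inner (E B u) u)))"

text \<open>
  \<open>E\<close> is the spectral measure of the operator \<open>T\<close> with domain \<open>D\<close>: \<open>T = \<integral> x dE(x)\<close> in the sense
  of quadratic forms, including equality of domains.  By polarization this determines \<open>T\<close>.
\<close>

definition is_spectral_measure ::
  "(real set \<Rightarrow> (nat \<Rightarrow> complex) \<Rightarrow> (nat \<Rightarrow> complex)) \<Rightarrow>
   (nat \<Rightarrow> complex) set \<Rightarrow> ((nat \<Rightarrow> complex) \<Rightarrow> (nat \<Rightarrow> complex)) \<Rightarrow> bool" where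
  "is_spectral_measure E D T \<longleftrightarrow>
     projection_valued_measure E \<and>
     D = {u \<in> l2. integrable (scalar_measure E u) (\<lambda>x. x\<^sup>2)} \<and>
     (\<forall>u\<in>D. l2_inner (T u) u = of_real (\<integral>x. x \<partial>scalar_measure E u))"

text \<open>
  \<open>f\<close> is a Lebesgue density of the absolutely continuous part of \<open>\<sigma>\<close>: \<open>\<sigma>\<close> is the sum of
  \<open>f(x) dx\<close> and a measure \<open>\<nu>\<close> concentrated on a Lebesgue null set \<open>N\<close>.
\<close>

definition is_ac_density :: "real measure \<Rightarrow> (real \<Rightarrow> real) \<Rightarrow> bool" where
  "is_ac_density \<sigma> f \<longleftrightarrow>
     f \<in> borel_measurable borel \<and> (AE x in lborel. 0 \<le> f x) \<and>
     (\<exists>\<nu> N. sets \<nu> = sets borel \<and> N \<in> null_sets lborel \<and> emeasure \<nu> (- N) = 0 \<and>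
        (\<forall>B\<in>sets borel. emeasure \<sigma> B = emeasure (density lborel (\<lambda>x. ennreal (f x))) B
                                        + emeasure \<nu> B))"

end

theory Submission
  imports Defs "HOL-Complex_Analysis.Complex_Analysis" "HOL-Real_Asymp.Real_Asymp"
begin

text \<open>
  Away from the origin the density is \<open>f(x) = 1 / (\<pi> L(|x|))\<close>, where \<open>L(|x|)\<close> measures the
  amplitude at infinity of the orthogonal polynomials \<open>P\<^sub>n(x)\<close>: with
  \<open>u\<^sub>k = (-1)\<^sup>k b\<^sub>2\<^sub>k P\<^sub>2\<^sub>k\<close> and \<open>v\<^sub>k = (-1)\<^sup>k P\<^sub>2\<^sub>k\<^sub>+\<^sub>1\<close> it is the limit of the energy
  \<open>k\<^sup>\<alpha> v\<^sub>k\<^sup>2 + k\<^sup>-\<^sup>\<alpha> u\<^sub>k\<^sup>2\<close>. So the theorem has two halves: the formula for \<open>f\<close>, and the behaviour of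
  \<open>L(x)\<close> as \<open>x\<close> decreases to \<open>0\<close>.

  The formula. Cut the recurrence at an index \<open>N\<close> by the boundary condition
  \<open>\<psi>\<^sub>N\<^sub>+\<^sub>1 = - \<i> \<psi>\<^sub>N\<close>. The resulting function \<open>m\<^sub>N\<close> is holomorphic up to the real line,
  satisfies \<open>|m\<^sub>N(z)| \<le> 1 / Im z\<close>, and has on the real line the explicit imaginary part
  \<open>1 / (b\<^sub>N (P\<^sub>N\<^sub>+\<^sub>1\<^sup>2 + P\<^sub>N\<^sup>2))\<close>, which for even \<open>N\<close> is the reciprocal of the energy. Since
  \<open>\<Sum> 1 / b\<^sub>n\<close> diverges, the Weyl discs shrink to points, and \<open>m\<^sub>N(z)\<close> converges in the upper half
  plane to the value at \<open>0\<close> of an \<open>\<ell>\<^sup>2\<close> solution of \<open>(A - z) \<psi> = e\<^sub>0\<close>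
  (\<open>weyl_sol_limit_l2\<close>). Polarizing the quadratic form of the spectral measure identifies that
  value with the Stieltjes transform of \<open>\<sigma>\<close> (\<open>resolvent_Stieltjes\<close>). To go down to the real
  line, \<open>m\<^sub>N\<close> is multiplied by a quadratic polynomial vanishing at both ends of an interval: moving the
  segment of integration from height \<open>0\<close> to height \<open>y\<close> then costs only \<open>O(y)\<close>, uniformly in \<open>N\<close>
  (\<open>bump_boundary_shift\<close>). Letting \<open>N \<rightarrow> \<infinity>\<close> and then \<open>y \<rightarrow> 0\<close> evaluates enough integrals against
  \<open>\<sigma>\<close> to conclude that \<open>\<sigma>\<close> is \<open>dx / (\<pi> L(|x|))\<close> away from \<open>0\<close> (\<open>ac_density_from_hats\<close>).

  The asymptotics. The pair \<open>(u, v)\<close> obeys a first-order difference system which discretizes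
  \<open>u'' = - x\<^sup>2 t\<^sup>-\<^sup>2\<^sup>\<alpha> u\<close>. Up to the index \<open>k \<sim> |x| powr (- 1 / (1 - \<alpha>))\<close> the solution has not yet
  oscillated, and \<open>v\<^sub>k \<approx> c x\<close> with a positive constant \<open>c\<close> (\<open>early_bounds\<close>); at that index the
  energy has the order of \<open>k powr (3 \<alpha> - 2)\<close>. From there on the energy, corrected by a small
  multiple of \<open>u\<^sub>k v\<^sub>k\<close>, is conserved up to summable relative errors, so that \<open>L(x)\<close> has the same
  order (\<open>limit_energy_comparable\<close>). This settles \<open>\<alpha> < 2/3\<close> and \<open>\<alpha> > 2/3\<close>. For
  \<open>\<alpha> = 2/3\<close> the differential equation has elementary solutions and an exactly conserved quadratic
  form, namely the corrected energy plus \<open>v\<^sup>2 / (9 x\<^sup>2)\<close>; for the difference system it is conserved up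
  to an error that vanishes with \<open>x\<close>, and its initial value tends to \<open>c\<^sup>2 / 9\<close>, whence
  \<open>f(x) \<rightarrow> 9 / (\<pi> c\<^sup>2)\<close>.
\<close>

section \<open>Square-summable sequences and projection-valued measures\<close>

lemma l2_summable_sq: "u \<in> l2 \<Longrightarrow> summable (\<lambda>n. (cmod (u n))\<^sup>2)"
  unfolding l2_def by simp

lemma l2_summable_norm_mult:
  assumes "u \<in> l2" "v \<in> l2"
  shows "summable (\<lambda>n. norm (u n * cnj (v n)))"
proof (rule summable_comparison_test')
  show "summable (\<lambda>n. (cmod (u n))\<^sup>2 + (cmod (v n))\<^sup>2)"
    by (intro summable_add l2_summable_sq assms)
  show "norm (norm (u n * cnj (v n))) \<le> (cmod (u n))\<^sup>2 + (cmod (v n))\<^sup>2" for n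
  proof -
    have "2 * (cmod (u n) * cmod (v n)) \<le> (cmod (u n))\<^sup>2 + (cmod (v n))\<^sup>2"
      using sum_squares_bound[of "cmod (u n)" "cmod (v n)"] by (simp add: mult.assoc)
    moreover have "0 \<le> cmod (u n) * cmod (v n)" by simp
    ultimately show ?thesis unfolding real_norm_def abs_norm_cancel norm_mult complex_mod_cnj by linarith
  qed
qed

lemma l2_summable_mult: "u \<in> l2 \<Longrightarrow> v \<in> l2 \<Longrightarrow> summable (\<lambda>n. u n * cnj (v n))"
  by (rule summable_norm_cancel[OF l2_summable_norm_mult])

lemma l2_lincomb:
  assumes "u \<in> l2" "v \<in> l2" shows "(\<lambda>n. a * u n + v n) \<in> l2"
  unfolding l2_def mem_Collect_eq
proof (rule summable_comparison_test')
  show "summable (\<lambda>n. 2 * (cmod a)\<^sup>2 * (cmod (u n))\<^sup>2 + 2 * (cmod (v n))\<^sup>2)"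
    by (intro summable_add summable_mult l2_summable_sq assms)
  show "norm ((cmod (a * u n + v n))\<^sup>2) \<le> 2 * (cmod a)\<^sup>2 * (cmod (u n))\<^sup>2 + 2 * (cmod (v n))\<^sup>2" for n
  proof -
    have "(cmod (a * u n + v n))\<^sup>2 \<le> (cmod (a * u n) + cmod (v n))\<^sup>2"
      by (intro power_mono norm_triangle_ineq) auto
    also have "\<dots> \<le> 2 * (cmod (a * u n))\<^sup>2 + 2 * (cmod (v n))\<^sup>2"
      using sum_squares_bound[of "cmod (a * u n)" "cmod (v n)"] by (simp add: power2_eq_square algebra_simps)
    finally show ?thesis by (simp add: norm_mult power_mult_distrib)
  qed
qed

lemma l2_zero: "(\<lambda>n. 0) \<in> l2" unfolding l2_def by simp

lemma l2_inner_lincomb: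
  assumes "u \<in> l2" "v \<in> l2" "w \<in> l2"
  shows "l2_inner (\<lambda>n. a * u n + v n) w = a * l2_inner u w + l2_inner v w"
proof -
  have "l2_inner (\<lambda>n. a * u n + v n) w = (\<Sum>n. a * (u n * cnj (w n)) + v n * cnj (w n))"
    unfolding l2_inner_def by (simp add: algebra_simps)
  also have "\<dots> = (\<Sum>n. a * (u n * cnj (w n))) + (\<Sum>n. v n * cnj (w n))"
    by (intro suminf_add[symmetric] summable_mult l2_summable_mult assms)
  finally show ?thesis unfolding l2_inner_def by (simp add: suminf_mult l2_summable_mult assms)
qed

lemma l2_inner_cnj:
  assumes "u \<in> l2" "v \<in> l2" shows "l2_inner v u = cnj (l2_inner u v)"
proof -
  have "(\<lambda>n. u n * cnj (v n)) sums l2_inner u v"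
    unfolding l2_inner_def by (intro summable_sums l2_summable_mult assms)
  then have "(\<lambda>n. cnj (u n * cnj (v n))) sums cnj (l2_inner u v)" by (simp only: sums_cnj)
  then have "(\<lambda>n. v n * cnj (u n)) sums cnj (l2_inner u v)" by (simp add: mult.commute)
  then show ?thesis unfolding l2_inner_def[of v u] by (simp add: sums_iff)
qed

lemma l2_inner_lincomb_right:
  assumes "u \<in> l2" "v \<in> l2" "w \<in> l2"
  shows "l2_inner w (\<lambda>n. a * u n + v n) = cnj a * l2_inner w u + l2_inner w v"
proof -
  have "l2_inner w (\<lambda>n. a * u n + v n) = cnj (l2_inner (\<lambda>n. a * u n + v n) w)"
    by (rule l2_inner_cnj) (use assms l2_lincomb in auto)
  also have "\<dots> = cnj a * cnj (l2_inner u w) + cnj (l2_inner v w)"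
    using l2_inner_lincomb[OF assms] by simp
  finally show ?thesis
    unfolding l2_inner_cnj[OF assms(1,3)] l2_inner_cnj[OF assms(2,3)] .
qed

lemma l2_inner_zero: "l2_inner (\<lambda>n. 0) w = 0" "l2_inner w (\<lambda>n. 0) = 0"
  unfolding l2_inner_def by auto

lemma l2_inner_lincomb_lincomb:
  assumes "u \<in> l2" "v \<in> l2" "u' \<in> l2" "v' \<in> l2"
  shows "l2_inner (\<lambda>n. a * u' n + v' n) (\<lambda>n. a * u n + v n)
    = of_real ((cmod a)\<^sup>2) * l2_inner u' u + a * l2_inner u' v + cnj a * l2_inner v' u + l2_inner v' v"
proof -
  have "l2_inner (\<lambda>n. a * u' n + v' n) (\<lambda>n. a * u n + v n) = a * l2_inner u' (\<lambda>n. a * u n + v n) + l2_inner v' (\<lambda>n. a * u n + v n)"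
    by (intro l2_inner_lincomb l2_lincomb assms)
  also have "l2_inner u' (\<lambda>n. a * u n + v n) = cnj a * l2_inner u' u + l2_inner u' v"
    by (intro l2_inner_lincomb_right assms)
  also have "l2_inner v' (\<lambda>n. a * u n + v n) = cnj a * l2_inner v' u + l2_inner v' v"
    by (intro l2_inner_lincomb_right assms)
  finally show ?thesis by (simp add: algebra_simps complex_norm_square del: of_real_power)
qed

lemma l2_inner_self:
  assumes "u \<in> l2" shows "l2_inner u u = of_real ((l2_norm u)\<^sup>2)"
proof -
  have "(\<lambda>n. complex_of_real ((cmod (u n))\<^sup>2)) sums of_real (\<Sum>n. (cmod (u n))\<^sup>2)"
    by (intro sums_of_real summable_sums l2_summable_sq assms)
  then have "(\<lambda>n. u n * cnj (u n)) sums of_real (\<Sum>n. (cmod (u n))\<^sup>2)"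
    by (simp add: complex_mult_cnj cmod_power2)
  moreover have "0 \<le> (\<Sum>n. (cmod (u n))\<^sup>2)" by (intro suminf_nonneg l2_summable_sq assms) auto
  ultimately show ?thesis unfolding l2_inner_def l2_norm_def by (simp add: sums_iff)
qed

lemma l2_norm_eq_0D:
  assumes "u \<in> l2" "l2_norm u = 0" shows "u = (\<lambda>n. 0)"
proof -
  have "(\<Sum>n. (cmod (u n))\<^sup>2) = 0" using assms(2) unfolding l2_norm_def by simp
  then have "\<forall>n. (cmod (u n))\<^sup>2 = 0" using suminf_eq_zero_iff[OF l2_summable_sq[OF assms(1)]] by simp
  then show ?thesis by auto
qed

lemma l2_cauchy_schwarz:
  assumes "u \<in> l2" "v \<in> l2" shows "cmod (l2_inner u v) \<le> l2_norm u * l2_norm v"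
proof -
  have "(\<lambda>n. \<Sum>i<n. u i * cnj (v i)) \<longlonglongrightarrow> l2_inner u v"
    unfolding l2_inner_def by (intro summable_LIMSEQ l2_summable_mult assms)
  then have lim: "(\<lambda>n. cmod (\<Sum>i<n. u i * cnj (v i))) \<longlonglongrightarrow> cmod (l2_inner u v)" by (rule tendsto_norm)
  have L: "L2_set (\<lambda>i. cmod (w i)) {..<n} \<le> l2_norm w" if "w \<in> l2" for w n
    unfolding L2_set_def l2_norm_def
    by (intro real_sqrt_le_mono sum_le_suminf l2_summable_sq that) auto
  have "cmod (\<Sum>i<n. u i * cnj (v i)) \<le> l2_norm u * l2_norm v" for n
  proof -
    have "cmod (\<Sum>i<n. u i * cnj (v i)) \<le> (\<Sum>i<n. \<bar>cmod (u i)\<bar> * \<bar>cmod (v i)\<bar>)"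
      by (rule order_trans[OF norm_sum]) (simp add: norm_mult)
    also have "\<dots> \<le> L2_set (\<lambda>i. cmod (u i)) {..<n} * L2_set (\<lambda>i. cmod (v i)) {..<n}"
      by (rule L2_set_mult_ineq)
    also have "\<dots> \<le> l2_norm u * l2_norm v"
      by (intro mult_mono L assms L2_set_nonneg) (rule order_trans[OF L2_set_nonneg L[OF assms(1)]])
    finally show ?thesis .
  qed
  then show ?thesis by (intro LIMSEQ_le_const2[OF lim]) auto
qed

lemma e0_l2: "e0 \<in> l2"
  unfolding l2_def e0_def mem_Collect_eq by (rule summable_finite[of "{0}"]) auto

lemma l2_inner_e0: "l2_inner u e0 = u 0"
proof -
  have "(\<lambda>n. u n * cnj (e0 n)) sums (\<Sum>n\<in>{0}. u n * cnj (e0 n))"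
    by (rule sums_finite) (auto simp: e0_def)
  then show ?thesis unfolding l2_inner_def by (simp add: sums_iff e0_def)
qed

lemma l2_sum: "(\<And>i. i \<in> I \<Longrightarrow> g i \<in> l2) \<Longrightarrow> finite I \<Longrightarrow> (\<lambda>n. \<Sum>i\<in>I. g i n) \<in> l2" for g :: "nat \<Rightarrow> nat \<Rightarrow> complex"
proof (induction I rule: infinite_finite_induct)
  case (insert x F)
  then show ?case using l2_lincomb[of "g x" "\<lambda>n. \<Sum>i\<in>F. g i n" 1] by simp
qed (simp_all add: l2_zero)

lemma density_indicator_real: "density M (indicator B) = density M (\<lambda>x. ennreal (indicator B x))"
  by (simp add: ennreal_indicator)

locale pvm =
  fixes E :: "real set \<Rightarrow> (nat \<Rightarrow> complex) \<Rightarrow> (nat \<Rightarrow> complex)"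
  assumes pvm: "projection_valued_measure E"
begin

lemma E_l2: "B \<in> sets borel \<Longrightarrow> u \<in> l2 \<Longrightarrow> E B u \<in> l2"
  and E_lincomb: "B \<in> sets borel \<Longrightarrow> u \<in> l2 \<Longrightarrow> v \<in> l2 \<Longrightarrow> E B (\<lambda>n. a * u n + v n) = (\<lambda>n. a * E B u n + E B v n)"
  and E_selfadjoint: "B \<in> sets borel \<Longrightarrow> u \<in> l2 \<Longrightarrow> v \<in> l2 \<Longrightarrow> l2_inner (E B u) v = l2_inner u (E B v)"
  and E_idem: "B \<in> sets borel \<Longrightarrow> u \<in> l2 \<Longrightarrow> E B (E B u) = E B u"
  and E_empty: "u \<in> l2 \<Longrightarrow> E {} u = (\<lambda>n. 0)"
  and E_UNIV: "u \<in> l2 \<Longrightarrow> E UNIV u = u"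
  and E_Int: "B \<in> sets borel \<Longrightarrow> C \<in> sets borel \<Longrightarrow> u \<in> l2 \<Longrightarrow> E B (E C u) = E (B \<inter> C) u"
  using pvm unfolding projection_valued_measure_def orthogonal_projection_def by simp_all

lemma E_countably_additive: "range F \<subseteq> sets borel \<Longrightarrow> disjoint_family F \<Longrightarrow> u \<in> l2 \<Longrightarrow>
    (\<lambda>N. l2_norm (\<lambda>n. E (\<Union>i. F i) u n - (\<Sum>i<N. E (F i) u n))) \<longlonglongrightarrow> 0" for F :: "nat \<Rightarrow> real set"
  using pvm unfolding projection_valued_measure_def by simp

lemma E_commute:
  assumes "B \<in> sets borel" "C \<in> sets borel" "u \<in> l2"
  shows "E B (E C u) = E C (E B u)"
  unfolding E_Int[OF assms] E_Int[OF assms(2,1,3)] by (simp add: Int_commute)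

definition mass :: "(nat \<Rightarrow> complex) \<Rightarrow> real set \<Rightarrow> real" where
  "mass u B = Re (l2_inner (E B u) u)"

lemma inner_E: assumes "B \<in> sets borel" "u \<in> l2"
  shows "l2_inner (E B u) u = of_real (mass u B)" "0 \<le> mass u B"
proof -
  have "l2_inner (E B u) u = l2_inner (E B u) (E B u)"
    using E_selfadjoint[OF assms(1) E_l2[OF assms] assms(2)] unfolding E_idem[OF assms] .
  also have "\<dots> = of_real ((l2_norm (E B u))\<^sup>2)" by (intro l2_inner_self E_l2 assms)
  finally show "l2_inner (E B u) u = of_real (mass u B)" "0 \<le> mass u B" unfolding mass_def by auto
qed

text \<open>
  Strong additivity of the projections passes to the scalar measure by the Cauchy-Schwarz
  inequality, because the defect of the masses is the inner product of the defect vector with \<open>u\<close>.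
\<close>

lemma mass_sums:
  assumes F: "range F \<subseteq> sets borel" "disjoint_family F" and u: "u \<in> l2"
  shows "(\<lambda>i. mass u (F i)) sums mass u (\<Union>i. F i)"
proof -
  have FB: "F i \<in> sets borel" for i using F by auto
  have UB: "(\<Union>i. F i) \<in> sets borel" using FB by auto
  let ?d = "\<lambda>N n. E (\<Union>i. F i) u n - (\<Sum>i<N. E (F i) u n)"
  have s: "(\<lambda>n. \<Sum>i<N. E (F i) u n) \<in> l2" for N by (intro l2_sum E_l2 FB u) auto
  have inner_s: "l2_inner (\<lambda>n. \<Sum>i<N. E (F i) u n) u = of_real (\<Sum>i<N. mass u (F i))" for N
  proof (induction N)
    case 0 then show ?case by (simp add: l2_inner_zero)
  next
    case (Suc N)
    have "l2_inner (\<lambda>n. 1 * E (F N) u n + (\<Sum>i<N. E (F i) u n)) u = 1 * l2_inner (E (F N) u) u + l2_inner (\<lambda>n. \<Sum>i<N. E (F i) u n) u"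
      by (intro l2_inner_lincomb E_l2 FB u s)
    then show ?case using Suc inner_E(1)[OF FB u, of N] by (simp add: add.commute)
  qed
  have d: "?d N \<in> l2" "l2_inner (?d N) u = of_real (mass u (\<Union>i. F i) - (\<Sum>i<N. mass u (F i)))" for N
  proof -
    have eq: "?d N = (\<lambda>n. (-1) * (\<Sum>i<N. E (F i) u n) + E (\<Union>i. F i) u n)" by auto
    show "?d N \<in> l2" unfolding eq by (intro l2_lincomb s E_l2 UB u)
    have "l2_inner (?d N) u = (-1) * l2_inner (\<lambda>n. \<Sum>i<N. E (F i) u n) u + l2_inner (E (\<Union>i. F i) u) u"
      unfolding eq by (intro l2_inner_lincomb s E_l2 UB u)
    then show "l2_inner (?d N) u = of_real (mass u (\<Union>i. F i) - (\<Sum>i<N. mass u (F i)))"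
      unfolding inner_s inner_E(1)[OF UB u] by simp
  qed
  have "(\<lambda>N. mass u (\<Union>i. F i) - (\<Sum>i<N. mass u (F i))) \<longlonglongrightarrow> 0"
  proof (rule Lim_null_comparison)
    show "\<forall>\<^sub>F N in sequentially. norm (mass u (\<Union>i. F i) - (\<Sum>i<N. mass u (F i))) \<le> l2_norm (?d N) * l2_norm u"
    proof (intro always_eventually allI)
      fix N
      show "norm (mass u (\<Union>i. F i) - (\<Sum>i<N. mass u (F i))) \<le> l2_norm (?d N) * l2_norm u"
        using l2_cauchy_schwarz[OF d(1) u, of N] unfolding d(2) by (simp only: norm_of_real real_norm_def)
    qed
    show "(\<lambda>N. l2_norm (?d N) * l2_norm u) \<longlonglongrightarrow> 0"
      using tendsto_mult_left_zero[OF E_countably_additive[OF F u]] by simp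
  qed
  then have "(\<lambda>N. mass u (\<Union>i. F i) - (mass u (\<Union>i. F i) - (\<Sum>i<N. mass u (F i)))) \<longlonglongrightarrow> mass u (\<Union>i. F i) - 0"
    by (intro tendsto_diff tendsto_const)
  then show ?thesis unfolding sums_def by simp
qed

lemma sets_scalar [simp, measurable_cong]: "sets (scalar_measure E u) = sets borel"
  unfolding scalar_measure_def using sets.sigma_sets_eq[of "borel :: real measure"] by (simp add: sets_measure_of_conv)

lemma space_scalar [simp]: "space (scalar_measure E u) = UNIV"
  unfolding scalar_measure_def by (simp add: space_measure_of_conv)

lemma emeasure_scalar:
  assumes u: "u \<in> l2" and B: "B \<in> sets borel"
  shows "emeasure (scalar_measure E u) B = ennreal (mass u B)"
  unfolding mass_def
proof (rule emeasure_measure_of[OF scalar_measure_def])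
  show "positive (sets (scalar_measure E u)) (\<lambda>B. ennreal (Re (l2_inner (E B u) u)))"
    unfolding positive_def using u by (simp add: E_empty l2_inner_zero)
  show "countably_additive (sets (scalar_measure E u)) (\<lambda>B. ennreal (Re (l2_inner (E B u) u)))"
  proof (rule countably_additiveI)
    fix F :: "nat \<Rightarrow> real set"
    assume F: "range F \<subseteq> sets (scalar_measure E u)" "disjoint_family F"
    have "(\<Sum>i. ennreal (mass u (F i))) = ennreal (mass u (\<Union>i. F i))"
      by (rule suminf_ennreal_eq[OF inner_E(2)[OF _ u] mass_sums[OF _ F(2) u]]) (use F in auto)
    then show "(\<Sum>i. ennreal (Re (l2_inner (E (F i) u) u))) = ennreal (Re (l2_inner (E (\<Union> (range F)) u) u))"
      unfolding mass_def .
  qed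
qed (use B in auto)

lemma measure_scalar:
  assumes "u \<in> l2" "B \<in> sets borel" shows "measure (scalar_measure E u) B = mass u B"
  unfolding measure_def emeasure_scalar[OF assms] using inner_E(2)[OF assms(2,1)] by simp

lemma finite_measure_scalar: assumes "u \<in> l2" shows "finite_measure (scalar_measure E u)"
  by (rule finite_measureI) (use emeasure_scalar[OF assms, of UNIV] in simp)

lemma scalar_measure_eqI:
  assumes "u \<in> l2" "v \<in> l2" "\<And>B. B \<in> sets borel \<Longrightarrow> mass u B = mass v B"
  shows "scalar_measure E u = scalar_measure E v"
  by (rule measure_eqI) (use emeasure_scalar assms in auto)

text \<open>
  Finite additivity, from the sequence \<open>B, - B, {}, {}, \<dots>\<close>: its partial sums are eventually
  constant, so their defect vector has norm zero.
\<close>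

lemma E_compl:
  assumes B: "B \<in> sets borel" and u: "u \<in> l2"
  shows "u = (\<lambda>n. 1 * E (- B) u n + E B u n)"
proof -
  define F where "F = (\<lambda>i::nat. if i = 0 then B else if i = 1 then - B else {})"
  have F: "range F \<subseteq> sets borel" "disjoint_family F" "(\<Union>i. F i) = UNIV"
  proof -
    show "range F \<subseteq> sets borel" unfolding F_def using B by auto
    show "disjoint_family F" unfolding F_def disjoint_family_on_def by auto
    have "F 0 \<union> F 1 = UNIV" unfolding F_def by auto
    then show "(\<Union>i. F i) = UNIV" by blast
  qed
  let ?d = "\<lambda>n. E UNIV u n - (E B u n + E (- B) u n)"
  have "l2_norm (\<lambda>n. E UNIV u n - (\<Sum>i<N. E (F i) u n)) = l2_norm ?d" if "2 \<le> N" for N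
  proof -
    have "(\<Sum>i<N. E (F i) u n) = (\<Sum>i\<in>{0,1}. E (F i) u n)" for n
      by (rule sum.mono_neutral_right) (use that in \<open>auto simp: F_def E_empty[OF u]\<close>)
    then show ?thesis by (simp add: F_def)
  qed
  then have "\<forall>\<^sub>F N in sequentially. l2_norm (\<lambda>n. E UNIV u n - (\<Sum>i<N. E (F i) u n)) = l2_norm ?d"
    unfolding eventually_sequentially by blast
  then have "(\<lambda>N. l2_norm ?d) \<longlonglongrightarrow> 0"
    using E_countably_additive[OF F(1,2) u] unfolding F(3) by (rule Lim_transform_eventually[rotated])
  then have "l2_norm ?d = 0" by (simp add: LIMSEQ_const_iff)
  moreover have "?d \<in> l2"
  proof -
    have "(\<lambda>n. (-1) * (1 * E B u n + E (- B) u n) + E UNIV u n) \<in> l2"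
      by (intro l2_lincomb E_l2 u) (use B in auto)
    moreover have "(\<lambda>n. (-1) * (1 * E B u n + E (- B) u n) + E UNIV u n) = ?d" by (auto simp: algebra_simps)
    ultimately show ?thesis by simp
  qed
  ultimately have "?d = (\<lambda>n. 0)" by (intro l2_norm_eq_0D)
  then have "?d n = 0" for n by metis
  then show ?thesis unfolding E_UNIV[OF u] by (auto simp: algebra_simps)
qed

lemma mass_E:
  assumes B: "B \<in> sets borel" and C: "C \<in> sets borel" and u: "u \<in> l2"
  shows "mass (E B u) C = mass u (B \<inter> C)"
proof -
  have "l2_inner (E C (E B u)) (E B u) = l2_inner (E B (E C (E B u))) u"
    by (rule E_selfadjoint[OF B E_l2[OF C E_l2[OF B u]] u, symmetric])
  also have "E B (E C (E B u)) = E (B \<inter> C) u" using assms by (simp add: E_Int E_l2 Int_commute)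
  finally show ?thesis unfolding mass_def by simp
qed

lemma scalar_measure_E:
  assumes B: "B \<in> sets borel" and u: "u \<in> l2"
  shows "scalar_measure E (E B u) = density (scalar_measure E u) (indicator B)"
proof (rule measure_eqI)
  fix C assume "C \<in> sets (scalar_measure E (E B u))"
  then have C: "C \<in> sets borel" by simp
  have "emeasure (density (scalar_measure E u) (indicator B)) C = (\<integral>\<^sup>+x. indicator B x * indicator C x \<partial>scalar_measure E u)"
    by (rule emeasure_density) (use B C in auto)
  also have "\<dots> = (\<integral>\<^sup>+x. indicator (B \<inter> C) x \<partial>scalar_measure E u)" by (simp add: indicator_inter_arith)
  also have "\<dots> = ennreal (mass u (B \<inter> C))" using B C emeasure_scalar[OF u] by simp
  finally show "emeasure (scalar_measure E (E B u)) C = emeasure (density (scalar_measure E u) (indicator B)) C"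
    using emeasure_scalar[OF E_l2[OF B u] C] mass_E[OF B C u] by simp
qed simp

lemma integral_scalar_E:
  fixes g :: "real \<Rightarrow> real"
  assumes B: "B \<in> sets borel" and u: "u \<in> l2" and g: "g \<in> borel_measurable borel"
  shows "(\<integral>x. g x \<partial>scalar_measure E (E B u)) = (\<integral>x. indicator B x * g x \<partial>scalar_measure E u)"
    and "integrable (scalar_measure E (E B u)) g \<longleftrightarrow> integrable (scalar_measure E u) (\<lambda>x. indicator B x * g x)"
  unfolding scalar_measure_E[OF B u] density_indicator_real using B g
  by (simp_all add: integral_density integrable_density)

end

section \<open>Operators represented by a spectral measure\<close>

text \<open>
  An identity between signed combinations of measures, arranged so that all terms are nonnegative,
  extends from sets to functions by the monotone class argument.
\<close>

lemma nn_integral_transfer: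
  fixes M1 M2 M :: "real measure"
  assumes [measurable_cong]: "sets M1 = sets borel" "sets M2 = sets borel" "sets M = sets borel"
    and [measurable]: "hn \<in> borel_measurable borel" "hp \<in> borel_measurable borel"
    and base: "\<And>C. C \<in> sets borel \<Longrightarrow>
      emeasure M1 C + (\<integral>\<^sup>+x. hn x * indicator C x \<partial>M) = emeasure M2 C + (\<integral>\<^sup>+x. hp x * indicator C x \<partial>M)"
    and g: "g \<in> borel_measurable borel"
  shows "(\<integral>\<^sup>+x. g x \<partial>M1) + (\<integral>\<^sup>+x. hn x * g x \<partial>M) = (\<integral>\<^sup>+x. g x \<partial>M2) + (\<integral>\<^sup>+x. hp x * g x \<partial>M)"
  using g
proof (induction rule: borel_measurable_induct)
  case (cong f g)
  then show ?case by simp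
next
  case (set A)
  then show ?case using base[of A] by simp
next
  case (mult u c)
  have [measurable]: "u \<in> borel_measurable borel" by fact
  have "(\<integral>\<^sup>+x. c * u x \<partial>M1) + (\<integral>\<^sup>+x. hn x * (c * u x) \<partial>M) = c * ((\<integral>\<^sup>+x. u x \<partial>M1) + (\<integral>\<^sup>+x. hn x * u x \<partial>M))"
    by (simp add: nn_integral_cmult distrib_left mult.left_commute[of _ c])
  also have "\<dots> = c * ((\<integral>\<^sup>+x. u x \<partial>M2) + (\<integral>\<^sup>+x. hp x * u x \<partial>M))" using mult by simp
  also have "\<dots> = (\<integral>\<^sup>+x. c * u x \<partial>M2) + (\<integral>\<^sup>+x. hp x * (c * u x) \<partial>M)"
    by (simp add: nn_integral_cmult distrib_left mult.left_commute[of _ c])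
  finally show ?case .
next
  case (add u v)
  have [measurable]: "u \<in> borel_measurable borel" "v \<in> borel_measurable borel" by fact+
  have "(\<integral>\<^sup>+x. v x + u x \<partial>M1) + (\<integral>\<^sup>+x. hn x * (v x + u x) \<partial>M)
    = ((\<integral>\<^sup>+x. v x \<partial>M1) + (\<integral>\<^sup>+x. hn x * v x \<partial>M)) + ((\<integral>\<^sup>+x. u x \<partial>M1) + (\<integral>\<^sup>+x. hn x * u x \<partial>M))"
    by (simp add: nn_integral_add distrib_left add_ac)
  also have "\<dots> = ((\<integral>\<^sup>+x. v x \<partial>M2) + (\<integral>\<^sup>+x. hp x * v x \<partial>M)) + ((\<integral>\<^sup>+x. u x \<partial>M2) + (\<integral>\<^sup>+x. hp x * u x \<partial>M))"
    using add by simp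
  also have "\<dots> = (\<integral>\<^sup>+x. v x + u x \<partial>M2) + (\<integral>\<^sup>+x. hp x * (v x + u x) \<partial>M)"
    by (simp add: nn_integral_add distrib_left add_ac)
  finally show ?case .
next
  case (seq U)
  have [measurable]: "U i \<in> borel_measurable borel" for i by fact
  have U: "incseq U" by fact
  have inc: "incseq (\<lambda>i. integral\<^sup>N M (U i))" for M :: "real measure"
    using U by (auto simp: incseq_def le_fun_def intro!: nn_integral_mono)
  have inc2: "incseq (\<lambda>i. \<integral>\<^sup>+x. h x * U i x \<partial>M)" for h
    using U by (auto simp: incseq_def le_fun_def intro!: nn_integral_mono mult_left_mono)
  have main: "(\<integral>\<^sup>+x. (SUP i. U i x) \<partial>M') + (\<integral>\<^sup>+x. h x * (SUP i. U i x) \<partial>M) = (SUP i. (\<integral>\<^sup>+x. U i x \<partial>M') + (\<integral>\<^sup>+x. h x * U i x \<partial>M))"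
    if [measurable_cong]: "sets M' = sets borel" and [measurable]: "h \<in> borel_measurable borel" for M' h
  proof -
    have "(\<integral>\<^sup>+x. (SUP i. U i x) \<partial>M') = (SUP i. \<integral>\<^sup>+x. U i x \<partial>M')"
      by (rule nn_integral_monotone_convergence_SUP[OF U]) simp
    moreover have "(\<integral>\<^sup>+x. h x * (SUP i. U i x) \<partial>M) = (SUP i. \<integral>\<^sup>+x. h x * U i x \<partial>M)"
    proof -
      have "(\<integral>\<^sup>+x. h x * (SUP i. U i x) \<partial>M) = (\<integral>\<^sup>+x. (SUP i. h x * U i x) \<partial>M)"
        by (simp add: SUP_mult_left_ennreal)
      also have "\<dots> = (SUP i. \<integral>\<^sup>+x. h x * U i x \<partial>M)"
        by (rule nn_integral_monotone_convergence_SUP) (use U in \<open>auto simp: incseq_def le_fun_def intro!: mult_left_mono\<close>)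
      finally show ?thesis .
    qed
    ultimately show ?thesis by (simp add: ennreal_SUP_add[OF inc inc2])
  qed
  have "(\<integral>\<^sup>+x. (SUP i. U i x) \<partial>M1) + (\<integral>\<^sup>+x. hn x * (SUP i. U i x) \<partial>M) = (\<integral>\<^sup>+x. (SUP i. U i x) \<partial>M2) + (\<integral>\<^sup>+x. hp x * (SUP i. U i x) \<partial>M)"
    using main[of M1 hn] main[of M2 hp] assms(1,2) seq.IH by simp
  then show ?case by (simp add: image_comp)
qed

text \<open>
  Here the base identity is \<open>M1 = M2 + 4 x M\<close> as signed measures. The factor \<open>4\<close> is the one of the
  polarization identity, from which the hypothesis comes in \<open>mass_T\<close>.
\<close>

lemma integral_id_transfer:
  fixes M1 M2 M :: "real measure"
  assumes s [measurable_cong, simp]: "sets M1 = sets borel" "sets M2 = sets borel" "sets M = sets borel"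
    and fin: "finite_measure M1" "finite_measure M2" "finite_measure M"
    and R: "0 \<le> R" and AE: "AE x in M1. \<bar>x\<bar> \<le> R" "AE x in M2. \<bar>x\<bar> \<le> R" "AE x in M. \<bar>x\<bar> \<le> R"
    and base: "\<And>C. C \<in> sets borel \<Longrightarrow> measure M1 C = measure M2 C + (\<integral>x. indicator C x * (4 * x) \<partial>M)"
  shows "(\<integral>x. x \<partial>M1) = (\<integral>x. x \<partial>M2) + 4 * (\<integral>x. x\<^sup>2 \<partial>M)"
proof -
  interpret M1: finite_measure M1 by fact
  interpret M2: finite_measure M2 by fact
  interpret M: finite_measure M by fact
  have sp: "space M1 = UNIV" "space M2 = UNIV" "space M = UNIV"
    using sets_eq_imp_space_eq[OF s(1)] sets_eq_imp_space_eq[OF s(2)] sets_eq_imp_space_eq[OF s(3)] by auto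
  have i1: "integrable M1 (\<lambda>x. x)" by (rule M1.integrable_const_bound[of _ R]) (use AE in auto)
  have i2: "integrable M2 (\<lambda>x. x)" by (rule M2.integrable_const_bound[of _ R]) (use AE in auto)
  have i: "integrable M (\<lambda>x. x)" by (rule M.integrable_const_bound[of _ R]) (use AE in auto)
  have isq: "integrable M (\<lambda>x. x\<^sup>2)"
  proof (rule M.integrable_const_bound[of _ "R\<^sup>2"])
    show "AE x in M. norm (x\<^sup>2) \<le> R\<^sup>2" using AE(3)
    proof eventually_elim
      case (elim x) show ?case using power_mono[OF elim abs_ge_zero, of 2] by simp
    qed
  qed simp
  have ic: "integrable M (\<lambda>x. indicator C x * (4 * x))" if "C \<in> sets borel" for C
    using integrable_real_mult_indicator[OF _ integrable_mult_right[OF i, of 4], of C] that by (simp add: mult.commute)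
  \<comment> \<open>Adding \<open>R\<close> to \<open>x\<close> and \<open>4 R\<close> to the density makes every integrand nonnegative.\<close>
  define hp where "hp = (\<lambda>x. ennreal (4 * x + 4 * R))"
  define hn where "hn = (\<lambda>x::real. ennreal (4 * R))"
  define g where "g = (\<lambda>x. ennreal (x + R))"
  have [measurable]: "hp \<in> borel_measurable borel" "hn \<in> borel_measurable borel" "g \<in> borel_measurable borel"
    unfolding hp_def hn_def g_def by auto
  have nn: "\<And>M. AE x in M. \<bar>x\<bar> \<le> R \<Longrightarrow> AE x in M. 0 \<le> x + R" by (auto elim: eventually_mono)
  have eN: "(\<integral>\<^sup>+x. ennreal (h x) \<partial>N) = ennreal (\<integral>x. h x \<partial>N)" "0 \<le> (\<integral>x. h x \<partial>N)"
    if "integrable N h" "AE x in N. 0 \<le> h x" for N and h :: "real \<Rightarrow> real"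
    using that by (auto intro: nn_integral_eq_integral integral_nonneg_AE)
  have base': "emeasure M1 C + (\<integral>\<^sup>+x. hn x * indicator C x \<partial>M) = emeasure M2 C + (\<integral>\<^sup>+x. hp x * indicator C x \<partial>M)"
    if C[measurable]: "C \<in> sets borel" for C
  proof -
    define h where "h = (\<lambda>x. indicator C x * (4 * x) + 4 * R * indicator C x)"
    have iC: "integrable M (\<lambda>x. 4 * R * indicator C x)"
      by (simp add: M.emeasure_eq_measure)
    have h: "integrable M h" unfolding h_def by (intro Bochner_Integration.integrable_add ic iC C)
    have hR: "(\<integral>x. h x \<partial>M) = (\<integral>x. indicator C x * (4 * x) \<partial>M) + 4 * R * measure M C"
      unfolding h_def using Bochner_Integration.integral_add[OF ic[OF C] iC] sp by simp
    have h0: "AE x in M. 0 \<le> h x" using nn[OF AE(3)] unfolding h_def by (auto elim!: eventually_mono simp: indicator_def)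
    have "(\<integral>\<^sup>+x. hn x * indicator C x \<partial>M) = ennreal (4 * R * measure M C)"
      unfolding hn_def by (simp add: nn_integral_cmult M.emeasure_eq_measure ennreal_mult R)
    moreover have "(\<integral>\<^sup>+x. hp x * indicator C x \<partial>M) = ennreal ((\<integral>x. indicator C x * (4 * x) \<partial>M) + 4 * R * measure M C)"
    proof -
      have "(\<integral>\<^sup>+x. hp x * indicator C x \<partial>M) = (\<integral>\<^sup>+x. ennreal (h x) \<partial>M)"
        unfolding hp_def h_def by (intro nn_integral_cong) (auto simp: indicator_def)
      then show ?thesis using eN(1)[OF h h0] unfolding hR by simp
    qed
    moreover have "0 \<le> (\<integral>x. indicator C x * (4 * x) \<partial>M) + 4 * R * measure M C"
      using eN(2)[OF h h0] unfolding hR .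
    moreover have "ennreal (measure M1 C) + ennreal (4 * R * measure M C) = ennreal (measure M1 C + 4 * R * measure M C)"
      by (rule ennreal_plus[symmetric]) (use R in auto)
    moreover have "measure M1 C + 4 * R * measure M C = measure M2 C + ((\<integral>x. indicator C x * (4 * x) \<partial>M) + 4 * R * measure M C)"
      using base[OF C] by simp
    ultimately show ?thesis
      by (simp only: M1.emeasure_eq_measure M2.emeasure_eq_measure ennreal_plus measure_nonneg)
  qed
  have t: "(\<integral>\<^sup>+x. g x \<partial>M1) + (\<integral>\<^sup>+x. hn x * g x \<partial>M) = (\<integral>\<^sup>+x. g x \<partial>M2) + (\<integral>\<^sup>+x. hp x * g x \<partial>M)"
    by (rule nn_integral_transfer[OF s _ _ base']) auto
  have j1: "integrable M1 (\<lambda>x. x + R)" and j2: "integrable M2 (\<lambda>x. x + R)" and j: "integrable M (\<lambda>x. x + R)"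
    using i1 i2 i by auto
  have e1: "(\<integral>\<^sup>+x. g x \<partial>M1) = ennreal (\<integral>x. x + R \<partial>M1)" "0 \<le> (\<integral>x. x + R \<partial>M1)"
    unfolding g_def using eN[OF j1 nn[OF AE(1)]] by auto
  have e2: "(\<integral>\<^sup>+x. g x \<partial>M2) = ennreal (\<integral>x. x + R \<partial>M2)" "0 \<le> (\<integral>x. x + R \<partial>M2)"
    unfolding g_def using eN[OF j2 nn[OF AE(2)]] by auto
  define p where "p = (\<lambda>x::real. 4 * R * (x + R))"
  define q where "q = (\<lambda>x::real. 4 * x\<^sup>2 + 8 * R * x + 4 * R\<^sup>2)"
  have jp: "integrable M p" "integrable M q" unfolding p_def q_def using j i isq by auto
  have p0: "AE x in M. 0 \<le> p x" using nn[OF AE(3)] R unfolding p_def by (auto elim!: eventually_mono)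
  have qq: "q x = 4 * (x + R)\<^sup>2" for x unfolding q_def by (simp add: power2_eq_square algebra_simps)
  have q0: "AE x in M. 0 \<le> q x" unfolding qq by simp
  have "(\<integral>\<^sup>+x. hn x * g x \<partial>M) = (\<integral>\<^sup>+x. ennreal (p x) \<partial>M)"
    by (rule nn_integral_cong_AE) (use nn[OF AE(3)] R in \<open>auto elim!: eventually_mono simp: hn_def g_def p_def ennreal_mult\<close>)
  then have e3: "(\<integral>\<^sup>+x. hn x * g x \<partial>M) = ennreal (\<integral>x. p x \<partial>M)" "0 \<le> (\<integral>x. p x \<partial>M)"
    using eN[OF jp(1) p0] by auto
  have "(\<integral>\<^sup>+x. hp x * g x \<partial>M) = (\<integral>\<^sup>+x. ennreal (q x) \<partial>M)"
  proof (rule nn_integral_cong_AE)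
    show "AE x in M. hp x * g x = ennreal (q x)" using nn[OF AE(3)]
    proof eventually_elim
      case (elim x)
      have "ennreal ((4 * x + 4 * R) * (x + R)) = ennreal (4 * x + 4 * R) * ennreal (x + R)"
        by (rule ennreal_mult) (use elim in auto)
      moreover have "(4 * x + 4 * R) * (x + R) = q x" unfolding q_def by (simp add: power2_eq_square algebra_simps)
      ultimately show ?case unfolding hp_def g_def by simp
    qed
  qed
  then have e4: "(\<integral>\<^sup>+x. hp x * g x \<partial>M) = ennreal (\<integral>x. q x \<partial>M)" "0 \<le> (\<integral>x. q x \<partial>M)"
    using eN[OF jp(2) q0] by auto
  have main: "(\<integral>x. x + R \<partial>M1) + (\<integral>x. p x \<partial>M) = (\<integral>x. x + R \<partial>M2) + (\<integral>x. q x \<partial>M)"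
    using t e1(2) e2(2) e3(2) e4(2) unfolding e1(1) e2(1) e3(1) e4(1) by (simp flip: ennreal_plus)
  have c1: "(\<integral>x. x + R \<partial>M1) = (\<integral>x. x \<partial>M1) + R * measure M1 UNIV" using i1 sp by simp
  have c2: "(\<integral>x. x + R \<partial>M2) = (\<integral>x. x \<partial>M2) + R * measure M2 UNIV" using i2 sp by simp
  have c3: "(\<integral>x. p x \<partial>M) = 4 * R * (\<integral>x. x \<partial>M) + 4 * R\<^sup>2 * measure M UNIV"
    unfolding p_def using i sp by (simp add: power2_eq_square algebra_simps)
  have c4: "(\<integral>x. q x \<partial>M) = 4 * (\<integral>x. x\<^sup>2 \<partial>M) + 8 * R * (\<integral>x. x \<partial>M) + 4 * R\<^sup>2 * measure M UNIV"
    unfolding q_def using i isq sp by simp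
  have c5: "R * measure M1 UNIV = R * measure M2 UNIV + 4 * R * (\<integral>x. x \<partial>M)"
    using base[of UNIV] by (simp add: distrib_left)
  show ?thesis using main unfolding c1 c2 c3 c4 c5 by simp
qed

text \<open>
  The definition of a spectral measure only speaks about the quadratic form of \<open>T\<close>. Everything
  below recovers operator statements from it by polarization.
\<close>

locale spectral_operator = pvm +
  fixes D :: "(nat \<Rightarrow> complex) set" and T :: "(nat \<Rightarrow> complex) \<Rightarrow> (nat \<Rightarrow> complex)"
  assumes spectral: "is_spectral_measure E D T"
    and D_lincomb: "u \<in> D \<Longrightarrow> v \<in> D \<Longrightarrow> (\<lambda>n. a * u n + v n) \<in> D"
    and T_l2: "u \<in> D \<Longrightarrow> T u \<in> l2"
    and T_lincomb: "u \<in> D \<Longrightarrow> v \<in> D \<Longrightarrow> T (\<lambda>n. a * u n + v n) = (\<lambda>n. a * T u n + T v n)"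
begin

abbreviation \<sigma> :: "(nat \<Rightarrow> complex) \<Rightarrow> real measure" where "\<sigma> u \<equiv> scalar_measure E u"

lemma dom_iff: "u \<in> D \<longleftrightarrow> u \<in> l2 \<and> integrable (\<sigma> u) (\<lambda>x. x\<^sup>2)"
  and form: "u \<in> D \<Longrightarrow> l2_inner (T u) u = of_real (\<integral>x. x \<partial>\<sigma> u)"
  using spectral unfolding is_spectral_measure_def by auto

lemma dom_l2: "u \<in> D \<Longrightarrow> u \<in> l2" using dom_iff by simp

lemma dom_E:
  assumes B: "B \<in> sets borel" and u: "u \<in> D" shows "E B u \<in> D"
proof -
  have "integrable (\<sigma> u) (\<lambda>x. indicator B x * x\<^sup>2)"
    using integrable_real_mult_indicator[of B "\<sigma> u" "\<lambda>x. x\<^sup>2"] u B dom_iff by (simp add: mult.commute)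
  then show ?thesis
    using dom_l2[OF u] B by (simp add: dom_iff E_l2 integral_scalar_E(2))
qed

lemma dom_E_bounded:
  assumes B: "B \<in> sets borel" "B \<subseteq> {-R..R}" and u: "u \<in> l2" shows "E B u \<in> D"
proof -
  interpret finite_measure "\<sigma> u" by (rule finite_measure_scalar[OF u])
  have "integrable (\<sigma> u) (\<lambda>x. indicator B x * x\<^sup>2)"
  proof (rule integrable_const_bound[of _ "R\<^sup>2"])
    show "AE x in \<sigma> u. norm (indicator B x * x\<^sup>2) \<le> R\<^sup>2"
    proof (rule AE_I2)
      fix x
      show "norm (indicator B x * x\<^sup>2) \<le> R\<^sup>2"
      proof (cases "x \<in> B")
        case True
        then have "\<bar>x\<bar> \<le> R" using B by (auto simp: abs_le_iff)
        then show ?thesis using power_mono[of "\<bar>x\<bar>" R 2] True by simp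
      qed auto
    qed
  qed (use B in simp)
  then show ?thesis using B u by (simp add: dom_iff E_l2 integral_scalar_E(2))
qed

text \<open>
  For \<open>w = a u + v\<close> with \<open>|a| = 1\<close> the measure of \<open>w\<close> does not depend on \<open>a\<close>, because the two
  vectors are separated by \<open>E B\<close>. Hence neither does the form at \<open>w\<close>, and the cross terms vanish. This
  replaces the statement that \<open>T\<close> commutes with \<open>E B\<close>.
\<close>

lemma T_orthogonal:
  assumes u: "u \<in> D" and v: "v \<in> D" and B: "B \<in> sets borel" and Ev: "E B v = v" and Eu: "E B u = (\<lambda>n. 0)"
  shows "l2_inner (T v) u = 0" "l2_inner (T u) v = 0"
proof -
  note l = dom_l2[OF u] dom_l2[OF v] T_l2[OF u] T_l2[OF v]
  let ?w = "\<lambda>a n. a * u n + v n"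
  have mass: "mass (?w a) C = (cmod a)\<^sup>2 * mass u C + mass v C" if C: "C \<in> sets borel" for a C
  proof -
    have "l2_inner (E C v) u = l2_inner (E C (E B v)) u" using Ev by simp
    also have "\<dots> = l2_inner (E B (E C v)) u" using E_commute[OF C B l(2)] by simp
    also have "\<dots> = l2_inner (E C v) (E B u)" by (rule E_selfadjoint[OF B E_l2[OF C l(2)] l(1)])
    also have "\<dots> = 0" unfolding Eu by (rule l2_inner_zero)
    finally have 1: "l2_inner (E C v) u = 0" .
    have "l2_inner (E C u) v = l2_inner u (E C v)" by (rule E_selfadjoint[OF C l(1,2)])
    also have "\<dots> = cnj (l2_inner (E C v) u)" by (rule l2_inner_cnj[OF E_l2[OF C l(2)] l(1)])
    finally have 2: "l2_inner (E C u) v = 0" using 1 by simp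
    have "l2_inner (E C (?w a)) (?w a) = of_real ((cmod a)\<^sup>2) * l2_inner (E C u) u + l2_inner (E C v) v"
      unfolding E_lincomb[OF C l(1,2)] l2_inner_lincomb_lincomb[OF l(1,2) E_l2[OF C l(1)] E_l2[OF C l(2)]] 1 2 by simp
    then show ?thesis unfolding mass_def by simp
  qed
  have q: "l2_inner (T (?w a)) (?w a) = of_real ((cmod a)\<^sup>2) * l2_inner (T u) u + a * l2_inner (T u) v + cnj a * l2_inner (T v) u + l2_inner (T v) v" for a
    unfolding T_lincomb[OF u v] by (rule l2_inner_lincomb_lincomb[OF l])
  have same: "l2_inner (T (?w a)) (?w a) = l2_inner (T (?w a')) (?w a')" if "cmod a = cmod a'" for a a'
  proof -
    have "\<sigma> (?w a) = \<sigma> (?w a')"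
      by (intro scalar_measure_eqI l2_lincomb l) (use mass that in auto)
    then show ?thesis using form D_lincomb u v by simp
  qed
  \<comment> \<open>The choices \<open>a = 1, -1\<close> give the sum of the cross terms, \<open>a = \<i>, -\<i>\<close> their difference.\<close>
  have "2 * (l2_inner (T u) v + l2_inner (T v) u) = 0" using same[of 1 "-1"] unfolding q by (simp add: algebra_simps)
  then have a: "l2_inner (T u) v + l2_inner (T v) u = 0" by (metis mult_eq_0_iff zero_neq_numeral)
  have b: "\<i> * (l2_inner (T u) v - l2_inner (T v) u) = 0" using same[of \<i> "-\<i>"] unfolding q by (simp add: algebra_simps)
  show "l2_inner (T v) u = 0" "l2_inner (T u) v = 0" using a b by (auto simp: add_eq_0_iff)
qed

lemma T_symmetric:
  assumes u: "u \<in> D" and v: "v \<in> D" shows "l2_inner (T v) u = cnj (l2_inner (T u) v)"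
proof -
  note l = dom_l2[OF u] dom_l2[OF v] T_l2[OF u] T_l2[OF v]
  let ?w = "\<lambda>a n. a * u n + v n"
  have q: "l2_inner (T (?w a)) (?w a) = of_real ((cmod a)\<^sup>2) * l2_inner (T u) u + a * l2_inner (T u) v + cnj a * l2_inner (T v) u + l2_inner (T v) v" for a
    unfolding T_lincomb[OF u v] by (rule l2_inner_lincomb_lincomb[OF l])
  have im: "Im (l2_inner (T w) w) = 0" if "w \<in> D" for w using form[OF that] by simp
  have "Im (l2_inner (T (?w a)) (?w a)) = 0" for a by (rule im[OF D_lincomb[OF u v]])
  then have "Im (a * l2_inner (T u) v + cnj a * l2_inner (T v) u) = 0" for a
    unfolding q using im[OF u] im[OF v] by (simp add: algebra_simps)
  from this[of 1] this[of \<i>] show ?thesis by (simp add: complex_eq_iff)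
qed

lemma E_split:
  assumes "B \<in> sets borel" "u \<in> D" and that: "v \<in> l2"
  shows "l2_inner (T u) v = l2_inner (T (E (- B) u)) v + l2_inner (T (E B u)) v"
proof -
  have B': "- B \<in> sets borel" using assms by simp
  have d: "E (- B) u \<in> D" "E B u \<in> D" using dom_E assms B' by auto
  have "T u = (\<lambda>n. 1 * T (E (- B) u) n + T (E B u) n)"
    using E_compl[OF assms(1) dom_l2[OF assms(2)]] T_lincomb[OF d, of 1] by metis
  then show ?thesis using l2_inner_lincomb[OF T_l2[OF d(1)] T_l2[OF d(2)] that, of 1] by simp
qed

lemma inner_T_E:
  assumes u: "u \<in> D" and B: "B \<in> sets borel"
  shows "l2_inner (T u) (E B u) = of_real (\<integral>x. indicator B x * x \<partial>\<sigma> u)"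
proof -
  have B': "- B \<in> sets borel" using B by simp
  have ul: "u \<in> l2" by (rule dom_l2[OF u])
  have d: "E (- B) u \<in> D" "E B u \<in> D" using dom_E u B B' by auto
  have "l2_inner (T (E (- B) u)) (E B u) = 0"
    by (rule T_orthogonal[OF d(1) d(2) B])
      (use E_Int[OF B B' ul] E_empty[OF ul] E_idem[OF B ul] in auto)
  then have "l2_inner (T u) (E B u) = l2_inner (T (E B u)) (E B u)"
    using E_split[OF B u dom_l2[OF d(2)]] by simp
  also have "\<dots> = of_real (\<integral>x. indicator B x * x \<partial>\<sigma> u)"
    unfolding form[OF d(2)] using integral_scalar_E(1)[OF B ul, of "\<lambda>x. x"] by simp
  finally show ?thesis .
qed

lemma AE_scalar_E:
  assumes "B \<in> sets borel" "B \<subseteq> {-R..R}" "u \<in> l2" shows "AE x in \<sigma> (E B u). \<bar>x\<bar> \<le> R"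
  unfolding scalar_measure_E[OF assms(1,3)] density_indicator_real
  by (subst AE_density) (use assms in \<open>auto simp: indicator_def abs_le_iff intro!: AE_I2\<close>)

text \<open>
  With \<open>v = E B u\<close> and \<open>w = E B (T u)\<close> the left side is the form \<open>\<langle>T v, w\<rangle>\<close>, a quarter of the
  difference of the forms at \<open>v + w\<close> and \<open>v - w\<close>. The measures of these two vectors differ by
  \<open>4 x\<close> times the measure of \<open>v\<close>, according to \<open>inner_T_E\<close>, and so their first moments differ by four
  times the second moment of \<open>v\<close>. Boundedness of \<open>B\<close> puts \<open>w\<close> into the domain.
\<close>

lemma mass_T:
  assumes u: "u \<in> D" and B: "B \<in> sets borel" "B \<subseteq> {-R..R}" and R: "0 \<le> R"
  shows "mass (T u) B = (\<integral>x. indicator B x * x\<^sup>2 \<partial>\<sigma> u)"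
proof -
  define v where "v = E B u"
  define w where "w = E B (T u)"
  have B': "- B \<in> sets borel" using B by simp
  have l: "u \<in> l2" "T u \<in> l2" using dom_l2[OF u] T_l2[OF u] by auto
  have d: "v \<in> D" "w \<in> D" "E (- B) u \<in> D" unfolding v_def w_def using dom_E[OF _ u] dom_E_bounded B B' l by auto
  have dl: "v \<in> l2" "w \<in> l2" "T v \<in> l2" "T w \<in> l2" using dom_l2 T_l2 d by auto
  have Ev: "E B v = v" "E B w = w" unfolding v_def w_def using E_idem B l by auto
  have "l2_inner (T (E (- B) u)) w = 0"
    by (rule T_orthogonal(2)[OF d(3) d(2) B(1) Ev(2)])
      (use E_Int[OF B(1) B' l(1)] E_empty[OF l(1)] in auto)
  then have 1: "l2_inner (T u) w = l2_inner (T v) w"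
    using E_split[OF B(1) u dl(2)] unfolding v_def by simp
  have "l2_inner (T u) w = l2_inner (E B (T u)) (T u)"
    unfolding w_def by (rule E_selfadjoint[OF B(1) l(2) l(2), symmetric])
  then have 2: "mass (T u) B = Re (l2_inner (T v) w)" unfolding 1 mass_def by simp
  let ?p = "\<lambda>n. 1 * w n + v n" and ?m = "\<lambda>n. (-1) * w n + v n"
  have pm: "?p \<in> D" "?m \<in> D" by (intro D_lincomb d)+
  have pml: "?p \<in> l2" "?m \<in> l2" using pm dom_l2 by auto
  have "l2_inner (T ?p) ?p - l2_inner (T ?m) ?m = 2 * (l2_inner (T w) v + l2_inner (T v) w)"
    unfolding T_lincomb[OF d(2,1)] l2_inner_lincomb_lincomb[OF dl(2,1,4,3)] by simp
  also have "l2_inner (T w) v = cnj (l2_inner (T v) w)" by (rule T_symmetric[OF d(1,2)])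
  finally have "Re (l2_inner (T ?p) ?p) - Re (l2_inner (T ?m) ?m) = 4 * Re (l2_inner (T v) w)"
    by (simp add: complex_eq_iff)
  then have 3: "4 * Re (l2_inner (T v) w) = (\<integral>x. x \<partial>\<sigma> ?p) - (\<integral>x. x \<partial>\<sigma> ?m)"
    unfolding form[OF pm(1)] form[OF pm(2)] by simp
  have base: "measure (\<sigma> ?p) C = measure (\<sigma> ?m) C + (\<integral>x. indicator C x * (4 * x) \<partial>\<sigma> v)" if C: "C \<in> sets borel" for C
  proof -
    have CB: "C \<inter> B \<in> sets borel" using C B by simp
    have "l2_inner (E C v) w = l2_inner (E B (E C v)) (T u)"
      unfolding w_def by (rule E_selfadjoint[OF B(1) E_l2[OF C dl(1)] l(2), symmetric])
    also have "E B (E C v) = E (C \<inter> B) u"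
      unfolding v_def using E_Int[OF C B(1) l(1)] E_Int[OF B(1) CB l(1)] by (simp add: Int_commute)
    also have "l2_inner (E (C \<inter> B) u) (T u) = cnj (l2_inner (T u) (E (C \<inter> B) u))"
      by (rule l2_inner_cnj[OF l(2) E_l2[OF CB l(1)]])
    also have "\<dots> = of_real (\<integral>x. indicator (C \<inter> B) x * x \<partial>\<sigma> u)" unfolding inner_T_E[OF u CB] by simp
    also have "(\<integral>x. indicator (C \<inter> B) x * x \<partial>\<sigma> u) = (\<integral>x. indicator B x * (indicator C x * x) \<partial>\<sigma> u)"
      by (rule Bochner_Integration.integral_cong) (auto simp: indicator_def)
    also have "\<dots> = (\<integral>x. indicator C x * x \<partial>\<sigma> v)"
      unfolding v_def by (rule integral_scalar_E(1)[OF B(1) l(1), symmetric]) (use C in simp)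
    finally have x: "l2_inner (E C v) w = of_real (\<integral>x. indicator C x * x \<partial>\<sigma> v)" .
    have "l2_inner (E C w) v = l2_inner w (E C v)" by (rule E_selfadjoint[OF C dl(2,1)])
    also have "\<dots> = cnj (l2_inner (E C v) w)" by (rule l2_inner_cnj[OF E_l2[OF C dl(1)] dl(2)])
    finally have y: "l2_inner (E C w) v = of_real (\<integral>x. indicator C x * x \<partial>\<sigma> v)" unfolding x by simp
    have "l2_inner (E C ?p) ?p = l2_inner (E C ?m) ?m + 4 * of_real (\<integral>x. indicator C x * x \<partial>\<sigma> v)"
      unfolding E_lincomb[OF C dl(2,1)] l2_inner_lincomb_lincomb[OF dl(2,1) E_l2[OF C dl(2)] E_l2[OF C dl(1)]] x y
      by simp
    then have "mass ?p C = mass ?m C + 4 * (\<integral>x. indicator C x * x \<partial>\<sigma> v)" unfolding mass_def by simp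
    also have "4 * (\<integral>x. indicator C x * x \<partial>\<sigma> v) = (\<integral>x. indicator C x * (4 * x) \<partial>\<sigma> v)"
      by (subst Bochner_Integration.integral_mult_right_zero[symmetric], rule Bochner_Integration.integral_cong) auto
    finally show ?thesis unfolding measure_scalar[OF pml(1) C] measure_scalar[OF pml(2) C] .
  qed
  have Epm: "?p = E B ?p" "?m = E B ?m"
    using E_lincomb[OF B(1) dl(2,1), of 1] E_lincomb[OF B(1) dl(2,1), of "-1"] Ev by auto
  have ae: "AE x in \<sigma> ?p. \<bar>x\<bar> \<le> R" "AE x in \<sigma> ?m. \<bar>x\<bar> \<le> R" "AE x in \<sigma> v. \<bar>x\<bar> \<le> R"
    using AE_scalar_E[OF B pml(1)] AE_scalar_E[OF B pml(2)] AE_scalar_E[OF B l(1)]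
    unfolding Epm[symmetric] v_def[symmetric] by auto
  have "(\<integral>x. x \<partial>\<sigma> ?p) = (\<integral>x. x \<partial>\<sigma> ?m) + 4 * (\<integral>x. x\<^sup>2 \<partial>\<sigma> v)"
    by (rule integral_id_transfer[OF sets_scalar sets_scalar sets_scalar finite_measure_scalar[OF pml(1)]
      finite_measure_scalar[OF pml(2)] finite_measure_scalar[OF dl(1)] R ae base])
  then have "Re (l2_inner (T v) w) = (\<integral>x. x\<^sup>2 \<partial>\<sigma> v)" using 3 by simp
  then show ?thesis unfolding 2 using integral_scalar_E(1)[OF B(1) l(1), of "\<lambda>x. x\<^sup>2"] unfolding v_def by simp
qed

lemma mass_shift:
  assumes u: "u \<in> D" and B: "B \<in> sets borel" "B \<subseteq> {-R..R}" and R: "0 \<le> R"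
  shows "mass (\<lambda>n. (- z) * u n + T u n) B = (\<integral>x. indicator B x * (cmod (of_real x - z))\<^sup>2 \<partial>\<sigma> u)"
    and "integrable (\<sigma> u) (\<lambda>x. indicator B x * (cmod (of_real x - z))\<^sup>2)"
proof -
  have l: "u \<in> l2" "T u \<in> l2" using dom_l2[OF u] T_l2[OF u] by auto
  interpret finite_measure "\<sigma> u" by (rule finite_measure_scalar[OF l(1)])
  have i2: "integrable (\<sigma> u) (\<lambda>x. indicator B x * x\<^sup>2)"
    using dom_E[OF B(1) u] integral_scalar_E(2)[OF B(1) l(1)] dom_iff by simp
  have i1: "integrable (\<sigma> u) (\<lambda>x. indicator B x * x)"
    by (rule integrable_const_bound[of _ R]) (use B R in \<open>auto simp: indicator_def abs_le_iff intro!: AE_I2\<close>)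
  have i0: "integrable (\<sigma> u) (\<lambda>x. indicator B x :: real)"
    by (rule integrable_const_bound[of _ 1]) (use B in \<open>auto simp: indicator_def\<close>)
  have sq: "indicator B x * (cmod (of_real x - z))\<^sup>2 = indicator B x * x\<^sup>2 + (- 2 * Re z) * (indicator B x * x) + (cmod z)\<^sup>2 * indicator B x" for x
    unfolding cmod_power2 by (simp add: power2_eq_square algebra_simps)
  show "integrable (\<sigma> u) (\<lambda>x. indicator B x * (cmod (of_real x - z))\<^sup>2)"
    unfolding sq by (intro Bochner_Integration.integrable_add integrable_mult_right i0 i1 i2)
  have int: "(\<integral>x. indicator B x * (cmod (of_real x - z))\<^sup>2 \<partial>\<sigma> u) =
     (\<integral>x. indicator B x * x\<^sup>2 \<partial>\<sigma> u) + (- 2 * Re z) * (\<integral>x. indicator B x * x \<partial>\<sigma> u) + (cmod z)\<^sup>2 * mass u B"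
  proof -
    have "(\<integral>x. indicator B x \<partial>\<sigma> u) = mass u B" using measure_scalar[OF l(1) B(1)] by simp
    then show ?thesis unfolding sq
      by (subst Bochner_Integration.integral_add Bochner_Integration.integral_mult_right_zero;
          (intro Bochner_Integration.integrable_add integrable_mult_right i0 i1 i2)?)+ simp
  qed
  have a: "l2_inner (E B (T u)) u = of_real (\<integral>x. indicator B x * x \<partial>\<sigma> u)"
    using E_selfadjoint[OF B(1) l(2,1)] inner_T_E[OF u B(1)] by simp
  have b: "l2_inner (E B u) (T u) = of_real (\<integral>x. indicator B x * x \<partial>\<sigma> u)"
    using l2_inner_cnj[OF l(2) E_l2[OF B(1) l(1)]] inner_T_E[OF u B(1)] by simp
  have "l2_inner (E B (\<lambda>n. (- z) * u n + T u n)) (\<lambda>n. (- z) * u n + T u n)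
    = of_real ((cmod z)\<^sup>2) * l2_inner (E B u) u + (- z) * of_real (\<integral>x. indicator B x * x \<partial>\<sigma> u)
      + cnj (- z) * of_real (\<integral>x. indicator B x * x \<partial>\<sigma> u) + l2_inner (E B (T u)) (T u)"
    unfolding E_lincomb[OF B(1) l] l2_inner_lincomb_lincomb[OF l E_l2[OF B(1) l(1)] E_l2[OF B(1) l(2)]] a b by simp
  then have "mass (\<lambda>n. (- z) * u n + T u n) B = (cmod z)\<^sup>2 * mass u B - 2 * Re z * (\<integral>x. indicator B x * x \<partial>\<sigma> u) + mass (T u) B"
    unfolding mass_def by simp
  then show "mass (\<lambda>n. (- z) * u n + T u n) B = (\<integral>x. indicator B x * (cmod (of_real x - z))\<^sup>2 \<partial>\<sigma> u)"
    unfolding mass_T[OF u B R] int by simp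
qed

lemma scalar_measure_shift:
  assumes u: "u \<in> D"
  shows "\<sigma> (\<lambda>n. (- z) * u n + T u n) = density (\<sigma> u) (\<lambda>x. ennreal ((cmod (of_real x - z))\<^sup>2))"
proof (rule measure_eqI)
  let ?f = "\<lambda>n. (- z) * u n + T u n"
  let ?M = "density (\<sigma> u) (\<lambda>x. ennreal ((cmod (of_real x - z))\<^sup>2))"
  have l: "u \<in> l2" "?f \<in> l2" by (rule dom_l2[OF u], rule l2_lincomb[OF dom_l2[OF u] T_l2[OF u]])
  fix C assume "C \<in> sets (\<sigma> ?f)"
  then have C: "C \<in> sets borel" by simp
  define A where "A n = C \<inter> {- real n..real n}" for n :: nat
  have A: "range A \<subseteq> sets borel" "incseq A" "(\<Union>n. A n) = C"
  proof -
    show "range A \<subseteq> sets borel" unfolding A_def using C by auto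
    show "incseq A" unfolding A_def incseq_def by auto
    show "(\<Union>n. A n) = C"
    proof (intro equalityI subsetI)
      fix x assume "x \<in> C"
      moreover obtain n :: nat where "\<bar>x\<bar> \<le> real n" using real_arch_simple by blast
      ultimately have "x \<in> A n" unfolding A_def by auto
      then show "x \<in> (\<Union>n. A n)" by blast
    qed (auto simp: A_def)
  qed
  have "emeasure (\<sigma> ?f) (A n) = emeasure ?M (A n)" for n
  proof -
    have An: "A n \<in> sets borel" "A n \<subseteq> {- real n..real n}" using A by (auto simp: A_def)
    have "emeasure ?M (A n) = (\<integral>\<^sup>+x. ennreal ((cmod (of_real x - z))\<^sup>2) * indicator (A n) x \<partial>\<sigma> u)"
      by (rule emeasure_density) (use An in auto)
    also have "\<dots> = (\<integral>\<^sup>+x. ennreal (indicator (A n) x * (cmod (of_real x - z))\<^sup>2) \<partial>\<sigma> u)"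
      by (intro nn_integral_cong) (auto simp: indicator_def)
    also have "\<dots> = ennreal (\<integral>x. indicator (A n) x * (cmod (of_real x - z))\<^sup>2 \<partial>\<sigma> u)"
      by (rule nn_integral_eq_integral[OF mass_shift(2)[OF u An]]) auto
    also have "\<dots> = ennreal (mass ?f (A n))" using mass_shift(1)[OF u An, of z] by simp
    finally show ?thesis using emeasure_scalar[OF l(2) An(1)] by simp
  qed
  moreover have "(SUP n. emeasure (\<sigma> ?f) (A n)) = emeasure (\<sigma> ?f) C"
    using SUP_emeasure_incseq[of A "\<sigma> ?f"] A by simp
  moreover have "(SUP n. emeasure ?M (A n)) = emeasure ?M C"
    using SUP_emeasure_incseq[of A ?M] A by simp
  ultimately show "emeasure (\<sigma> ?f) C = emeasure ?M C" by simp
qed simp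

text \<open>
  If \<open>(T - z) u = e0\<close>, then \<open>scalar_measure_shift\<close> says that the measure of \<open>e0\<close> is
  \<open>|x - z|\<^sup>2\<close> times that of \<open>u\<close>, while \<open>\<langle>e0, u\<rangle>\<close> is the integral of \<open>x - z\<close> against the latter.
\<close>

lemma resolvent_Stieltjes:
  assumes u: "u \<in> D" and z: "Im z \<noteq> 0" and eq: "(\<lambda>n. (- z) * u n + T u n) = e0"
  shows "u 0 = (\<integral>x. 1 / (of_real x - z) \<partial>\<sigma> e0)"
proof -
  have l: "u \<in> l2" "T u \<in> l2" using dom_l2[OF u] T_l2[OF u] by auto
  interpret finite_measure "\<sigma> u" by (rule finite_measure_scalar[OF l(1)])
  have ix: "integrable (\<sigma> u) (\<lambda>x. x)"
  proof (rule Bochner_Integration.integrable_bound)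
    show "integrable (\<sigma> u) (\<lambda>x. 1 + x\<^sup>2)" using u dom_iff by simp
    show "AE x in \<sigma> u. norm x \<le> norm (1 + x\<^sup>2)"
    proof (rule AE_I2)
      fix x :: real
      have "2 * \<bar>x\<bar> \<le> 1 + x\<^sup>2" using sum_squares_bound[of "\<bar>x\<bar>" 1] by simp
      then show "norm x \<le> norm (1 + x\<^sup>2)" by simp
    qed
  qed simp
  have nz: "complex_of_real x - w \<noteq> 0" if "Im w \<noteq> 0" for x w using that by (auto simp: complex_eq_iff)
  have "cnj (u 0) = l2_inner e0 u" using l2_inner_cnj[OF l(1) e0_l2] l2_inner_e0 by simp
  also have "\<dots> = (- z) * l2_inner u u + l2_inner (T u) u"
    unfolding eq[symmetric] by (rule l2_inner_lincomb[OF l l(1)])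
  also have "l2_inner u u = of_real (measure (\<sigma> u) UNIV)"
    using measure_scalar[OF l(1), of UNIV] inner_E(1)[of UNIV u] E_UNIV[OF l(1)] l by simp
  also have "(- z) * of_real (measure (\<sigma> u) UNIV) + l2_inner (T u) u = (\<integral>x. complex_of_real x - z \<partial>\<sigma> u)"
  proof -
    have "(\<integral>x. complex_of_real x - z \<partial>\<sigma> u) = (\<integral>x. complex_of_real x \<partial>\<sigma> u) - (\<integral>x. z \<partial>\<sigma> u)"
      by (rule Bochner_Integration.integral_diff) (use ix in auto)
    also have "(\<integral>x. z \<partial>\<sigma> u) = z * of_real (measure (\<sigma> u) UNIV)" by (simp add: scaleR_conv_of_real mult.commute)
    finally show ?thesis using form[OF u] by simp
  qed
  also have "\<dots> = (\<integral>x. (cmod (of_real x - z))\<^sup>2 *\<^sub>R (1 / (of_real x - cnj z)) \<partial>\<sigma> u)"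
  proof (rule Bochner_Integration.integral_cong[OF refl])
    fix x :: real
    have "of_real ((cmod (of_real x - z))\<^sup>2) = (of_real x - z) * (of_real x - cnj z)"
      using complex_norm_square[of "of_real x - z"] by simp
    then show "complex_of_real x - z = (cmod (of_real x - z))\<^sup>2 *\<^sub>R (1 / (of_real x - cnj z))"
      using nz[of "cnj z" x] z by (simp add: scaleR_conv_of_real)
  qed
  also have "\<dots> = (\<integral>x. 1 / (of_real x - cnj z) \<partial>density (\<sigma> u) (\<lambda>x. ennreal ((cmod (of_real x - z))\<^sup>2)))"
    by (rule integral_density[symmetric]) auto
  also have "density (\<sigma> u) (\<lambda>x. ennreal ((cmod (of_real x - z))\<^sup>2)) = \<sigma> e0"
    using scalar_measure_shift[OF u, of z] unfolding eq by simp
  finally have "u 0 = cnj (\<integral>x. 1 / (of_real x - cnj z) \<partial>\<sigma> e0)" by (metis complex_cnj_cnj)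
  also have "\<dots> = (\<integral>x. cnj (1 / (of_real x - cnj z)) \<partial>\<sigma> e0)" by (rule Bochner_Integration.integral_cnj[symmetric])
  finally show ?thesis by simp
qed

end

section \<open>Weyl solutions of a Jacobi recurrence\<close>

fun three_term :: "(nat \<Rightarrow> real) \<Rightarrow> 'a \<Rightarrow> 'a \<Rightarrow> 'a \<Rightarrow> nat \<Rightarrow> 'a::real_field" where
  "three_term b s0 s1 z 0 = s0"
| "three_term b s0 s1 z (Suc 0) = s1"
| "three_term b s0 s1 z (Suc (Suc n)) = (z * three_term b s0 s1 z (Suc n) - of_real (b n) * three_term b s0 s1 z n) / of_real (b (Suc n))"

text \<open>
  The orthogonal polynomials of the first kind; those of the second kind are \<open>spoly\<close>, whose entries
  at the indices \<open>0\<close> and \<open>1\<close> are chosen so that the Wronskian in \<open>wronskian\<close> is \<open>1\<close>.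
\<close>

definition opoly :: "(nat \<Rightarrow> real) \<Rightarrow> 'a \<Rightarrow> nat \<Rightarrow> 'a::real_field" where
  "opoly b z = three_term b 1 (z / of_real (b 0)) z"

definition spoly :: "(nat \<Rightarrow> real) \<Rightarrow> 'a \<Rightarrow> nat \<Rightarrow> 'a::real_field" where
  "spoly b z = three_term b 0 (1 / of_real (b 0)) z"

lemma three_term_of_real:
  fixes s0 s1 x :: real
  shows "three_term b (of_real s0) (of_real s1) (of_real x) n = (of_real (three_term b s0 s1 x n) :: complex)"
  by (induction b s0 s1 x n rule: three_term.induct) auto

lemma opoly_of_real: "opoly b (of_real x :: complex) n = of_real (opoly b x n)"
  using three_term_of_real[of b 1 "x / b 0" x n] by (simp add: opoly_def)

lemma spoly_of_real: "spoly b (of_real x :: complex) n = of_real (spoly b x n)"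
  using three_term_of_real[of b 0 "1 / b 0" x n] by (simp add: spoly_def)

locale jacobi_weights =
  fixes b :: "nat \<Rightarrow> real"
  assumes b_pos: "0 < b n"
begin

lemma b_nz: "of_real (b n) \<noteq> (0 :: 'a :: real_field)"
  using b_pos[of n] by simp

lemma three_term_rec:
  fixes z :: "'a :: real_field"
  shows "of_real (b n) * three_term b s0 s1 z n + of_real (b (Suc n)) * three_term b s0 s1 z (Suc (Suc n)) = z * three_term b s0 s1 z (Suc n)"
  using b_nz[of "Suc n", where 'a = 'a] by simp

lemma opoly_rec:
  fixes z :: "'a :: real_field"
  shows "of_real (b n) * opoly b z n + of_real (b (Suc n)) * opoly b z (Suc (Suc n)) = z * opoly b z (Suc n)"
  unfolding opoly_def by (rule three_term_rec)

lemma spoly_rec: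
  fixes z :: "'a :: real_field"
  shows "of_real (b n) * spoly b z n + of_real (b (Suc n)) * spoly b z (Suc (Suc n)) = z * spoly b z (Suc n)"
  unfolding spoly_def by (rule three_term_rec)

lemma opoly_0:
  fixes z :: "'a :: real_field"
  shows "opoly b z 0 = 1" "of_real (b 0) * opoly b z (Suc 0) = z"
  using b_nz[of 0, where 'a = 'a] by (auto simp: opoly_def)

lemma spoly_0:
  fixes z :: "'a :: real_field"
  shows "spoly b z 0 = 0" "of_real (b 0) * spoly b z (Suc 0) = 1"
  using b_nz[of 0, where 'a = 'a] by (auto simp: spoly_def)

lemma wronskian:
  fixes z :: "'a :: real_field"
  shows "of_real (b N) * (spoly b z (Suc N) * opoly b z N - spoly b z N * opoly b z (Suc N)) = 1"
proof (induction N)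
  case 0 then show ?case using spoly_0(2)[of z] by (simp add: opoly_0(1) spoly_0(1))
next
  case (Suc N)
  have p: "of_real (b (Suc N)) * opoly b z (Suc (Suc N)) = z * opoly b z (Suc N) - of_real (b N) * opoly b z N"
    and q: "of_real (b (Suc N)) * spoly b z (Suc (Suc N)) = z * spoly b z (Suc N) - of_real (b N) * spoly b z N"
    using opoly_rec[of N z] spoly_rec[of N z] by (auto simp: algebra_simps)
  have "of_real (b (Suc N)) * (spoly b z (Suc (Suc N)) * opoly b z (Suc N) - spoly b z (Suc N) * opoly b z (Suc (Suc N)))
    = (of_real (b (Suc N)) * spoly b z (Suc (Suc N))) * opoly b z (Suc N) - spoly b z (Suc N) * (of_real (b (Suc N)) * opoly b z (Suc (Suc N)))"
    by (simp add: algebra_simps)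
  also have "\<dots> = of_real (b N) * (spoly b z (Suc N) * opoly b z N - spoly b z N * opoly b z (Suc N))"
    unfolding p q by (simp add: algebra_simps)
  finally show ?case using Suc by simp
qed

lemma green:
  fixes \<psi> :: "nat \<Rightarrow> complex"
  assumes rec: "\<And>n. of_real (b n) * \<psi> n + of_real (b (Suc n)) * \<psi> (Suc (Suc n)) = z * \<psi> (Suc n)"
  shows "Im z * (\<Sum>n\<le>N. (cmod (\<psi> n))\<^sup>2) = b N * Im (\<psi> (Suc N) * cnj (\<psi> N)) - Im ((of_real (b 0) * \<psi> (Suc 0) - z * \<psi> 0) * cnj (\<psi> 0))"
proof (induction N)
  case 0 show ?case unfolding cmod_power2 by (simp add: power2_eq_square algebra_simps)
next
  case (Suc N)
  have r: "of_real (b (Suc N)) * \<psi> (Suc (Suc N)) = z * \<psi> (Suc N) - of_real (b N) * \<psi> N"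
    using rec[of N] by (simp add: algebra_simps)
  have "b (Suc N) * Im (\<psi> (Suc (Suc N)) * cnj (\<psi> (Suc N))) = Im ((of_real (b (Suc N)) * \<psi> (Suc (Suc N))) * cnj (\<psi> (Suc N)))"
    by (simp add: algebra_simps)
  also have "\<dots> = Im z * (cmod (\<psi> (Suc N)))\<^sup>2 + b N * Im (\<psi> (Suc N) * cnj (\<psi> N))"
    unfolding r cmod_power2 by (simp add: power2_eq_square algebra_simps)
  finally show ?case using Suc by (simp add: algebra_simps)
qed

text \<open>
  The solution \<open>spoly + m * opoly\<close> satisfies the dissipative boundary condition
  \<open>\<psi> (N + 1) = - \<i> * \<psi> N\<close> exactly for \<open>m = weyl_m N z\<close>.
\<close>

definition weyl_den :: "nat \<Rightarrow> complex \<Rightarrow> complex" where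
  "weyl_den N z = opoly b z (Suc N) + \<i> * opoly b z N"

definition weyl_m :: "nat \<Rightarrow> complex \<Rightarrow> complex" where
  "weyl_m N z = - (spoly b z (Suc N) + \<i> * spoly b z N) / weyl_den N z"

lemma opoly_green: "Im z * (\<Sum>n\<le>N. (cmod (opoly b z n))\<^sup>2) = b N * Im (opoly b z (Suc N) * cnj (opoly b z N))"
  using green[OF opoly_rec, where z = z and N = N] opoly_0[of z] by simp

lemma opoly_sum_ge_1: "1 \<le> (\<Sum>n\<le>N. (cmod (opoly b z n))\<^sup>2)"
  using member_le_sum[of 0 "{..N}" "\<lambda>n. (cmod (opoly b z n))\<^sup>2"] opoly_0(1)[of z] by simp

text \<open>
  Off the real line a zero would be a solution with the sign of its boundary form opposite to the
  one forced by Green's identity; on the real line it would be a common zero of two consecutive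
  polynomials, which the Wronskian excludes.
\<close>

lemma weyl_den_nonzero: assumes "0 \<le> Im z" shows "weyl_den N z \<noteq> 0"
proof
  assume d: "weyl_den N z = 0"
  show False
  proof (cases "Im z = 0")
    case True
    then have z: "z = of_real (Re z)" by (simp add: complex_eq_iff)
    let ?x = "Re z"
    have "of_real (opoly b ?x (Suc N)) + \<i> * complex_of_real (opoly b ?x N) = 0"
      using d unfolding weyl_den_def by (subst (asm) (1 2) z) (simp only: opoly_of_real)
    then have "opoly b ?x (Suc N) = 0" "opoly b ?x N = 0" by (auto simp: complex_eq_iff)
    then show False using wronskian[of N ?x] by simp
  next
    case False
    then have y: "0 < Im z" using assms by simp
    have "opoly b z (Suc N) = - \<i> * opoly b z N" using d unfolding weyl_den_def by (simp add: eq_neg_iff_add_eq_0)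
    then have "Im (opoly b z (Suc N) * cnj (opoly b z N)) = - (cmod (opoly b z N))\<^sup>2"
      unfolding cmod_power2 by (simp add: power2_eq_square)
    then have "Im z * (\<Sum>n\<le>N. (cmod (opoly b z n))\<^sup>2) = - b N * (cmod (opoly b z N))\<^sup>2"
      unfolding opoly_green by simp
    moreover have "0 \<le> b N * (cmod (opoly b z N))\<^sup>2" using b_pos[of N] by simp
    moreover have "0 < Im z * (\<Sum>n\<le>N. (cmod (opoly b z n))\<^sup>2)"
      using y opoly_sum_ge_1[where z = z and N = N] by (intro mult_pos_pos) auto
    ultimately show False by linarith
  qed
qed

definition weyl_sol :: "complex \<Rightarrow> complex \<Rightarrow> nat \<Rightarrow> complex" where
  "weyl_sol m z n = spoly b z n + m * opoly b z n"

lemma weyl_sol_rec: "of_real (b n) * weyl_sol m z n + of_real (b (Suc n)) * weyl_sol m z (Suc (Suc n)) = z * weyl_sol m z (Suc n)"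
proof -
  have "of_real (b n) * weyl_sol m z n + of_real (b (Suc n)) * weyl_sol m z (Suc (Suc n))
    = (of_real (b n) * spoly b z n + of_real (b (Suc n)) * spoly b z (Suc (Suc n)))
     + m * (of_real (b n) * opoly b z n + of_real (b (Suc n)) * opoly b z (Suc (Suc n)))"
    unfolding weyl_sol_def by (simp add: algebra_simps)
  then show ?thesis unfolding opoly_rec spoly_rec weyl_sol_def by (simp add: algebra_simps)
qed

lemma weyl_sol_0: "weyl_sol m z 0 = m" "of_real (b 0) * weyl_sol m z (Suc 0) - z * weyl_sol m z 0 = 1"
proof -
  show *: "weyl_sol m z 0 = m" unfolding weyl_sol_def by (simp add: opoly_0(1) spoly_0(1))
  have "of_real (b 0) * weyl_sol m z (Suc 0) = of_real (b 0) * spoly b z (Suc 0) + m * (of_real (b 0) * opoly b z (Suc 0))"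
    unfolding weyl_sol_def by (simp add: algebra_simps)
  then show "of_real (b 0) * weyl_sol m z (Suc 0) - z * weyl_sol m z 0 = 1"
    unfolding * opoly_0 spoly_0 by simp
qed

text \<open>
  Green's identity for the solution with the boundary condition; the boundary term
  \<open>- b N * |\<psi> N|\<^sup>2\<close> has a sign and is dropped.
\<close>

lemma weyl_disc:
  assumes "0 < Im z"
  shows "Im z * (\<Sum>n\<le>N. (cmod (weyl_sol (weyl_m N z) z n))\<^sup>2) \<le> Im (weyl_m N z)"
proof -
  let ?m = "weyl_m N z"
  have d: "weyl_den N z \<noteq> 0" using weyl_den_nonzero assms by simp
  have "weyl_sol ?m z (Suc N) + \<i> * weyl_sol ?m z N = (spoly b z (Suc N) + \<i> * spoly b z N) + ?m * weyl_den N z"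
    unfolding weyl_sol_def weyl_den_def by (simp add: algebra_simps)
  also have "\<dots> = 0" unfolding weyl_m_def using d by simp
  finally have e: "weyl_sol ?m z (Suc N) = - \<i> * weyl_sol ?m z N" by (simp add: eq_neg_iff_add_eq_0)
  have "Im z * (\<Sum>n\<le>N. (cmod (weyl_sol ?m z n))\<^sup>2) = b N * Im (weyl_sol ?m z (Suc N) * cnj (weyl_sol ?m z N)) + Im ?m"
    using green[of "weyl_sol ?m z" z N, OF weyl_sol_rec] unfolding weyl_sol_0(2) unfolding weyl_sol_0(1) by simp
  also have "\<dots> = - b N * (cmod (weyl_sol ?m z N))\<^sup>2 + Im ?m"
    unfolding e cmod_power2 by (simp add: power2_eq_square algebra_simps)
  finally show ?thesis using b_pos[of N] by simp
qed

lemma weyl_m_bound: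
  assumes "0 < Im z" shows "cmod (weyl_m N z) \<le> 1 / Im z"
proof -
  let ?m = "weyl_m N z"
  have "(cmod ?m)\<^sup>2 \<le> (\<Sum>n\<le>N. (cmod (weyl_sol ?m z n))\<^sup>2)"
    using member_le_sum[of 0 "{..N}" "\<lambda>n. (cmod (weyl_sol ?m z n))\<^sup>2"] weyl_sol_0(1)[of ?m z] by simp
  then have "Im z * (cmod ?m)\<^sup>2 \<le> Im ?m" using weyl_disc[OF assms, of N] assms by (meson less_imp_le mult_left_mono order_trans)
  also have "Im ?m \<le> cmod ?m" using abs_Im_le_cmod[of ?m] by linarith
  finally have "cmod ?m * (Im z * cmod ?m) \<le> cmod ?m * 1" by (simp add: power2_eq_square algebra_simps)
  then show ?thesis using assms by (cases "?m = 0") (auto simp: field_simps)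
qed

text \<open>
  On the real line numerator and denominator have real polynomials as real and imaginary parts, and
  the imaginary part of the quotient is their Wronskian over the squared modulus.
\<close>

lemma Im_weyl_m_real: "Im (weyl_m N (of_real x)) = 1 / (b N * ((opoly b x (Suc N))\<^sup>2 + (opoly b x N)\<^sup>2))"
proof -
  let ?P = "opoly b x (Suc N)" and ?p = "opoly b x N"
  let ?Q = "spoly b x (Suc N)" and ?q = "spoly b x N"
  have nz: "?P\<^sup>2 + ?p\<^sup>2 \<noteq> 0" using wronskian[of N x] by (auto simp: sum_power2_eq_zero_iff)
  have w: "?Q * ?p - ?q * ?P = 1 / b N" using wronskian[of N x] b_pos[of N] by (simp add: field_simps)
  have "Im (weyl_m N (of_real x)) = (?Q * ?p - ?q * ?P) / (?P\<^sup>2 + ?p\<^sup>2)"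
    unfolding weyl_m_def weyl_den_def opoly_of_real spoly_of_real by (simp add: Im_divide diff_divide_distrib[symmetric] algebra_simps)
  then show ?thesis unfolding w by simp
qed

end

locale carleman_weights = jacobi_weights +
  assumes carleman: "\<not> summable (\<lambda>n. 1 / b n)"
begin

text \<open>
  Carleman's argument: the boundary form in Green's identity is at least \<open>Im z\<close>, hence
  \<open>Im z / b n\<close> is bounded by the squares of two consecutive entries.
\<close>

lemma opoly_not_l2:
  assumes "0 < Im z" shows "\<not> summable (\<lambda>n. (cmod (opoly b z n))\<^sup>2)"
proof
  assume s: "summable (\<lambda>n. (cmod (opoly b z n))\<^sup>2)"
  have "summable (\<lambda>n. 1 / b n)"
  proof (rule summable_comparison_test')
    show "summable (\<lambda>n. 1 / Im z * ((cmod (opoly b z n))\<^sup>2 + (cmod (opoly b z (Suc n)))\<^sup>2))"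
      using s by (intro summable_mult summable_add) (simp_all add: summable_Suc_iff[of "\<lambda>n. (cmod (opoly b z n))\<^sup>2"])
    show "norm (1 / b n) \<le> 1 / Im z * ((cmod (opoly b z n))\<^sup>2 + (cmod (opoly b z (Suc n)))\<^sup>2)" for n
    proof -
      let ?S = "(cmod (opoly b z n))\<^sup>2 + (cmod (opoly b z (Suc n)))\<^sup>2"
      have "Im z * 1 \<le> Im z * (\<Sum>k\<le>n. (cmod (opoly b z k))\<^sup>2)"
        using assms opoly_sum_ge_1 by (intro mult_left_mono) auto
      also have "\<dots> \<le> b n * cmod (opoly b z (Suc n) * cnj (opoly b z n))"
        unfolding opoly_green using b_pos[of n] abs_Im_le_cmod[of "opoly b z (Suc n) * cnj (opoly b z n)"]
        by (intro mult_left_mono) auto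
      also have "cmod (opoly b z (Suc n) * cnj (opoly b z n)) = cmod (opoly b z (Suc n)) * cmod (opoly b z n)" by (simp add: norm_mult)
      also have "b n * \<dots> \<le> b n * ?S"
      proof (intro mult_left_mono)
        show "cmod (opoly b z (Suc n)) * cmod (opoly b z n) \<le> ?S"
          using sum_squares_bound[of "cmod (opoly b z n)" "cmod (opoly b z (Suc n))"]
            mult_nonneg_nonneg[OF norm_ge_zero norm_ge_zero, of "opoly b z (Suc n)" "opoly b z n"]
          by (simp only: mult.commute mult.left_commute)
      qed (use b_pos[of n] in simp)
      finally have "Im z \<le> b n * ?S" by simp
      then show ?thesis using assms b_pos[of n] by (simp add: field_simps)
    qed
  qed
  then show False using carleman by simp
qed

lemma opoly_sum_unbounded:
  assumes "0 < Im z" obtains N where "\<And>n. N \<le> n \<Longrightarrow> C < (\<Sum>k\<le>n. (cmod (opoly b z k))\<^sup>2)"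
proof -
  let ?f = "\<lambda>n. (cmod (opoly b z n))\<^sup>2"
  have "\<exists>N. C < (\<Sum>k\<le>N. ?f k)"
  proof (rule ccontr)
    assume "\<not> ?thesis"
    then have *: "(\<Sum>k\<le>N. ?f k) \<le> C" for N by (simp add: not_less)
    have "(\<Sum>k<N. ?f k) \<le> C" for N
      by (rule order_trans[OF sum_mono2 *[of N]]) auto
    then have "summable ?f" by (intro summableI_nonneg_bounded) auto
    then show False using opoly_not_l2[OF assms] by simp
  qed
  then obtain N where N: "C < (\<Sum>k\<le>N. ?f k)" by blast
  show ?thesis
  proof (rule that)
    fix n assume "N \<le> n"
    then have "(\<Sum>k\<le>N. ?f k) \<le> (\<Sum>k\<le>n. ?f k)" by (intro sum_mono2) auto
    then show "C < (\<Sum>k\<le>n. ?f k)" using N by simp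
  qed
qed

text \<open>
  Both Weyl solutions have norm at most \<open>1 / Im z\<close> on the first \<open>N + 1\<close> entries, and their
  difference is a multiple of the polynomial of the first kind. This bounds the diameter of the
  Weyl disc.
\<close>

lemma weyl_m_diff:
  assumes y: "0 < Im z" and NM: "N \<le> M"
  shows "(cmod (weyl_m N z - weyl_m M z))\<^sup>2 * (\<Sum>k\<le>N. (cmod (opoly b z k))\<^sup>2) \<le> 4 / (Im z)\<^sup>2"
proof -
  have bd: "(\<Sum>n\<le>N. (cmod (weyl_sol (weyl_m K z) z n))\<^sup>2) \<le> 1 / (Im z)\<^sup>2" if "N \<le> K" for K
  proof -
    have "(\<Sum>n\<le>N. (cmod (weyl_sol (weyl_m K z) z n))\<^sup>2) \<le> (\<Sum>n\<le>K. (cmod (weyl_sol (weyl_m K z) z n))\<^sup>2)"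
      using that by (intro sum_mono2) auto
    also have "\<dots> \<le> Im (weyl_m K z) / Im z" using weyl_disc[OF y, of K] y by (simp add: field_simps)
    also have "\<dots> \<le> (1 / Im z) / Im z"
      using weyl_m_bound[OF y, of K] abs_Im_le_cmod[of "weyl_m K z"] y by (intro divide_right_mono) linarith+
    finally show ?thesis by (simp add: power2_eq_square)
  qed
  have "(cmod (weyl_m N z - weyl_m M z))\<^sup>2 * (\<Sum>k\<le>N. (cmod (opoly b z k))\<^sup>2)
     = (\<Sum>k\<le>N. (cmod (weyl_sol (weyl_m N z) z k - weyl_sol (weyl_m M z) z k))\<^sup>2)"
    unfolding sum_distrib_left weyl_sol_def
    by (intro sum.cong refl) (simp add: left_diff_distrib[symmetric] norm_mult power_mult_distrib)
  also have "\<dots> \<le> (\<Sum>k\<le>N. 2 * (cmod (weyl_sol (weyl_m N z) z k))\<^sup>2 + 2 * (cmod (weyl_sol (weyl_m M z) z k))\<^sup>2)"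
  proof (rule sum_mono)
    fix k
    let ?a = "weyl_sol (weyl_m N z) z k" and ?b = "weyl_sol (weyl_m M z) z k"
    have "(cmod (?a - ?b))\<^sup>2 \<le> (cmod ?a + cmod ?b)\<^sup>2" by (intro power_mono norm_triangle_ineq4) auto
    also have "\<dots> \<le> 2 * (cmod ?a)\<^sup>2 + 2 * (cmod ?b)\<^sup>2"
      using sum_squares_bound[of "cmod ?a" "cmod ?b"] by (simp add: power2_eq_square algebra_simps)
    finally show "(cmod (?a - ?b))\<^sup>2 \<le> 2 * (cmod ?a)\<^sup>2 + 2 * (cmod ?b)\<^sup>2" .
  qed
  also have "\<dots> = 2 * (\<Sum>k\<le>N. (cmod (weyl_sol (weyl_m N z) z k))\<^sup>2) + 2 * (\<Sum>k\<le>N. (cmod (weyl_sol (weyl_m M z) z k))\<^sup>2)"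
    by (simp add: sum.distrib sum_distrib_left)
  also have "\<dots> \<le> 4 / (Im z)\<^sup>2" using bd[OF order_refl] bd[OF NM] by simp
  finally show ?thesis .
qed

lemma weyl_m_convergent:
  assumes y: "0 < Im z" shows "convergent (\<lambda>N. weyl_m N z)"
proof (rule Cauchy_convergent, rule CauchyI)
  fix e :: real assume e: "0 < e"
  obtain N0 where N0: "\<And>n. N0 \<le> n \<Longrightarrow> 4 / ((Im z)\<^sup>2 * e\<^sup>2) < (\<Sum>k\<le>n. (cmod (opoly b z k))\<^sup>2)"
    using opoly_sum_unbounded[OF y] by blast
  have *: "cmod (weyl_m N z - weyl_m M z) < e" if "N0 \<le> N" "N \<le> M" for N M
  proof (rule ccontr)
    assume "\<not> ?thesis"
    then have "e\<^sup>2 \<le> (cmod (weyl_m N z - weyl_m M z))\<^sup>2" using e by (intro power_mono) auto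
    moreover have "0 < 4 / ((Im z)\<^sup>2 * e\<^sup>2)" using e y by simp
    ultimately have "e\<^sup>2 * (\<Sum>k\<le>N. (cmod (opoly b z k))\<^sup>2) \<le> 4 / (Im z)\<^sup>2"
      using N0[OF that(1)] by (intro order_trans[OF mult_right_mono weyl_m_diff[OF y that(2)]]) (auto intro: sum_nonneg)
    moreover have "e\<^sup>2 * (4 / ((Im z)\<^sup>2 * e\<^sup>2)) < e\<^sup>2 * (\<Sum>k\<le>N. (cmod (opoly b z k))\<^sup>2)"
      using N0[OF that(1)] e by (intro mult_strict_left_mono) auto
    ultimately show False using e by simp
  qed
  show "\<exists>K. \<forall>m\<ge>K. \<forall>n\<ge>K. cmod (weyl_m m z - weyl_m n z) < e"
  proof (intro exI allI impI)
    fix m n assume "N0 \<le> m" "N0 \<le> n"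
    then show "cmod (weyl_m m z - weyl_m n z) < e"
      using *[of m n] *[of n m] by (cases "m \<le> n") (auto simp: norm_minus_commute)
  qed
qed

lemma weyl_sol_limit_l2:
  assumes y: "0 < Im z" and m: "(\<lambda>N. weyl_m N z) \<longlonglongrightarrow> m" shows "weyl_sol m z \<in> l2"
  unfolding l2_def mem_Collect_eq
proof (rule summableI_nonneg_bounded)
  fix K
  have "(\<lambda>N. \<Sum>n<K. (cmod (weyl_sol (weyl_m N z) z n))\<^sup>2) \<longlonglongrightarrow> (\<Sum>n<K. (cmod (weyl_sol m z n))\<^sup>2)"
    unfolding weyl_sol_def by (intro tendsto_intros m)
  then show "(\<Sum>n<K. (cmod (weyl_sol m z n))\<^sup>2) \<le> 1 / (Im z)\<^sup>2"
  proof (rule LIMSEQ_le_const2)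
    show "\<exists>N0. \<forall>N\<ge>N0. (\<Sum>n<K. (cmod (weyl_sol (weyl_m N z) z n))\<^sup>2) \<le> 1 / (Im z)\<^sup>2"
    proof (intro exI allI impI)
      fix N assume N: "K \<le> N"
      have "(\<Sum>n<K. (cmod (weyl_sol (weyl_m N z) z n))\<^sup>2) \<le> (\<Sum>n\<le>N. (cmod (weyl_sol (weyl_m N z) z n))\<^sup>2)"
        using N by (intro sum_mono2) auto
      also have "\<dots> \<le> Im (weyl_m N z) / Im z" using weyl_disc[OF y, of N] y by (simp add: field_simps)
      also have "\<dots> \<le> (1 / Im z) / Im z"
        using weyl_m_bound[OF y, of N] abs_Im_le_cmod[of "weyl_m N z"] y by (intro divide_right_mono) linarith+
      finally show "(\<Sum>n<K. (cmod (weyl_sol (weyl_m N z) z n))\<^sup>2) \<le> 1 / (Im z)\<^sup>2" by (simp add: power2_eq_square)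
    qed
  qed
qed simp

lemma jacobi_map_weyl_sol: "jacobi_map b (weyl_sol m z) = (\<lambda>n. z * weyl_sol m z n + e0 n)"
proof
  fix n show "jacobi_map b (weyl_sol m z) n = z * weyl_sol m z n + e0 n"
  proof (cases n)
    case 0 then show ?thesis using weyl_sol_0(2)[of m z] by (simp add: jacobi_map_def e0_def algebra_simps)
  next
    case (Suc k) then show ?thesis using weyl_sol_rec[of k m z] by (simp add: jacobi_map_def e0_def)
  qed
qed

theorem weyl_m_tendsto_Stieltjes:
  assumes E: "is_spectral_measure E (jacobi_dom b) (jacobi_map b)" and y: "0 < Im z"
  shows "(\<lambda>N. weyl_m N z) \<longlonglongrightarrow> (\<integral>x. 1 / (of_real x - z) \<partial>scalar_measure E e0)"
proof -
  obtain m where m: "(\<lambda>N. weyl_m N z) \<longlonglongrightarrow> m" using weyl_m_convergent[OF y] by (auto simp: convergent_def)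
  have lin: "jacobi_map b (\<lambda>n. a * u n + v n) = (\<lambda>n. a * jacobi_map b u n + jacobi_map b v n)" for a u v
    unfolding jacobi_map_def by (auto simp: algebra_simps)
  interpret spectral_operator E "jacobi_dom b" "jacobi_map b"
  proof
    show "projection_valued_measure E" using E unfolding is_spectral_measure_def by simp
    show "jacobi_map b u \<in> l2" if "u \<in> jacobi_dom b" for u using that unfolding jacobi_dom_def by simp
    show "(\<lambda>n. a * u n + v n) \<in> jacobi_dom b" if "u \<in> jacobi_dom b" "v \<in> jacobi_dom b" for u v a
      using that unfolding jacobi_dom_def by (auto simp: lin intro!: l2_lincomb)
  qed (use E lin in auto)
  have w: "weyl_sol m z \<in> l2" by (rule weyl_sol_limit_l2[OF y m])
  then have d: "weyl_sol m z \<in> jacobi_dom b"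
    using l2_lincomb[OF w e0_l2, of z] unfolding jacobi_dom_def by (simp add: jacobi_map_weyl_sol)
  have "(\<lambda>n. (- z) * weyl_sol m z n + jacobi_map b (weyl_sol m z) n) = e0"
    unfolding jacobi_map_weyl_sol by auto
  from resolvent_Stieltjes[OF d _ this] y have "m = (\<integral>x. 1 / (of_real x - z) \<partial>scalar_measure E e0)"
    unfolding weyl_sol_0(1) by simp
  then show ?thesis using m by simp
qed

end

section \<open>Stieltjes inversion by a boundary shift\<close>

definition bump :: "real \<Rightarrow> real \<Rightarrow> complex \<Rightarrow> complex" where
  "bump p q z = (z - of_real p) * (of_real q - z)"

text \<open>
  The polynomial \<open>bump p q\<close> vanishes at \<open>p\<close> and \<open>q\<close>, so on the two vertical sides of the
  rectangle it is of order \<open>Im z\<close> and compensates the bound \<open>1 / Im z\<close> on \<open>m\<close>. A primitive on the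
  closed half plane turns the two horizontal integrals into boundary values, whose differences along
  the sides are controlled by the mean value inequality.
\<close>

lemma bump_boundary_shift:
  fixes m :: "complex \<Rightarrow> complex"
  assumes pq: "p \<le> q" and y: "0 \<le> y" "y \<le> 1"
    and diff: "\<And>z. 0 \<le> Im z \<Longrightarrow> m field_differentiable at z"
    and bound: "\<And>z. 0 < Im z \<Longrightarrow> cmod (m z) \<le> 1 / Im z"
  shows "cmod ((\<integral>x. indicator {p..q} x *\<^sub>R (bump p q (Complex x y) * m (Complex x y)) \<partial>lborel)
    - (\<integral>x. indicator {p..q} x *\<^sub>R (bump p q (Complex x 0) * m (Complex x 0)) \<partial>lborel)) \<le> 2 * (q - p + 1) * y"
proof -
  let ?S = "{z. 0 \<le> Im z}" and ?f = "\<lambda>z. bump p q z * m z"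
  have fd: "?f field_differentiable at z" if "0 \<le> Im z" for z
    unfolding bump_def using diff[OF that] by (auto intro!: derivative_intros)
  have cont: "continuous_on ?S ?f"
    using fd by (auto intro!: continuous_at_imp_continuous_on field_differentiable_imp_continuous_at)
  obtain g where g: "\<And>z. z \<in> ?S \<Longrightarrow> (g has_field_derivative ?f z) (at z within ?S)"
    by (rule holomorphic_convex_primitive[of ?S "{}" ?f])
      (use convex_halfspace_Im_ge[of 0] cont fd interior_subset[of ?S] in auto)
  have ftc: "(\<integral>x. indicator {p..q} x *\<^sub>R ?f (Complex x s) \<partial>lborel) = g (Complex q s) - g (Complex p s)" if s: "0 \<le> s" for s
  proof (rule integral_FTC_atLeastAtMost[OF pq])
    fix x assume x: "p \<le> x" "x \<le> q"
    have "((\<lambda>x. Complex x s) has_vector_derivative 1) (at x within {p..q})"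
      unfolding Complex_eq by (auto intro!: derivative_eq_intros)
    moreover have "(g has_field_derivative ?f (Complex x s)) (at (Complex x s) within (\<lambda>x. Complex x s) ` {p..q})"
      by (rule DERIV_subset[OF g]) (use s in auto)
    ultimately show "((\<lambda>x. g (Complex x s)) has_vector_derivative ?f (Complex x s)) (at x within {p..q})"
      using field_vector_diff_chain_within[of "\<lambda>x. Complex x s" 1 x "{p..q}" g] by (simp add: o_def)
  next
    show "continuous_on {p..q} (\<lambda>x. ?f (Complex x s))"
    proof (rule continuous_on_compose2[OF cont])
      show "continuous_on {p..q} (\<lambda>x. Complex x s)" unfolding Complex_eq by (intro continuous_intros)
    qed (use s in auto)
  qed
  have side: "cmod (g (Complex a y) - g (Complex a 0)) \<le> (q - p + 1) * y" if a: "a = p \<or> a = q" for a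
  proof -
    let ?L = "closed_segment (Complex a 0) (Complex a y)"
    have L: "Re z = a \<and> 0 \<le> Im z \<and> Im z \<le> y" if z: "z \<in> ?L" for z
    proof -
      obtain t where t: "0 \<le> t" "t \<le> 1" "z = (1 - t) *\<^sub>R Complex a 0 + t *\<^sub>R Complex a y"
        using z unfolding in_segment by blast
      have "Re z = a" "Im z = t * y" unfolding t(3) by (simp_all add: algebra_simps)
      moreover have "t * y \<le> 1 * y" using t y by (intro mult_right_mono) auto
      ultimately show ?thesis using t y by auto
    qed
    have "cmod (g (Complex a y) - g (Complex a 0)) \<le> (q - p + 1) * cmod (Complex a y - Complex a 0)"
    proof (rule field_differentiable_bound[where S = ?L])
      fix z assume z: "z \<in> ?L"
      show "(g has_field_derivative ?f z) (at z within ?L)"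
        by (rule DERIV_subset[OF g]) (use L[OF z] L in auto)
      have b: "cmod (bump p q z) \<le> Im z * (q - p + 1)"
      proof -
        have "cmod (Complex (q - p) c) \<le> q - p + 1" if "\<bar>c\<bar> \<le> 1" for c
          using cmod_le[of "Complex (q - p) c"] that pq by simp
        then have *: "cmod (Complex (q - p) (- Im z)) \<le> q - p + 1" "cmod (Complex (q - p) (Im z)) \<le> q - p + 1"
          using L[OF z] y by auto
        from a show ?thesis
        proof
          assume "a = p"
          then have "bump p q z = (\<i> * of_real (Im z)) * Complex (q - p) (- Im z)"
            using L[OF z] unfolding bump_def by (simp add: complex_eq_iff)
          then show ?thesis using *(1) L[OF z] by (simp add: norm_mult mult_left_mono)
        next
          assume "a = q"
          then have "bump p q z = (- \<i> * of_real (Im z)) * Complex (q - p) (Im z)"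
            using L[OF z] unfolding bump_def by (simp add: complex_eq_iff)
          then show ?thesis using *(2) L[OF z] by (simp add: norm_mult mult_left_mono)
        qed
      qed
      show "norm (?f z) \<le> q - p + 1"
      proof (cases "Im z = 0")
        case True then show ?thesis using b pq by simp
      next
        case False
        then have "0 < Im z" using L[OF z] by simp
        then have "cmod (bump p q z) * cmod (m z) \<le> (Im z * (q - p + 1)) * (1 / Im z)"
          by (intro mult_mono b bound) (use pq in auto)
        then show ?thesis using \<open>0 < Im z\<close> by (simp add: norm_mult)
      qed
    qed auto
    moreover have "Complex a y - Complex a 0 = \<i> * of_real y" by (simp add: complex_eq_iff)
    ultimately show ?thesis using y by (simp add: norm_mult)
  qed
  have "(\<integral>x. indicator {p..q} x *\<^sub>R ?f (Complex x y) \<partial>lborel) - (\<integral>x. indicator {p..q} x *\<^sub>R ?f (Complex x 0) \<partial>lborel)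
    = (g (Complex q y) - g (Complex q 0)) - (g (Complex p y) - g (Complex p 0))"
    unfolding ftc[OF y(1)] ftc[OF order_refl] by simp
  also have "cmod \<dots> \<le> (q - p + 1) * y + (q - p + 1) * y"
    by (rule order_trans[OF norm_triangle_ineq4]) (intro add_mono side; simp)
  finally show ?thesis by (simp add: algebra_simps)
qed

text \<open>
  Division of \<open>bump p q\<close> by \<open>t - z\<close> leaves the remainder \<open>(t - p) * (q - t)\<close>; the linear quotient
  contributes \<open>y\<close> and the remainder a Poisson kernel.
\<close>

lemma bump_kernel:
  assumes "y \<noteq> 0"
  shows "Im (bump p q (Complex x y) / (of_real t - Complex x y)) = y + (t - p) * (q - t) * (y / ((x - t)\<^sup>2 + y\<^sup>2))"
proof -
  have nz: "of_real t - Complex x y \<noteq> 0" using assms by (simp add: complex_eq_iff)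
  have "bump p q (Complex x y) = (of_real (t - p - q) + Complex x y) * (of_real t - Complex x y) + of_real ((t - p) * (q - t))"
    unfolding bump_def by (simp add: complex_eq_iff algebra_simps)
  then have "bump p q (Complex x y) / (of_real t - Complex x y) = of_real (t - p - q) + Complex x y + of_real ((t - p) * (q - t)) / (of_real t - Complex x y)"
    using nz by (simp add: add_divide_distrib)
  moreover have "Im (1 / (of_real t - Complex x y)) = y / ((x - t)\<^sup>2 + y\<^sup>2)"
    by (simp add: Im_divide power2_commute)
  moreover have "Im (of_real c / w) = c * Im (1 / w)" for c w
    by (simp add: Im_divide)
  ultimately show ?thesis by (simp only: plus_complex.sel Im_complex_of_real complex.sel)
qed

lemma arctan_diff_le: assumes "a \<le> b" shows "arctan b - arctan a \<le> b - a"
proof (cases "a = b")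
  case False
  have "\<exists>z. a < z \<and> z < b \<and> arctan b - arctan a = (b - a) * inverse (1 + z\<^sup>2)"
    by (rule MVT2) (use False assms DERIV_arctan in auto)
  then obtain z where "arctan b - arctan a = (b - a) * inverse (1 + z\<^sup>2)" by blast
  moreover have "inverse (1 + z\<^sup>2) \<le> 1" by (intro inverse_le_1_iff[THEN iffD2]) auto
  ultimately show ?thesis using assms mult_left_mono[of "inverse (1 + z\<^sup>2)" 1 "b - a"] by simp
qed simp

definition kernel :: "real \<Rightarrow> real \<Rightarrow> real \<Rightarrow> real \<Rightarrow> real" where
  "kernel p q y t = y * (q - p) + (t - p) * (q - t) * (arctan ((q - t) / y) - arctan ((p - t) / y))"

lemma kernel_integral:
  assumes y: "0 < y" and pq: "p \<le> q"
  shows "(\<integral>x. indicator {p..q} x *\<^sub>R (y + (t - p) * (q - t) * (y / ((x - t)\<^sup>2 + y\<^sup>2))) \<partial>lborel) = kernel p q y t"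
proof -
  have pos: "(x - t)\<^sup>2 + y\<^sup>2 > 0" for x using y by (intro add_nonneg_pos) auto
  have "(\<integral>x. indicator {p..q} x *\<^sub>R (y + (t - p) * (q - t) * (y / ((x - t)\<^sup>2 + y\<^sup>2))) \<partial>lborel)
    = (y * q + (t - p) * (q - t) * arctan ((q - t) / y)) - (y * p + (t - p) * (q - t) * arctan ((p - t) / y))"
  proof (rule integral_FTC_atLeastAtMost[OF pq])
    fix x
    have "1 / y / (1 + ((x - t) / y)\<^sup>2) = y / ((x - t)\<^sup>2 + y\<^sup>2)"
      using y pos[of x] by (simp add: field_simps power2_eq_square)
    then have h: "((\<lambda>x. arctan ((x - t) / y)) has_real_derivative y / ((x - t)\<^sup>2 + y\<^sup>2)) (at x within {p..q})"
      using y by (auto intro!: derivative_eq_intros simp: field_simps)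
    have "((\<lambda>x. y * x + (t - p) * (q - t) * arctan ((x - t) / y)) has_real_derivative y + (t - p) * (q - t) * (y / ((x - t)\<^sup>2 + y\<^sup>2))) (at x within {p..q})"
      using DERIV_add[OF DERIV_cmult[OF DERIV_ident, of y] DERIV_cmult[OF h, of "(t - p) * (q - t)"]] by simp
    then show "((\<lambda>x. y * x + (t - p) * (q - t) * arctan ((x - t) / y)) has_vector_derivative y + (t - p) * (q - t) * (y / ((x - t)\<^sup>2 + y\<^sup>2))) (at x within {p..q})"
      by (simp add: has_real_derivative_iff_has_vector_derivative)
  next
    show "continuous_on {p..q} (\<lambda>x. y + (t - p) * (q - t) * (y / ((x - t)\<^sup>2 + y\<^sup>2)))"
      by (intro continuous_intros ballI less_imp_neq[OF pos, symmetric])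
  qed
  then show ?thesis unfolding kernel_def by (simp add: algebra_simps)
qed

text \<open>
  The factor \<open>(t - p) * (q - t)\<close> grows quadratically, but the difference of arctangents is at most
  \<open>y * (1 / a - 1 / b)\<close>, where \<open>a\<close> and \<open>b\<close> are the distances of \<open>t\<close> to the two endpoints, and the
  product of the distances cancels. The bound is therefore uniform in \<open>t\<close>.
\<close>

lemma kernel_outside:
  assumes y: "0 < y" and pq: "p \<le> q" and t: "t < p \<or> q < t"
  shows "\<bar>kernel p q y t\<bar> \<le> 2 * y * (q - p)"
proof -
  have key: "\<bar>(t - p) * (q - t) * (arctan ((q - t) / y) - arctan ((p - t) / y))\<bar> \<le> y * (q - p)"
    if "0 < a" "a \<le> b" "(a = t - q \<and> b = t - p) \<or> (a = p - t \<and> b = q - t)" for a b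
  proof -
    have eq: "arctan (c / y) = pi / 2 - arctan (y / c)" if "0 < c" for c
      using arctan_inverse[of "c / y"] that y by (simp add: sgn_if)
    have d: "0 \<le> arctan (b / y) - arctan (a / y)"
      using that y by (simp add: arctan_le_iff divide_right_mono)
    have "arctan (b / y) - arctan (a / y) = arctan (y / a) - arctan (y / b)"
      using eq[of a] eq[of b] that by simp
    also have "\<dots> \<le> y / a - y / b" by (intro arctan_diff_le divide_left_mono) (use that y in auto)
    also have "\<dots> = y * (b - a) / (a * b)" using that by (simp add: field_simps)
    finally have "(a * b) * (arctan (b / y) - arctan (a / y)) \<le> (a * b) * (y * (b - a) / (a * b))"
      using that by (intro mult_left_mono) auto
    also have "\<dots> = y * (b - a)" using that by simp
    finally have 1: "(a * b) * (arctan (b / y) - arctan (a / y)) \<le> y * (b - a)" .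
    have 2: "0 \<le> (a * b) * (arctan (b / y) - arctan (a / y))" using that d by auto
    have ba: "b - a = q - p" using that(3) by auto
    have "\<bar>(t - p) * (q - t) * (arctan ((q - t) / y) - arctan ((p - t) / y))\<bar> = (a * b) * (arctan (b / y) - arctan (a / y))"
      using that(3)
    proof
      assume ab: "a = t - q \<and> b = t - p"
      then have "(q - t) / y = - (a / y)" "(p - t) / y = - (b / y)" "(t - p) * (q - t) = - (a * b)"
        unfolding ab[THEN conjunct1] ab[THEN conjunct2] by (simp_all add: diff_divide_distrib algebra_simps)
      then have "(t - p) * (q - t) * (arctan ((q - t) / y) - arctan ((p - t) / y)) = - (a * b) * (- arctan (a / y) - - arctan (b / y))"
        by (simp only: arctan_minus)
      moreover have "- (a * b) * (- arctan (a / y) - - arctan (b / y)) = - ((a * b) * (arctan (b / y) - arctan (a / y)))"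
        by (simp add: algebra_simps)
      ultimately have "(t - p) * (q - t) * (arctan ((q - t) / y) - arctan ((p - t) / y)) = - ((a * b) * (arctan (b / y) - arctan (a / y)))"
        by (rule trans)
      then show ?thesis using abs_of_nonneg[OF 2] by (simp only: abs_minus_cancel)
    next
      assume ab: "a = p - t \<and> b = q - t"
      then have "(p - t) / y = a / y" "(q - t) / y = b / y" "(t - p) * (q - t) = - (a * b)"
        unfolding ab[THEN conjunct1] ab[THEN conjunct2] by (simp_all add: algebra_simps)
      then have "(t - p) * (q - t) * (arctan ((q - t) / y) - arctan ((p - t) / y)) = - ((a * b) * (arctan (b / y) - arctan (a / y)))"
        by (simp only: mult_minus_left)
      then show ?thesis using abs_of_nonneg[OF 2] by (simp only: abs_minus_cancel)
    qed
    then show ?thesis using 1 ba by simp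
  qed
  have "\<bar>(t - p) * (q - t) * (arctan ((q - t) / y) - arctan ((p - t) / y))\<bar> \<le> y * (q - p)"
    using t key[of "t - q" "t - p"] key[of "p - t" "q - t"] pq by auto
  moreover have "0 \<le> y * (q - p)" using y pq by simp
  ultimately show ?thesis unfolding kernel_def by linarith
qed

lemma kernel_inside:
  assumes y: "0 < y" and t: "p \<le> t" "t \<le> q"
  shows "\<bar>kernel p q y t\<bar> \<le> y * (q - p) + (q - p)\<^sup>2 * pi"
proof -
  have a: "\<bar>arctan ((q - t) / y) - arctan ((p - t) / y)\<bar> \<le> pi"
    using arctan_bounded[of "(q - t) / y"] arctan_bounded[of "(p - t) / y"] by auto
  have b: "\<bar>(t - p) * (q - t)\<bar> \<le> (q - p)\<^sup>2"
    unfolding power2_eq_square abs_mult using t by (intro mult_mono) auto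
  have "\<bar>(t - p) * (q - t) * (arctan ((q - t) / y) - arctan ((p - t) / y))\<bar> \<le> (q - p)\<^sup>2 * pi"
    unfolding abs_mult[of "(t - p) * (q - t)"] by (intro mult_mono a b) auto
  moreover have "0 \<le> y * (q - p)" using y t by simp
  ultimately show ?thesis unfolding kernel_def by linarith
qed

lemma kernel_tendsto:
  assumes pq: "p \<le> q"
  shows "((\<lambda>y. kernel p q y t) \<longlongrightarrow> pi * (indicator {p..q} t * ((t - p) * (q - t)))) (at_right 0)"
proof -
  consider "t < p \<or> q < t" | "t = p \<or> t = q" | "p < t" "t < q" by linarith
  then show ?thesis
  proof cases
    case 1
    have "((\<lambda>y. kernel p q y t) \<longlongrightarrow> 0) (at_right 0)"
    proof (rule Lim_null_comparison)
      show "\<forall>\<^sub>F y in at_right 0. norm (kernel p q y t) \<le> 2 * y * (q - p)"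
        unfolding eventually_at_right_field using kernel_outside[OF _ pq 1] by (intro exI[of _ 1]) auto
      show "((\<lambda>y. 2 * y * (q - p)) \<longlongrightarrow> 0) (at_right 0)" by (auto intro!: tendsto_eq_intros)
    qed
    then show ?thesis using 1 by auto
  next
    case 2
    then have "(t - p) * (q - t) = 0" by auto
    then have k: "kernel p q y t = y * (q - p)" and z: "pi * (indicator {p..q} t * ((t - p) * (q - t))) = 0" for y
      unfolding kernel_def by simp_all
    have "((\<lambda>y. y * (q - p)) \<longlongrightarrow> 0 * (q - p)) (at_right 0)" by (intro tendsto_intros)
    then show ?thesis unfolding k z by simp
  next
    case 3
    have "((\<lambda>y. arctan ((q - t) / y)) \<longlongrightarrow> pi / 2) (at_right 0)"
      by (rule filterlim_compose[OF tendsto_arctan_at_top])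
        (unfold divide_inverse, rule filterlim_tendsto_pos_mult_at_top[OF tendsto_const _ filterlim_inverse_at_top_right], use 3 in simp)
    moreover have "((\<lambda>y. arctan ((p - t) / y)) \<longlongrightarrow> - (pi / 2)) (at_right 0)"
    proof -
      have "filterlim (\<lambda>y. - ((t - p) / y)) at_bot (at_right 0)"
        unfolding filterlim_uminus_at_top[symmetric]
        by (unfold divide_inverse, rule filterlim_tendsto_pos_mult_at_top[OF tendsto_const _ filterlim_inverse_at_top_right], use 3 in simp)
      then have "filterlim (\<lambda>y. (p - t) / y) at_bot (at_right 0)" by (simp add: minus_divide_left)
      then show ?thesis by (rule filterlim_compose[OF tendsto_arctan_at_bot])
    qed
    ultimately have "((\<lambda>y. kernel p q y t) \<longlongrightarrow> 0 * (q - p) + (t - p) * (q - t) * (pi / 2 - - (pi / 2))) (at_right 0)"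
      unfolding kernel_def by (intro tendsto_intros)
    then show ?thesis using 3 by (simp add: mult_ac)
  qed
qed

lemma kernel_integrand_bound:
  fixes p q t x y :: real
  assumes y: "0 < y" and x: "p \<le> x" "x \<le> q"
  shows "\<bar>y + (t - p) * (q - t) * (y / ((x - t)\<^sup>2 + y\<^sup>2))\<bar> \<le> 3 * y + 2 * (q - p)\<^sup>2 / y"
proof -
  define s where "s = (x - t)\<^sup>2 + y\<^sup>2"
  have s: "0 < s" using y unfolding s_def by (intro add_nonneg_pos) auto
  have "\<bar>(t - p) * (q - t)\<bar> \<le> (\<bar>x - t\<bar> + (q - p)) * (\<bar>x - t\<bar> + (q - p))"
    unfolding abs_mult using x by (intro mult_mono) auto
  also have "\<dots> \<le> 2 * (x - t)\<^sup>2 + 2 * (q - p)\<^sup>2"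
    using sum_squares_bound[of "\<bar>x - t\<bar>" "q - p"] by (simp add: power2_eq_square algebra_simps)
  finally have a: "\<bar>(t - p) * (q - t)\<bar> \<le> 2 * (x - t)\<^sup>2 + 2 * (q - p)\<^sup>2" .
  have "(2 * (x - t)\<^sup>2 + 2 * (q - p)\<^sup>2) * (y / s) = 2 * y * ((x - t)\<^sup>2 / s) + 2 * (q - p)\<^sup>2 * (y / s)"
    by (simp add: add_divide_distrib algebra_simps)
  also have "\<dots> \<le> 2 * y * 1 + 2 * (q - p)\<^sup>2 * (1 / y)"
  proof (intro add_mono mult_left_mono)
    show "(x - t)\<^sup>2 / s \<le> 1" using s unfolding s_def by simp
    have "y\<^sup>2 \<le> s" unfolding s_def by simp
    then show "y / s \<le> 1 / y" using s y by (simp add: field_simps power2_eq_square)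
  qed (use y in auto)
  finally have b: "(2 * (x - t)\<^sup>2 + 2 * (q - p)\<^sup>2) * (y / s) \<le> 2 * y + 2 * (q - p)\<^sup>2 / y" by simp
  have "\<bar>(t - p) * (q - t) * (y / s)\<bar> = \<bar>(t - p) * (q - t)\<bar> * (y / s)" using s y by (simp add: abs_mult)
  also have "\<dots> \<le> (2 * (x - t)\<^sup>2 + 2 * (q - p)\<^sup>2) * (y / s)" using s y by (intro mult_right_mono a) auto
  finally show ?thesis using b y unfolding s_def by linarith
qed

text \<open>
  Fubini's theorem; the integrand is bounded for fixed \<open>y\<close> and supported in a strip of finite
  measure.
\<close>

lemma Stieltjes_bump_kernel:
  assumes fin: "finite_measure \<sigma>" and sets [measurable_cong]: "sets \<sigma> = sets borel" and y: "0 < y" and pq: "p \<le> q"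
  shows "(\<integral>x. indicator {p..q} x * Im (bump p q (Complex x y) * (\<integral>t. 1 / (of_real t - Complex x y) \<partial>\<sigma>)) \<partial>lborel)
    = (\<integral>t. kernel p q y t \<partial>\<sigma>)"
proof -
  interpret finite_measure \<sigma> by fact
  interpret pair_sigma_finite \<sigma> lborel ..
  have sp: "space \<sigma> = UNIV" using sets_eq_imp_space_eq[OF sets] by simp
  define F where "F = (\<lambda>t x. indicator {p..q} x * (y + (t - p) * (q - t) * (y / ((x - t)\<^sup>2 + y\<^sup>2))))"
  have nz: "complex_of_real t - Complex x y \<noteq> 0" for t x using y by (simp add: complex_eq_iff)
  have int: "integrable \<sigma> (\<lambda>t. 1 / (complex_of_real t - Complex x y))" for x
  proof (rule integrable_const_bound[of _ "1 / y"])
    show "AE t in \<sigma>. norm (1 / (complex_of_real t - Complex x y)) \<le> 1 / y"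
    proof (rule AE_I2)
      fix t
      have "y \<le> cmod (complex_of_real t - Complex x y)"
        using abs_Im_le_cmod[of "complex_of_real t - Complex x y"] y by simp
      then show "norm (1 / (complex_of_real t - Complex x y)) \<le> 1 / y"
        using y by (simp add: norm_divide frac_le)
    qed
  qed measurable
  have in1: "indicator {p..q} x * Im (bump p q (Complex x y) * (\<integral>t. 1 / (of_real t - Complex x y) \<partial>\<sigma>)) = (\<integral>t. F t x \<partial>\<sigma>)" for x
  proof -
    have "bump p q (Complex x y) * (\<integral>t. 1 / (of_real t - Complex x y) \<partial>\<sigma>) = (\<integral>t. bump p q (Complex x y) * (1 / (of_real t - Complex x y)) \<partial>\<sigma>)"
      by (rule Bochner_Integration.integral_mult_right_zero[symmetric])
    then have "Im (bump p q (Complex x y) * (\<integral>t. 1 / (of_real t - Complex x y) \<partial>\<sigma>)) = (\<integral>t. Im (bump p q (Complex x y) * (1 / (of_real t - Complex x y))) \<partial>\<sigma>)"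
      using integral_Im[OF integrable_mult_right[OF int[of x], of "bump p q (Complex x y)"]] by simp
    also have "\<dots> = (\<integral>t. y + (t - p) * (q - t) * (y / ((x - t)\<^sup>2 + y\<^sup>2)) \<partial>\<sigma>)"
      using bump_kernel[of y p q x] y by simp
    finally show ?thesis unfolding F_def by (simp only: Bochner_Integration.integral_mult_right_zero)
  qed
  have intF: "integrable (\<sigma> \<Otimes>\<^sub>M lborel) (case_prod F)"
  proof (rule Bochner_Integration.integrable_bound)
    let ?D = "3 * y + 2 * (q - p)\<^sup>2 / y"
    have "emeasure (\<sigma> \<Otimes>\<^sub>M lborel) (UNIV \<times> {p..q}) = emeasure \<sigma> UNIV * emeasure lborel {p..q}"
      by (rule lborel.emeasure_pair_measure_Times) (auto simp: sets)
    also have "\<dots> < \<infinity>" using pq by (auto simp: emeasure_eq_measure ennreal_mult_less_top)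
    finally have "integrable (\<sigma> \<Otimes>\<^sub>M lborel) (indicator (UNIV \<times> {p..q}) :: _ \<Rightarrow> real)"
      by (intro integrable_real_indicator) (auto simp: sets)
    then show "integrable (\<sigma> \<Otimes>\<^sub>M lborel) (\<lambda>z. ?D * indicator (UNIV \<times> {p..q}) z)" by (rule integrable_mult_right)
    show "case_prod F \<in> borel_measurable (\<sigma> \<Otimes>\<^sub>M lborel)" unfolding F_def by measurable
    show "AE z in \<sigma> \<Otimes>\<^sub>M lborel. norm (case_prod F z) \<le> norm (?D * indicator (UNIV \<times> {p..q}) z)"
    proof (rule AE_I2)
      fix z :: "real \<times> real"
      obtain t x where z: "z = (t, x)" by (cases z)
      show "norm (case_prod F z) \<le> norm (?D * indicator (UNIV \<times> {p..q}) z)"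
      proof (cases "x \<in> {p..q}")
        case True
        then have "\<bar>F t x\<bar> \<le> ?D" using kernel_integrand_bound[OF y, of p x q t] unfolding F_def by simp
        also have "\<dots> \<le> \<bar>?D\<bar>" by simp
        finally show ?thesis using True unfolding z by (simp add: indicator_def)
      next
        case False then show ?thesis unfolding z F_def by simp
      qed
    qed
  qed
  have "(\<integral>x. F t x \<partial>lborel) = kernel p q y t" for t
    using kernel_integral[OF y pq, of t] unfolding F_def by simp
  then show ?thesis unfolding in1 using Fubini_integral[OF intF] by simp
qed

text \<open>
  Both limits are taken in the estimate of \<open>bump_boundary_shift\<close>, which does not depend on \<open>n\<close>: first
  \<open>n \<rightarrow> \<infinity>\<close> at heights \<open>0\<close> and \<open>y\<close>, then \<open>y \<rightarrow> 0\<close> along \<open>1 / (j + 1)\<close>.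
\<close>

lemma Stieltjes_inversion_bump:
  fixes m :: "nat \<Rightarrow> complex \<Rightarrow> complex" and w :: "real \<Rightarrow> real"
  assumes fin: "finite_measure \<sigma>" and sets [measurable_cong]: "sets \<sigma> = sets borel" and pq: "p \<le> q"
    and diff: "\<And>n z. 0 \<le> Im z \<Longrightarrow> m n field_differentiable at z"
    and bound: "\<And>n z. 0 < Im z \<Longrightarrow> cmod (m n z) \<le> 1 / Im z"
    and conv: "\<And>z. 0 < Im z \<Longrightarrow> (\<lambda>n. m n z) \<longlonglongrightarrow> (\<integral>t. 1 / (of_real t - z) \<partial>\<sigma>)"
    and real: "\<And>x. p \<le> x \<Longrightarrow> x \<le> q \<Longrightarrow> (\<lambda>n. Im (m n (of_real x))) \<longlonglongrightarrow> pi * w x"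
    and dom: "\<And>n x. N0 \<le> n \<Longrightarrow> p \<le> x \<Longrightarrow> x \<le> q \<Longrightarrow> \<bar>Im (m n (of_real x))\<bar> \<le> C"
  shows "(\<integral>t. indicator {p..q} t * ((t - p) * (q - t)) \<partial>\<sigma>) = (\<integral>x. indicator {p..q} x * ((x - p) * (q - x)) * w x \<partial>lborel)"
proof -
  interpret finite_measure \<sigma> by fact
  let ?bm = "\<lambda>n y x. bump p q (Complex x y) * m n (Complex x y)"
  define A where "A n y = (\<integral>x. indicator {p..q} x *\<^sub>R ?bm n y x \<partial>lborel)" for n y
  have cbump: "continuous_on S (\<lambda>x. bump p q (Complex x y))" for S y
    unfolding bump_def Complex_eq by (intro continuous_intros)
  have cm: "continuous_on S (\<lambda>x. m n (Complex x y))" if "0 \<le> y" for S n y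
  proof -
    have "continuous_on {z. 0 \<le> Im z} (m n)"
      using diff by (auto intro!: continuous_at_imp_continuous_on field_differentiable_imp_continuous_at)
    then show ?thesis
    proof (rule continuous_on_compose2)
      show "continuous_on S (\<lambda>x. Complex x y)" unfolding Complex_eq by (intro continuous_intros)
    qed (use that in auto)
  qed
  have iA: "integrable lborel (\<lambda>x. indicator {p..q} x *\<^sub>R ?bm n y x)" if "0 \<le> y" for n y
    using borel_integrable_atLeastAtMost'[OF continuous_on_mult[OF cbump cm[OF that]], of p q y n]
    unfolding set_integrable_def .
  have ImA: "Im (A n y) = (\<integral>x. indicator {p..q} x * Im (?bm n y x) \<partial>lborel)" if "0 \<le> y" for n y
    unfolding A_def using integral_Im[OF iA[OF that, of n]] by (simp only: scaleR_complex.sel)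
  have shift: "cmod (A n y - A n 0) \<le> 2 * (q - p + 1) * y" if "0 \<le> y" "y \<le> 1" for n y
    unfolding A_def by (rule bump_boundary_shift[OF pq that diff bound])
  define W where "W = (\<integral>x. indicator {p..q} x * ((x - p) * (q - x)) * (pi * w x) \<partial>lborel)"
  have A0: "(\<lambda>n. Im (A n 0)) \<longlonglongrightarrow> W"
  proof -
    have b0: "Im (?bm n 0 x) = (x - p) * (q - x) * Im (m n (of_real x))" for n x
    proof -
      have "Complex x 0 = of_real x" by (simp add: complex_eq_iff)
      then have "?bm n 0 x = of_real ((x - p) * (q - x)) * m n (of_real x)" unfolding bump_def by simp
      then show ?thesis by simp
    qed
    have m0: "(\<lambda>x. indicator {p..q} x * ((x - p) * (q - x)) * Im (m n (of_real x))) \<in> borel_measurable lborel" for n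
    proof -
      have "(\<lambda>x. Im (indicator {p..q} x *\<^sub>R ?bm n 0 x)) \<in> borel_measurable lborel"
        using borel_measurable_integrable[OF iA[of 0 n]] by measurable
      then show ?thesis by (simp only: scaleR_complex.sel b0 mult.assoc)
    qed
    have pt: "(\<lambda>n. indicator {p..q} x * ((x - p) * (q - x)) * Im (m n (of_real x))) \<longlonglongrightarrow> indicator {p..q} x * ((x - p) * (q - x)) * (pi * w x)" for x
    proof (cases "x \<in> {p..q}")
      case True
      then show ?thesis by (intro tendsto_intros real) auto
    qed simp
    have "(\<lambda>n. \<integral>x. indicator {p..q} x * ((x - p) * (q - x)) * Im (m (n + N0) (of_real x)) \<partial>lborel) \<longlonglongrightarrow> W"
      unfolding W_def
    proof (rule integral_dominated_convergence[where w = "\<lambda>x. indicator {p..q} x * ((q - p)\<^sup>2 * \<bar>C\<bar>)"])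
      show "(\<lambda>x. indicator {p..q} x * ((x - p) * (q - x)) * (pi * w x)) \<in> borel_measurable lborel"
        by (rule borel_measurable_LIMSEQ_real[OF pt m0])
      show "(\<lambda>x. indicator {p..q} x * ((x - p) * (q - x)) * Im (m (n + N0) (of_real x))) \<in> borel_measurable lborel" for n
        by (rule m0)
      show "integrable lborel (\<lambda>x. indicator {p..q} x * ((q - p)\<^sup>2 * \<bar>C\<bar>))"
        by (intro integrable_mult_left integrable_real_indicator) (use pq in auto)
      show "AE x in lborel. (\<lambda>n. indicator {p..q} x * ((x - p) * (q - x)) * Im (m (n + N0) (of_real x))) \<longlonglongrightarrow> indicator {p..q} x * ((x - p) * (q - x)) * (pi * w x)"
        by (rule AE_I2) (rule LIMSEQ_ignore_initial_segment[OF pt])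
      show "AE x in lborel. norm (indicator {p..q} x * ((x - p) * (q - x)) * Im (m (n + N0) (of_real x))) \<le> indicator {p..q} x * ((q - p)\<^sup>2 * \<bar>C\<bar>)" for n
      proof (rule AE_I2)
        fix x
        show "norm (indicator {p..q} x * ((x - p) * (q - x)) * Im (m (n + N0) (of_real x))) \<le> indicator {p..q} x * ((q - p)\<^sup>2 * \<bar>C\<bar>)"
        proof (cases "x \<in> {p..q}")
          case True
          then have "\<bar>(x - p) * (q - x)\<bar> * \<bar>Im (m (n + N0) (of_real x))\<bar> \<le> (q - p)\<^sup>2 * \<bar>C\<bar>"
            unfolding power2_eq_square abs_mult[of "x - p"]
            by (intro mult_mono order_trans[OF dom abs_ge_self]) auto
          then show ?thesis using True by (simp add: abs_mult)
        qed simp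
      qed
    qed
    then have "(\<lambda>n. Im (A (n + N0) 0)) \<longlonglongrightarrow> W" by (simp only: ImA[OF order_refl] b0 mult.assoc)
    then show ?thesis by (rule LIMSEQ_offset)
  qed
  have Ay: "(\<lambda>n. Im (A n y)) \<longlonglongrightarrow> (\<integral>t. kernel p q y t \<partial>\<sigma>)" if y: "0 < y" for y
  proof -
    let ?M = "\<lambda>x. \<integral>t. 1 / (of_real t - Complex x y) \<partial>\<sigma>"
    have pt: "(\<lambda>n. indicator {p..q} x * Im (?bm n y x)) \<longlonglongrightarrow> indicator {p..q} x * Im (bump p q (Complex x y) * ?M x)" for x
      by (intro tendsto_intros conv) (use y in simp)
    have my: "(\<lambda>x. indicator {p..q} x * Im (?bm n y x)) \<in> borel_measurable lborel" for n
    proof -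
      have "(\<lambda>x. Im (indicator {p..q} x *\<^sub>R ?bm n y x)) \<in> borel_measurable lborel"
        using borel_measurable_integrable[OF iA[of y n, OF less_imp_le[OF y]]] by measurable
      then show ?thesis by (simp only: scaleR_complex.sel)
    qed
    have "(\<lambda>n. Im (A n y)) \<longlonglongrightarrow> (\<integral>x. indicator {p..q} x * Im (bump p q (Complex x y) * ?M x) \<partial>lborel)"
      unfolding ImA[OF less_imp_le[OF y]]
    proof (rule integral_dominated_convergence[where w = "\<lambda>x. indicator {p..q} x * (cmod (bump p q (Complex x y)) * (1 / y))"])
      show "(\<lambda>x. indicator {p..q} x * Im (bump p q (Complex x y) * ?M x)) \<in> borel_measurable lborel"
        by (rule borel_measurable_LIMSEQ_real[OF pt my])
      show "integrable lborel (\<lambda>x. indicator {p..q} x * (cmod (bump p q (Complex x y)) * (1 / y)))"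
        using borel_integrable_atLeastAtMost'[OF continuous_on_mult[OF continuous_on_norm[OF cbump] continuous_on_const], of p q y "1 / y"]
        unfolding set_integrable_def real_scaleR_def .
      show "AE x in lborel. (\<lambda>n. indicator {p..q} x * Im (?bm n y x)) \<longlonglongrightarrow> indicator {p..q} x * Im (bump p q (Complex x y) * ?M x)"
        by (rule AE_I2) (rule pt)
      show "AE x in lborel. norm (indicator {p..q} x * Im (?bm n y x)) \<le> indicator {p..q} x * (cmod (bump p q (Complex x y)) * (1 / y))" for n
      proof (rule AE_I2)
        fix x
        have "\<bar>Im (?bm n y x)\<bar> \<le> cmod (?bm n y x)" by (rule abs_Im_le_cmod)
        also have "\<dots> \<le> cmod (bump p q (Complex x y)) * (1 / y)"
          unfolding norm_mult using bound[of "Complex x y" n] y by (intro mult_left_mono) auto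
        finally show "norm (indicator {p..q} x * Im (?bm n y x)) \<le> indicator {p..q} x * (cmod (bump p q (Complex x y)) * (1 / y))"
          by (auto simp: indicator_def)
      qed
    qed (rule my)
    then show ?thesis unfolding Stieltjes_bump_kernel[OF fin sets y pq] .
  qed
  have close: "\<bar>(\<integral>t. kernel p q y t \<partial>\<sigma>) - W\<bar> \<le> 2 * (q - p + 1) * y" if y: "0 < y" "y \<le> 1" for y
  proof (rule LIMSEQ_le_const2)
    show "(\<lambda>n. \<bar>Im (A n y) - Im (A n 0)\<bar>) \<longlonglongrightarrow> \<bar>(\<integral>t. kernel p q y t \<partial>\<sigma>) - W\<bar>"
      by (intro tendsto_intros Ay A0 y)
    have "\<bar>Im (A n y) - Im (A n 0)\<bar> \<le> 2 * (q - p + 1) * y" for n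
      using order_trans[OF abs_Im_le_cmod shift[of y n]] y by simp
    then show "\<exists>N. \<forall>n\<ge>N. \<bar>Im (A n y) - Im (A n 0)\<bar> \<le> 2 * (q - p + 1) * y" by blast
  qed
  define ys where "ys = (\<lambda>j. 1 / real (Suc j))"
  have ys: "0 < ys j" "ys j \<le> 1" for j unfolding ys_def by auto
  have ys0: "ys \<longlonglongrightarrow> 0" unfolding ys_def using LIMSEQ_inverse_real_of_nat by (simp add: inverse_eq_divide)
  have ysr: "filterlim ys (at_right 0) sequentially"
  proof -
    have "ys j \<noteq> 0" for j using ys(1)[of j] by simp
    then show ?thesis unfolding filterlim_at using ys0 ys(1) by (auto intro!: always_eventually)
  qed
  have K: "(\<lambda>j. \<integral>t. kernel p q (ys j) t \<partial>\<sigma>) \<longlonglongrightarrow> (\<integral>t. pi * (indicator {p..q} t * ((t - p) * (q - t))) \<partial>\<sigma>)"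
  proof (rule integral_dominated_convergence[where w = "\<lambda>t. 2 * (q - p) + (q - p)\<^sup>2 * pi"])
    show "AE t in \<sigma>. (\<lambda>j. kernel p q (ys j) t) \<longlonglongrightarrow> pi * (indicator {p..q} t * ((t - p) * (q - t)))"
      by (rule AE_I2) (rule filterlim_compose[OF kernel_tendsto[OF pq] ysr])
    show "AE t in \<sigma>. norm (kernel p q (ys j) t) \<le> 2 * (q - p) + (q - p)\<^sup>2 * pi" for j
    proof (rule AE_I2)
      fix t
      have y1: "ys j * (q - p) \<le> 1 * (q - p)" using ys[of j] pq by (intro mult_right_mono) auto
      have "0 \<le> (q - p)\<^sup>2 * pi" by simp
      then show "norm (kernel p q (ys j) t) \<le> 2 * (q - p) + (q - p)\<^sup>2 * pi"
      proof (cases "t < p \<or> q < t")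
        case True
        have "2 * ys j * (q - p) = 2 * (ys j * (q - p))" by simp
        then show ?thesis using kernel_outside[OF ys(1)[of j] pq True] y1 \<open>0 \<le> (q - p)\<^sup>2 * pi\<close>
          unfolding real_norm_def by linarith
      next
        case False
        then have "p \<le> t" "t \<le> q" by auto
        have aux: "k \<le> a + D \<Longrightarrow> a \<le> 1 * c \<Longrightarrow> 0 \<le> c \<Longrightarrow> k \<le> 2 * c + D" for k a c D :: real
          by linarith
        show ?thesis unfolding real_norm_def
          by (rule aux[OF kernel_inside[OF ys(1)[of j] \<open>p \<le> t\<close> \<open>t \<le> q\<close>] y1]) (use pq in simp)
      qed
    qed
    show "(\<lambda>t. kernel p q (ys j) t) \<in> borel_measurable \<sigma>" for j unfolding kernel_def by measurable
  qed auto
  have "(\<lambda>j. \<bar>(\<integral>t. kernel p q (ys j) t \<partial>\<sigma>) - W\<bar>) \<longlonglongrightarrow> 0"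
  proof (rule tendsto_sandwich[OF _ _ tendsto_const])
    show "\<forall>\<^sub>F j in sequentially. \<bar>(\<integral>t. kernel p q (ys j) t \<partial>\<sigma>) - W\<bar> \<le> 2 * (q - p + 1) * ys j"
      using close[OF ys] by (intro always_eventually) blast
    show "(\<lambda>j. 2 * (q - p + 1) * ys j) \<longlonglongrightarrow> 0" using tendsto_mult_right_zero[OF ys0] by simp
  qed auto
  then have "(\<lambda>j. \<integral>t. kernel p q (ys j) t \<partial>\<sigma>) \<longlonglongrightarrow> W"
    by (simp add: tendsto_rabs_zero_iff LIM_zero_iff)
  then have "(\<integral>t. pi * (indicator {p..q} t * ((t - p) * (q - t))) \<partial>\<sigma>) = W" using K LIMSEQ_unique by blast
  also have "W = pi * (\<integral>x. indicator {p..q} x * ((x - p) * (q - x)) * w x \<partial>lborel)"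
  proof -
    have "W = (\<integral>x. pi * (indicator {p..q} x * ((x - p) * (q - x)) * w x) \<partial>lborel)"
      unfolding W_def by (intro Bochner_Integration.integral_cong) auto
    then show ?thesis by (simp only: Bochner_Integration.integral_mult_right_zero)
  qed
  finally show ?thesis by (simp only: Bochner_Integration.integral_mult_right_zero mult_cancel_left) simp
qed

section \<open>Densities from integrals of hat functions\<close>

definition hat :: "real \<Rightarrow> real \<Rightarrow> real \<Rightarrow> real" where
  "hat a c t = indicator {a..c} t * ((t - a) * (c - t))"

text \<open>
  A second mixed difference of hat functions in their two endpoints. Differencing twice removes the
  quadratic profile and leaves a function equal to \<open>1\<close> between two linear ramps, of which the left
  one lies inside and the right one outside the interval; the pointwise limit is the indicator of
  the half-open interval.
\<close>

definition trapezoid :: "real \<Rightarrow> real \<Rightarrow> real \<Rightarrow> real \<Rightarrow> real" where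
  "trapezoid h p q t = (hat p (q + h) t - hat p q t - hat (p + h) (q + h) t + hat (p + h) q t) / h\<^sup>2"

lemma trapezoid_eq:
  assumes h: "0 < h" "h \<le> q - p"
  shows "trapezoid h p q t = (if t < p then 0 else if t < p + h then (t - p) / h
    else if t \<le> q then 1 else if t \<le> q + h then (q + h - t) / h else 0)"
proof -
  have "hat p (q + h) t - hat p q t - hat (p + h) (q + h) t + hat (p + h) q t = h\<^sup>2 * (if t < p then 0 else if t < p + h then (t - p) / h
    else if t \<le> q then 1 else if t \<le> q + h then (q + h - t) / h else 0)"
    unfolding hat_def using h by (auto simp: indicator_def power2_eq_square field_simps)
  then show ?thesis unfolding trapezoid_def using h by simp
qed

lemma trapezoid_bounds:
  assumes h: "0 < h" "h \<le> q - p"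
  shows "0 \<le> trapezoid h p q t" "trapezoid h p q t \<le> 1" "trapezoid h p q t \<noteq> 0 \<Longrightarrow> t \<in> {p..q + h}"
  unfolding trapezoid_eq[OF h] using h by (auto split: if_splits)

lemma trapezoid_tendsto:
  assumes pq: "p < q"
  shows "((\<lambda>h. trapezoid h p q t) \<longlongrightarrow> indicator {p<..q} t) (at_right 0)"
proof (rule tendsto_eventually)
  define e where "e = min (q - p) (if t \<le> p then 1 else if t \<le> q then t - p else t - q)"
  have e: "0 < e" unfolding e_def using pq by auto
  show "\<forall>\<^sub>F h in at_right 0. trapezoid h p q t = indicator {p<..q} t"
    unfolding eventually_at_right_field
  proof (intro exI[of _ e] conjI e allI impI)
    fix h :: real assume h: "0 < h" "h < e"
    then have "h \<le> q - p" unfolding e_def by simp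
    then show "trapezoid h p q t = indicator {p<..q} t"
      unfolding trapezoid_eq[OF h(1) \<open>h \<le> q - p\<close>] using h unfolding e_def by (auto simp: indicator_def split: if_splits)
  qed
qed

lemma hat_measurable [measurable]: "hat a c \<in> borel_measurable borel"
  unfolding hat_def by measurable

lemma hat_bound: "\<bar>hat a c t\<bar> \<le> (c - a)\<^sup>2 * indicator {a..c} t"
proof (cases "t \<in> {a..c}")
  case True
  then have "\<bar>(t - a) * (c - t)\<bar> \<le> (c - a)\<^sup>2"
    unfolding abs_mult power2_eq_square by (intro mult_mono) auto
  then show ?thesis using True unfolding hat_def by simp
qed (simp add: hat_def)

lemma interval_measure_from_hats:
  assumes fin: "finite_measure \<sigma>" and sets [measurable_cong]: "sets \<sigma> = sets borel"
    and pq: "P \<le> p" "p < q" "q < Q"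
    and w: "integrable lborel (\<lambda>x. indicator {P..Q} x * w x)"
    and hats: "\<And>a c. P \<le> a \<Longrightarrow> a \<le> c \<Longrightarrow> c \<le> Q \<Longrightarrow> (\<integral>t. hat a c t \<partial>\<sigma>) = (\<integral>x. hat a c x * w x \<partial>lborel)"
  shows "measure \<sigma> {p<..q} = (\<integral>x. indicator {p<..q} x * w x \<partial>lborel)"
proof -
  interpret finite_measure \<sigma> by fact
  define h0 where "h0 = min (q - p) (Q - q)"
  have h0: "0 < h0" "h0 \<le> q - p" "h0 \<le> Q - q" unfolding h0_def using pq by auto
  have i1: "integrable \<sigma> (hat a c)" for a c
  proof (rule integrable_const_bound[of _ "(c - a)\<^sup>2"])
    show "AE x in \<sigma>. norm (hat a c x) \<le> (c - a)\<^sup>2"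
    proof (rule AE_I2)
      fix x show "norm (hat a c x) \<le> (c - a)\<^sup>2"
        unfolding real_norm_def by (rule order_trans[OF hat_bound]) (simp add: indicator_def)
    qed
  qed measurable
  have wm: "(\<lambda>x. g x * w x) \<in> borel_measurable lborel" if g [measurable]: "g \<in> borel_measurable borel" and z: "\<And>x. x \<notin> {P..Q} \<Longrightarrow> g x = 0" for g
  proof -
    have [measurable]: "(\<lambda>x. indicator {P..Q} x * w x) \<in> borel_measurable borel" using borel_measurable_integrable[OF w] by simp
    have "(\<lambda>x. g x * (indicator {P..Q} x * w x)) \<in> borel_measurable lborel" by measurable
    moreover have "g x * (indicator {P..Q} x * w x) = g x * w x" for x using z[of x] by (auto simp: indicator_def)
    ultimately show ?thesis by simp
  qed
  have dominated: "norm (g x * w x) \<le> B * norm (indicator {P..Q} x * w x)"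
    if "\<bar>g x\<bar> \<le> B" "x \<notin> {P..Q} \<Longrightarrow> g x = 0" for g :: "real \<Rightarrow> real" and B x
    using that by (cases "x \<in> {P..Q}") (auto simp: abs_mult mult_right_mono)
  have i2: "integrable lborel (\<lambda>x. hat a c x * w x)" if "P \<le> a" "c \<le> Q" for a c
  proof (rule Bochner_Integration.integrable_bound)
    show "integrable lborel (\<lambda>x. (c - a)\<^sup>2 * norm (indicator {P..Q} x * w x))"
      by (intro integrable_mult_right integrable_norm w)
    have z: "hat a c x = 0" if "x \<notin> {P..Q}" for x using that \<open>P \<le> a\<close> \<open>c \<le> Q\<close> unfolding hat_def by auto
    show "(\<lambda>x. hat a c x * w x) \<in> borel_measurable lborel" by (rule wm[OF hat_measurable z])
    show "AE x in lborel. norm (hat a c x * w x) \<le> norm ((c - a)\<^sup>2 * norm (indicator {P..Q} x * w x))"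
    proof (rule AE_I2)
      fix x
      have "\<bar>hat a c x\<bar> \<le> (c - a)\<^sup>2" by (rule order_trans[OF hat_bound]) (simp add: indicator_def)
      from dominated[of "hat a c", OF this z] show "norm (hat a c x * w x) \<le> norm ((c - a)\<^sup>2 * norm (indicator {P..Q} x * w x))"
        by (simp add: abs_mult)
    qed
  qed
  have eq: "(\<integral>t. trapezoid h p q t \<partial>\<sigma>) = (\<integral>x. trapezoid h p q x * w x \<partial>lborel)" if h: "0 < h" "h \<le> h0" for h
  proof -
    have b: "P \<le> p" "P \<le> p + h" "q + h \<le> Q" "q \<le> Q" "p \<le> q + h" "p \<le> q" "p + h \<le> q + h" "p + h \<le> q"
      using pq h h0 by auto
    have "(\<integral>t. trapezoid h p q t \<partial>\<sigma>) = ((\<integral>t. hat p (q + h) t \<partial>\<sigma>) - (\<integral>t. hat p q t \<partial>\<sigma>) - (\<integral>t. hat (p + h) (q + h) t \<partial>\<sigma>) + (\<integral>t. hat (p + h) q t \<partial>\<sigma>)) / h\<^sup>2"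
      unfolding trapezoid_def by (simp add: i1)
    also have "\<dots> = ((\<integral>t. hat p (q + h) t * w t \<partial>lborel) - (\<integral>t. hat p q t * w t \<partial>lborel) - (\<integral>t. hat (p + h) (q + h) t * w t \<partial>lborel) + (\<integral>t. hat (p + h) q t * w t \<partial>lborel)) / h\<^sup>2"
      by (simp only: hats b)
    also have "\<dots> = (\<integral>x. (hat p (q + h) x * w x - hat p q x * w x - hat (p + h) (q + h) x * w x + hat (p + h) q x * w x) / h\<^sup>2 \<partial>lborel)"
      by (simp add: i2 b)
    also have "\<dots> = (\<integral>x. trapezoid h p q x * w x \<partial>lborel)"
      unfolding trapezoid_def by (intro Bochner_Integration.integral_cong) (auto simp: algebra_simps)
    finally show ?thesis .
  qed
  define hs where "hs = (\<lambda>j. h0 / real (Suc j))"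
  have hs: "0 < hs j" "hs j \<le> h0" "hs j \<le> q - p" for j
  proof -
    show "0 < hs j" unfolding hs_def using h0 by simp
    show *: "hs j \<le> h0" unfolding hs_def using h0 by (simp add: field_simps)
    then show "hs j \<le> q - p" using h0 by simp
  qed
  have hs0: "hs \<longlonglongrightarrow> 0"
    unfolding hs_def using tendsto_mult_right_zero[OF LIMSEQ_inverse_real_of_nat, of h0] by (simp add: divide_inverse)
  have hsr: "filterlim hs (at_right 0) sequentially"
  proof -
    have "hs j \<noteq> 0" for j using hs(1)[of j] by simp
    then show ?thesis unfolding filterlim_at using hs0 hs(1) by (auto intro!: always_eventually)
  qed
  have tm [measurable]: "trapezoid h p q \<in> borel_measurable borel" for h unfolding trapezoid_def by measurable
  have pt: "(\<lambda>j. trapezoid (hs j) p q t) \<longlonglongrightarrow> indicator {p<..q} t" for t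
    by (rule filterlim_compose[OF trapezoid_tendsto[OF pq(2)] hsr])
  have z: "trapezoid (hs j) p q x = 0" if "x \<notin> {P..Q}" for j x
  proof (rule ccontr)
    assume "trapezoid (hs j) p q x \<noteq> 0"
    then have "x \<in> {p..q + hs j}" by (rule trapezoid_bounds(3)[OF hs(1,3)])
    then show False using that pq h0 hs(2)[of j] by auto
  qed
  have "(\<lambda>j. \<integral>t. trapezoid (hs j) p q t \<partial>\<sigma>) \<longlonglongrightarrow> (\<integral>t. indicator {p<..q} t \<partial>\<sigma>)"
  proof (rule integral_dominated_convergence[where w = "\<lambda>_. 1"])
    show "AE x in \<sigma>. norm (trapezoid (hs j) p q x) \<le> 1" for j
      using trapezoid_bounds[OF hs(1,3)[of j]] by (intro AE_I2) simp
    show "AE x in \<sigma>. (\<lambda>j. trapezoid (hs j) p q x) \<longlonglongrightarrow> indicator {p<..q} x" by (rule AE_I2) (rule pt)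
  qed auto
  moreover have "(\<lambda>j. \<integral>x. trapezoid (hs j) p q x * w x \<partial>lborel) \<longlonglongrightarrow> (\<integral>x. indicator {p<..q} x * w x \<partial>lborel)"
  proof (rule integral_dominated_convergence[where w = "\<lambda>x. norm (indicator {P..Q} x * w x)"])
    show "(\<lambda>x. indicator {p<..q} x * w x) \<in> borel_measurable lborel"
      by (rule wm) (use pq in auto)
    show "(\<lambda>x. trapezoid (hs j) p q x * w x) \<in> borel_measurable lborel" for j
      by (rule wm) (use z in auto)
    show "integrable lborel (\<lambda>x. norm (indicator {P..Q} x * w x))" by (intro integrable_norm w)
    show "AE x in lborel. (\<lambda>j. trapezoid (hs j) p q x * w x) \<longlonglongrightarrow> indicator {p<..q} x * w x"
      by (intro AE_I2 tendsto_intros pt)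
    show "AE x in lborel. norm (trapezoid (hs j) p q x * w x) \<le> norm (indicator {P..Q} x * w x)" for j
    proof (rule AE_I2)
      fix x
      have "\<bar>trapezoid (hs j) p q x\<bar> \<le> 1" using trapezoid_bounds[OF hs(1,3)[of j], of x] by simp
      from dominated[of "trapezoid (hs j) p q", OF this z] show "norm (trapezoid (hs j) p q x * w x) \<le> norm (indicator {P..Q} x * w x)" by simp
    qed
  qed
  ultimately have "(\<integral>t. indicator {p<..q} t \<partial>\<sigma>) = (\<integral>x. indicator {p<..q} x * w x \<partial>lborel)"
    using eq[OF hs(1,2)] LIMSEQ_unique by fastforce
  then show ?thesis using sets sets_eq_imp_space_eq[OF sets] by simp
qed

text \<open>
  On the interval the measure has density \<open>w\<close>. Off the null set \<open>N\<close> which carries the singular part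
  it also has density \<open>f\<close>, and densities are unique almost everywhere.
\<close>

lemma ac_density_from_hats:
  assumes fin: "finite_measure \<sigma>" and sets [measurable_cong]: "sets \<sigma> = sets borel"
    and PQ: "P < R" "R < Q"
    and w: "integrable lborel (\<lambda>x. indicator {P..Q} x * w x)" and w0: "\<And>x. x \<in> {P..Q} \<Longrightarrow> 0 \<le> w x"
    and hats: "\<And>a c. P \<le> a \<Longrightarrow> a \<le> c \<Longrightarrow> c \<le> Q \<Longrightarrow> (\<integral>t. hat a c t \<partial>\<sigma>) = (\<integral>x. hat a c x * w x \<partial>lborel)"
    and f: "is_ac_density \<sigma> f"
  shows "AE x in lborel. x \<in> {P<..R} \<longrightarrow> f x = w x"
proof -
  interpret finite_measure \<sigma> by fact
  let ?D = "{P<..R}"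
  define v where "v = (\<lambda>x. indicator {P<..R} x * w x)"
  have wm: "(\<lambda>x. indicator {P..Q} x * w x) \<in> borel_measurable borel" using borel_measurable_integrable[OF w] by simp
  have vint: "integrable lborel (\<lambda>x. indicator {p<..q} x * w x)" if "P \<le> p" "q \<le> Q" for p q
  proof (rule Bochner_Integration.integrable_bound[OF w])
    have "(\<lambda>x. indicator {p<..q} x * (indicator {P..Q} x * w x)) \<in> borel_measurable lborel" using wm by measurable
    moreover have "indicator {p<..q} x * (indicator {P..Q} x * w x) = indicator {p<..q} x * w x" for x
      using that by (auto simp: indicator_def)
    ultimately show "(\<lambda>x. indicator {p<..q} x * w x) \<in> borel_measurable lborel" by simp
    show "AE x in lborel. norm (indicator {p<..q} x * w x) \<le> norm (indicator {P..Q} x * w x)"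
      using that by (intro AE_I2) (auto simp: indicator_def)
  qed
  have vm [measurable]: "v \<in> borel_measurable borel"
    unfolding v_def using borel_measurable_integrable[OF vint[of P R]] PQ by simp
  have v0: "0 \<le> v x" for x unfolding v_def using w0[of x] PQ by (auto simp: indicator_def)
  define M1 where "M1 = density \<sigma> (indicator ?D)"
  define M2 where "M2 = density lborel (\<lambda>x. ennreal (v x))"
  have M1: "emeasure M1 B = emeasure \<sigma> (?D \<inter> B)" if "B \<in> sets borel" for B
  proof -
    have "emeasure M1 B = (\<integral>\<^sup>+x. indicator ?D x * indicator B x \<partial>\<sigma>)"
      unfolding M1_def by (rule emeasure_density) (use that in \<open>auto simp: sets\<close>)
    also have "\<dots> = (\<integral>\<^sup>+x. indicator (?D \<inter> B) x \<partial>\<sigma>)" by (simp add: indicator_inter_arith)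
    also have "\<dots> = emeasure \<sigma> (?D \<inter> B)" using that by (simp add: sets)
    finally show ?thesis .
  qed
  have "M1 = M2"
  proof (rule measure_eqI_lessThan)
    show "sets M1 = sets borel" "sets M2 = sets borel" unfolding M1_def M2_def by (simp_all add: sets)
    show "emeasure M1 {x<..} < \<infinity>" for x using M1[of "{x<..}"] by (simp add: emeasure_eq_measure)
    show "emeasure M1 {x<..} = emeasure M2 {x<..}" for x
    proof -
      have e2: "emeasure M2 {x<..} = (\<integral>\<^sup>+t. ennreal (v t) * indicator {x<..} t \<partial>lborel)"
        unfolding M2_def by (rule emeasure_density) auto
      define p where "p = max x P"
      have D: "?D \<inter> {x<..} = {p<..R}" unfolding p_def by auto
      have vi: "ennreal (v t) * indicator {x<..} t = ennreal (indicator {p<..R} t * w t)" for t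
        unfolding v_def p_def by (auto simp: indicator_def)
      show ?thesis
      proof (cases "p < R")
        case True
        have Pp: "P \<le> p" unfolding p_def by simp
        have "emeasure M1 {x<..} = ennreal (measure \<sigma> {p<..R})" using M1[of "{x<..}"] unfolding D by (simp add: emeasure_eq_measure)
        also have "measure \<sigma> {p<..R} = (\<integral>t. indicator {p<..R} t * w t \<partial>lborel)"
          by (rule interval_measure_from_hats[OF fin sets Pp True PQ(2) w hats])
        also have "ennreal \<dots> = (\<integral>\<^sup>+t. ennreal (indicator {p<..R} t * w t) \<partial>lborel)"
        proof (rule nn_integral_eq_integral[symmetric])
          show "integrable lborel (\<lambda>t. indicator {p<..R} t * w t)" by (rule vint) (use Pp PQ in auto)
          show "AE t in lborel. 0 \<le> indicator {p<..R} t * w t"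
            using w0 Pp PQ by (intro AE_I2) (auto simp: indicator_def)
        qed
        finally show ?thesis unfolding e2 vi .
      next
        case False
        then have "{p<..R} = {}" by auto
        then show ?thesis using M1[of "{x<..}"] unfolding e2 vi D by simp
      qed
    qed
  qed
  obtain \<nu> N where fm [measurable]: "f \<in> borel_measurable borel" and f0: "AE x in lborel. 0 \<le> f x"
    and N: "N \<in> null_sets lborel" "emeasure \<nu> (- N) = 0" "sets \<nu> = sets borel"
    and dec: "\<And>B. B \<in> sets borel \<Longrightarrow> emeasure \<sigma> B = emeasure (density lborel (\<lambda>x. ennreal (f x))) B + emeasure \<nu> B"
    using f unfolding is_ac_density_def by blast
  have Nb: "N \<in> sets borel" using N(1) by auto
  have AEN: "AE x in lborel. x \<notin> N" by (rule AE_not_in[OF N(1)])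
  define g where "g = (\<lambda>x. ennreal (f x) * indicator ?D x)"
  have gm [measurable]: "g \<in> borel_measurable borel" unfolding g_def by measurable
  have "density lborel g = density lborel (\<lambda>x. ennreal (v x))"
  proof (rule measure_eqI)
    fix B assume "B \<in> sets (density lborel g)"
    then have B [measurable]: "B \<in> sets borel" by simp
    define C where "C = B - N"
    have C [measurable]: "C \<in> sets borel" unfolding C_def using B Nb by auto
    have nu: "emeasure \<nu> (?D \<inter> C) = 0"
    proof -
      have "emeasure \<nu> (?D \<inter> C) \<le> emeasure \<nu> (- N)" by (rule emeasure_mono) (use Nb N in \<open>auto simp: C_def\<close>)
      then show ?thesis using N(2) by simp
    qed
    have "emeasure (density lborel g) B = (\<integral>\<^sup>+x. g x * indicator B x \<partial>lborel)" by (rule emeasure_density) auto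
    also have "\<dots> = (\<integral>\<^sup>+x. ennreal (f x) * indicator (?D \<inter> C) x \<partial>lborel)"
      by (rule nn_integral_cong_AE) (use AEN in \<open>auto elim!: eventually_mono simp: g_def C_def indicator_def\<close>)
    also have "\<dots> = emeasure (density lborel (\<lambda>x. ennreal (f x))) (?D \<inter> C)"
      by (rule emeasure_density[symmetric]) auto
    also have "\<dots> = emeasure \<sigma> (?D \<inter> C)" using dec[of "?D \<inter> C"] nu by simp
    also have "\<dots> = emeasure M2 C" using M1[OF C] \<open>M1 = M2\<close> by simp
    also have "\<dots> = (\<integral>\<^sup>+x. ennreal (v x) * indicator C x \<partial>lborel)" unfolding M2_def by (rule emeasure_density) auto
    also have "\<dots> = (\<integral>\<^sup>+x. ennreal (v x) * indicator B x \<partial>lborel)"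
      by (rule nn_integral_cong_AE) (use AEN in \<open>auto elim!: eventually_mono simp: C_def indicator_def\<close>)
    also have "\<dots> = emeasure (density lborel (\<lambda>x. ennreal (v x))) B" by (rule emeasure_density[symmetric]) auto
    finally show "emeasure (density lborel g) B = emeasure (density lborel (\<lambda>x. ennreal (v x))) B" .
  qed simp
  then have "AE x in lborel. g x = ennreal (v x)"
    by (rule sigma_finite_measure.density_unique[OF sigma_finite_lborel, rotated 2]) auto
  then show ?thesis using f0
  proof eventually_elim
    case (elim x)
    show ?case
    proof
      assume x: "x \<in> ?D"
      then have "ennreal (f x) = ennreal (w x)" using elim unfolding g_def v_def by simp
      then show "f x = w x" using elim w0[of x] x PQ by (simp add: ennreal_inj)
    qed
  qed
qed

section \<open>Gronwall estimates and one step of the recurrence\<close>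

lemma gronwall_two_sided:
  fixes g e :: "nat \<Rightarrow> real"
  assumes "\<And>k. K \<le> k \<Longrightarrow> k < n \<Longrightarrow> \<bar>g (Suc k) - g k\<bar> \<le> e k * g k"
    and "\<And>k. K \<le> k \<Longrightarrow> k < n \<Longrightarrow> 0 \<le> e k \<and> e k \<le> 1 / 2"
    and "0 \<le> g K" and "K \<le> n"
  shows "exp (- 2 * sum e {K..<n}) * g K \<le> g n \<and> g n \<le> exp (sum e {K..<n}) * g K"
  using assms(4,1,2)
proof (induction n rule: dec_induct)
  case base
  then show ?case by simp
next
  case (step n)
  have IH: "exp (- 2 * sum e {K..<n}) * g K \<le> g n" "g n \<le> exp (sum e {K..<n}) * g K"
    using step by auto
  have en: "0 \<le> e n" "e n \<le> 1 / 2" using step by auto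
  have d: "\<bar>g (Suc n) - g n\<bar> \<le> e n * g n" using step by auto
  have g0: "0 \<le> g n" using IH(1) assms(3) by (meson exp_ge_zero mult_nonneg_nonneg order_trans)
  have split: "sum e {K..<Suc n} = sum e {K..<n} + e n" using step by simp
  have "g (Suc n) \<le> (1 + e n) * g n" using d by (simp add: algebra_simps)
  also have "\<dots> \<le> exp (e n) * (exp (sum e {K..<n}) * g K)"
    by (intro mult_mono IH(2) exp_ge_add_one_self) (use g0 en in auto)
  finally have up: "g (Suc n) \<le> exp (sum e {K..<Suc n}) * g K"
    using step by (simp add: split exp_add mult_ac)
  have "exp (2 * e n) * (1 - e n) \<ge> (1 + 2 * e n) * (1 - e n)"
    by (intro mult_right_mono exp_ge_add_one_self) (use en in auto)
  moreover have "(1 + 2 * e n) * (1 - e n) = 1 + e n * (1 - 2 * e n)" by (simp add: algebra_simps)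
  moreover have "e n * (1 - 2 * e n) \<ge> 0" using en by auto
  ultimately have "exp (2 * e n) * (1 - e n) \<ge> 1" by linarith
  then have "exp (- 2 * e n) \<le> 1 - e n"
    by (simp add: exp_minus field_simps)
  then have "exp (- 2 * e n) * (exp (- 2 * sum e {K..<n}) * g K) \<le> (1 - e n) * g n"
    by (intro mult_mono IH(1)) (use en assms(3) in auto)
  also have "\<dots> \<le> g (Suc n)" using d by (simp add: algebra_simps)
  finally have "exp (- 2 * sum e {K..<Suc n}) * g K \<le> g (Suc n)"
    unfolding split by (simp add: distrib_left exp_diff exp_minus exp_add field_simps)
  with up show ?case by simp
qed

lemma convergent_if_summable_relative_increments:
  fixes g e :: "nat \<Rightarrow> real"
  assumes rel: "\<And>k. K \<le> k \<Longrightarrow> \<bar>g (Suc k) - g k\<bar> \<le> e k * g k"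
    and e: "\<And>k. K \<le> k \<Longrightarrow> 0 \<le> e k \<and> e k \<le> 1 / 2"
    and g: "0 \<le> g K" and se: "summable e"
  shows "convergent g"
proof -
  define M where "M = exp (\<Sum>k. e (k + K)) * g K"
  have se': "summable (\<lambda>k. e (k + K))" using se by (simp add: summable_iff_shift)
  have bd: "0 \<le> g (k + K)" "g (k + K) \<le> M" for k
  proof -
    have "sum e {K..<k + K} = (\<Sum>i<k. e (i + K))"
      using sum.shift_bounds_nat_ivl[of e 0 K k] by (simp add: atLeast0LessThan)
    also have "\<dots> \<le> (\<Sum>k. e (k + K))" by (rule sum_le_suminf[OF se']) (use e in auto)
    finally have *: "sum e {K..<k + K} \<le> (\<Sum>k. e (k + K))" .
    have "exp (- 2 * sum e {K..<k + K}) * g K \<le> g (k + K) \<and> g (k + K) \<le> exp (sum e {K..<k + K}) * g K"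
      by (rule gronwall_two_sided) (use rel e g in auto)
    moreover have "exp (sum e {K..<k + K}) * g K \<le> M"
      unfolding M_def by (intro mult_right_mono) (use * g in auto)
    moreover have "0 \<le> exp (- 2 * sum e {K..<k + K}) * g K" using g by simp
    ultimately show "0 \<le> g (k + K)" "g (k + K) \<le> M" by linarith+
  qed
  have "summable (\<lambda>k. g (Suc k + K) - g (k + K))"
  proof (rule summable_comparison_test')
    show "summable (\<lambda>k. M * e (k + K))" using se' by (rule summable_mult)
    show "norm (g (Suc k + K) - g (k + K)) \<le> M * e (k + K)" if "k \<ge> 0" for k
    proof -
      have "norm (g (Suc k + K) - g (k + K)) \<le> e (k + K) * g (k + K)" using rel[of "k + K"] by simp
      also have "\<dots> \<le> e (k + K) * M" by (intro mult_left_mono bd) (use e in auto)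
      finally show ?thesis by (simp add: mult.commute)
    qed
  qed
  then have "convergent (\<lambda>n. \<Sum>k<n. g (Suc k + K) - g (k + K))"
    by (simp add: summable_iff_convergent)
  then have "convergent (\<lambda>n. (g (n + K) - g (0 + K)) + g K)"
    unfolding sum_lessThan_telescope[of "\<lambda>k. g (k + K)"] by (rule convergent_add) (rule convergent_const)
  then show ?thesis by (simp add: convergent_ignore_initial_segment)
qed

lemma powr_increment_le:
  fixes a :: real assumes "0 < a" "a \<le> 1"
  shows "real (Suc k) powr a - real k powr a \<le> real (Suc k) powr (a - 1)"
proof -
  have "real k / real (Suc k) \<le> (real k / real (Suc k)) powr a"
  proof (cases "k = 0")
    case False
    then show ?thesis using powr_mono'[of a 1 "real k / real (Suc k)"] assms by (simp del: of_nat_Suc)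
  qed auto
  then have "real k / real (Suc k) * real (Suc k) powr a \<le> (real k / real (Suc k)) powr a * real (Suc k) powr a"
    by (intro mult_right_mono) auto
  also have "\<dots> = real k powr a" by (simp add: powr_mult[symmetric] del: of_nat_Suc)
  finally have "real (Suc k) powr a - real k powr a \<le> real (Suc k) powr a * (1 - real k / real (Suc k))"
    by (simp add: algebra_simps)
  also have "1 - real k / real (Suc k) = 1 / real (Suc k)" by (simp add: field_simps)
  finally show ?thesis by (simp add: powr_diff)
qed

lemma powr_increment_ge:
  fixes a :: real assumes "0 < a" "a \<le> 1"
  shows "a * real (Suc k) powr (a - 1) \<le> real (Suc k) powr a - real k powr a"
proof (cases "k = 0")
  case True then show ?thesis using assms by simp
next
  case False
  have "\<exists>z. real k < z \<and> z < real (Suc k) \<and> real (Suc k) powr a - real k powr a = (real (Suc k) - real k) * (a * z powr (a - 1))"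
    by (rule MVT2) (use False in \<open>auto intro!: derivative_eq_intros simp: powr_diff\<close>)
  then obtain z where z: "real k < z" "z < real (Suc k)"
     and e: "real (Suc k) powr a - real k powr a = a * z powr (a - 1)" by auto
  have "real (Suc k) powr (a - 1) \<le> z powr (a - 1)"
    by (rule powr_mono2') (use z assms in auto)
  then show ?thesis using e assms by simp
qed

lemma powr_increment_antimono:
  fixes a :: real assumes "0 < a" "a \<le> 1"
  shows "real (Suc (Suc k)) powr a - real (Suc k) powr a \<le> real (Suc k) powr a - real k powr a"
proof -
  have "\<exists>z. real (Suc k) < z \<and> z < real (Suc (Suc k)) \<and> real (Suc (Suc k)) powr a - real (Suc k) powr a = (real (Suc (Suc k)) - real (Suc k)) * (a * z powr (a - 1))"
    by (rule MVT2) (auto intro!: derivative_eq_intros simp: powr_diff)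
  then obtain z where z: "real (Suc k) < z"
     and e: "real (Suc (Suc k)) powr a - real (Suc k) powr a = a * z powr (a - 1)" by auto
  have "z powr (a - 1) \<le> real (Suc k) powr (a - 1)"
    by (rule powr_mono2') (use z assms in auto)
  then have "a * z powr (a - 1) \<le> a * real (Suc k) powr (a - 1)" using assms by simp
  then show ?thesis using e powr_increment_ge[OF assms, of k] by linarith
qed

lemma sum_powr_le:
  fixes a :: real assumes "0 < a" "a \<le> 1"
  shows "(\<Sum>j<k. real (Suc j) powr (a - 1)) \<le> real k powr a / a"
proof (induction k)
  case (Suc k)
  then show ?case using powr_increment_ge[OF assms, of k] assms(1) by (simp add: field_simps)
qed simp

text \<open>
  One step of the recurrence, with primed letters for the values before the step. The term
  \<open>V'\<^sup>2 - U\<^sup>2 / r\<^sup>2\<close> that dominates the change of the energy equals \<open>(U' V' - U V) / x\<close>, so adding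
  \<open>d / x * (U * V)\<close> to the energy cancels it; what is left is of second order.
\<close>

lemma step_identity:
  fixes r r' x U V' e :: real
  assumes "0 < r" "0 < r'" "x \<noteq> 0"
  defines "U' \<equiv> U + x * V'" and "V \<equiv> V' + x * U / r\<^sup>2" and "d \<equiv> r - r'"
  shows "(r * V\<^sup>2 + U\<^sup>2 / r) - (r' * V'\<^sup>2 + U'\<^sup>2 / r') =
     d * (V'\<^sup>2 - U\<^sup>2 / (r * r')) + (- 2 * x * d * U * V' / (r * r') + x\<^sup>2 * (U\<^sup>2 / r ^ 3 - V'\<^sup>2 / r'))"
   and "(r * V\<^sup>2 + U\<^sup>2 / r + d / x * (U * V)) - (r' * V'\<^sup>2 + U'\<^sup>2 / r' + e / x * (U' * V')) =
     - ((e - d) / x * (U' * V')) + (- d\<^sup>2 * U\<^sup>2 / (r\<^sup>2 * r')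
      + (- 2 * x * d * U * V' / (r * r') + x\<^sup>2 * (U\<^sup>2 / r ^ 3 - V'\<^sup>2 / r')))"
  unfolding U'_def V_def d_def using assms(1-3)
  by (simp_all add: field_simps power2_eq_square power3_eq_cube)

lemma mult_le_energy:
  fixes r u v :: real assumes "0 < r"
  shows "\<bar>u * v\<bar> \<le> (r * v\<^sup>2 + u\<^sup>2 / r) / 2"
proof -
  have "0 \<le> (r * \<bar>v\<bar> - \<bar>u\<bar>)\<^sup>2 / r" using assms by simp
  also have "\<dots> = r * v\<^sup>2 + u\<^sup>2 / r - 2 * \<bar>u * v\<bar>"
    using assms by (simp add: power2_eq_square field_simps abs_mult)
  finally show ?thesis by simp
qed

text \<open>
  The remainders of \<open>step_identity\<close> relative to the energy \<open>S\<close> before the step. The mixed term is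
  split by \<open>2 a b \<le> a\<^sup>2 + b\<^sup>2\<close>, so that only \<open>(d / r)\<^sup>2\<close> and \<open>(x / r')\<^sup>2\<close> remain, both of which are
  summable along the recurrence.
\<close>

lemma step_bounds:
  fixes r r' x X U V' :: real
  assumes r: "1 \<le> r'" "r' \<le> r" and x: "0 < x" "x \<le> X"
  defines "U' \<equiv> U + x * V'" and "d \<equiv> r - r'" and "C \<equiv> (1 + X)\<^sup>2"
  defines "S \<equiv> r' * V'\<^sup>2 + U'\<^sup>2 / r'"
  shows "V'\<^sup>2 \<le> S / r'" and "U\<^sup>2 \<le> C * r' * S"
    and "d\<^sup>2 * U\<^sup>2 / (r\<^sup>2 * r') \<le> C * (d / r)\<^sup>2 * S"
    and "\<bar>- 2 * x * d * U * V' / (r * r') + x\<^sup>2 * (U\<^sup>2 / r ^ 3 - V'\<^sup>2 / r')\<bar>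
      \<le> (C * (d / r)\<^sup>2 + 3 * C * (x / r')\<^sup>2) * S"
proof -
  have S0: "0 \<le> S" unfolding S_def using r by auto
  have d0: "0 \<le> d" unfolding d_def using r by simp
  have C1: "1 \<le> C" "0 \<le> C" unfolding C_def using x by (auto simp: power2_eq_square algebra_simps)
  show V: "V'\<^sup>2 \<le> S / r'" unfolding S_def using r by (simp add: field_simps)
  have U': "U'\<^sup>2 \<le> r' * S" unfolding S_def using r by (simp add: field_simps)
  have aV: "\<bar>V'\<bar> \<le> sqrt S / sqrt r'" using V r by (metis real_sqrt_abs real_sqrt_divide real_sqrt_le_iff)
  have aU': "\<bar>U'\<bar> \<le> sqrt r' * sqrt S" using U' by (metis real_sqrt_abs real_sqrt_mult real_sqrt_le_iff)
  have sr: "sqrt S / sqrt r' \<le> sqrt r' * sqrt S"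
  proof -
    have "sqrt S * 1 \<le> sqrt S * r'" using r S0 by (intro mult_left_mono) auto
    then show ?thesis using r by (simp add: field_simps)
  qed
  have "\<bar>U\<bar> \<le> \<bar>U'\<bar> + x * \<bar>V'\<bar>" unfolding U'_def using abs_triangle_ineq4[of "U + x * V'" "x * V'"] x by (simp add: abs_mult)
  also have "\<dots> \<le> sqrt r' * sqrt S + X * (sqrt r' * sqrt S)"
    by (intro add_mono mult_mono aU' order_trans[OF aV sr]) (use x in auto)
  finally have aU: "\<bar>U\<bar> \<le> (1 + X) * (sqrt r' * sqrt S)" by (simp add: algebra_simps)
  have "U\<^sup>2 \<le> ((1 + X) * (sqrt r' * sqrt S))\<^sup>2" using aU by (metis abs_ge_zero power2_abs power_mono)
  also have "\<dots> = C * r' * S" unfolding C_def using r S0 by (simp add: power_mult_distrib)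
  finally show U: "U\<^sup>2 \<le> C * r' * S" .
  have "d\<^sup>2 * U\<^sup>2 / (r\<^sup>2 * r') = (d / r)\<^sup>2 / r' * U\<^sup>2" using r by (simp add: field_simps)
  also have "\<dots> \<le> (d / r)\<^sup>2 / r' * (C * r' * S)" using r by (intro mult_left_mono U) auto
  also have "\<dots> = C * (d / r)\<^sup>2 * S" using r by simp
  finally show "d\<^sup>2 * U\<^sup>2 / (r\<^sup>2 * r') \<le> C * (d / r)\<^sup>2 * S" .
  have UV: "\<bar>U * V'\<bar> \<le> C * S"
  proof -
    have "\<bar>U * V'\<bar> \<le> ((1 + X) * (sqrt r' * sqrt S)) * (sqrt S / sqrt r')"
      unfolding abs_mult by (intro mult_mono aU aV) (use x r S0 in auto)
    also have "\<dots> = (1 + X) * S" using r S0 by simp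
    also have "\<dots> \<le> C * S" unfolding C_def using x S0
      by (intro mult_right_mono) (auto simp: power2_eq_square algebra_simps)
    finally show ?thesis .
  qed
  have am: "2 * (x * d / (r * r')) \<le> (d / r)\<^sup>2 + (x / r')\<^sup>2"
    using sum_squares_bound[of "d / r" "x / r'"] by (simp add: field_simps)
  have "\<bar>- 2 * x * d * U * V' / (r * r')\<bar> = 2 * (x * d / (r * r')) * \<bar>U * V'\<bar>"
    using x d0 r by (simp add: abs_mult abs_divide field_simps)
  also have "\<dots> \<le> ((d / r)\<^sup>2 + (x / r')\<^sup>2) * (C * S)"
    by (intro mult_mono am UV) (use x d0 r in auto)
  finally have t1: "\<bar>- 2 * x * d * U * V' / (r * r')\<bar> \<le> ((d / r)\<^sup>2 + (x / r')\<^sup>2) * (C * S)" .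
  have "U\<^sup>2 / r ^ 3 \<le> (C * r' * S) / r' ^ 3"
    by (intro frac_le U power_mono) (use r C1 S0 in auto)
  also have "\<dots> = C * S / r'\<^sup>2" using r by (simp add: power2_eq_square power3_eq_cube)
  finally have a: "U\<^sup>2 / r ^ 3 \<le> C * S / r'\<^sup>2" .
  have "V'\<^sup>2 / r' \<le> S / r' / r'" using V r by (intro divide_right_mono) auto
  also have "\<dots> \<le> C * S / r'\<^sup>2"
  proof -
    have "S \<le> C * S" using mult_right_mono[OF C1(1) S0] by simp
    then show ?thesis using r by (simp add: power2_eq_square divide_right_mono)
  qed
  finally have b: "V'\<^sup>2 / r' \<le> C * S / r'\<^sup>2" .
  have ab: "0 \<le> U\<^sup>2 / r ^ 3" "0 \<le> V'\<^sup>2 / r'" using r by auto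
  have "\<bar>U\<^sup>2 / r ^ 3 - V'\<^sup>2 / r'\<bar> \<le> 2 * (C * S / r'\<^sup>2)" using a b ab by linarith
  then have "x\<^sup>2 * \<bar>U\<^sup>2 / r ^ 3 - V'\<^sup>2 / r'\<bar> \<le> x\<^sup>2 * (2 * (C * S / r'\<^sup>2))" by (intro mult_left_mono) auto
  then have t2: "\<bar>x\<^sup>2 * (U\<^sup>2 / r ^ 3 - V'\<^sup>2 / r')\<bar> \<le> 2 * C * (x / r')\<^sup>2 * S"
    by (simp add: abs_mult power_divide mult_ac)
  show "\<bar>- 2 * x * d * U * V' / (r * r') + x\<^sup>2 * (U\<^sup>2 / r ^ 3 - V'\<^sup>2 / r')\<bar>
      \<le> (C * (d / r)\<^sup>2 + 3 * C * (x / r')\<^sup>2) * S"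
    using abs_triangle_ineq[of "- 2 * x * d * U * V' / (r * r')" "x\<^sup>2 * (U\<^sup>2 / r ^ 3 - V'\<^sup>2 / r')"] t1 t2
    by (simp add: algebra_simps)
qed

section \<open>The energy of a discrete string\<close>

text \<open>
  A discretization of the string equation \<open>u' = - x v\<close>, \<open>v' = x t\<^sup>-\<^sup>2\<^sup>\<alpha> u\<close>, for all values of the
  spectral parameter at once.
\<close>

locale weighted_string =
  fixes \<alpha> \<beta> :: real and u v :: "real \<Rightarrow> nat \<Rightarrow> real"
  assumes alpha: "1 / 2 < \<alpha>" "\<alpha> < 1" and beta: "0 < \<beta>"
    and u0: "u x 0 = \<beta>" and v0: "v x 0 = x / \<beta>"
    and uS: "u x (Suc k) = u x k - x * v x k"
    and vS: "v x (Suc k) = v x k + x * u x (Suc k) / real (Suc k) powr (2 * \<alpha>)"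
begin

definition r :: "nat \<Rightarrow> real" where "r k = real k powr \<alpha>"

definition d :: "nat \<Rightarrow> real" where "d k = r (Suc k) - r k"

text \<open>
  The squared amplitude of a WKB solution. Since \<open>r 0 = 0\<close>, it is meaningful from \<open>k = 1\<close> on.
\<close>

definition energy :: "real \<Rightarrow> nat \<Rightarrow> real" where
  "energy x k = r k * (v x k)\<^sup>2 + (u x k)\<^sup>2 / r k"

text \<open>
  The correction of \<open>step_identity\<close>; it is small relative to the energy once \<open>d (k - 1)\<close> is small
  against \<open>x\<close>, that is for \<open>k\<close> large against \<open>x powr (- 1 / (1 - \<alpha>))\<close>.
\<close>

definition corrected_energy :: "real \<Rightarrow> nat \<Rightarrow> real" where
  "corrected_energy x k = energy x k + d (k - 1) / x * (u x k * v x k)"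

lemma r_ge_1: "1 \<le> k \<Longrightarrow> 1 \<le> r k"
  unfolding r_def using alpha by (intro ge_one_powr_ge_zero) auto

lemma r_pos: "1 \<le> k \<Longrightarrow> 0 < r k"
  using r_ge_1[of k] by simp

lemma r_mono: "r k \<le> r (Suc k)"
  unfolding r_def using alpha by (intro powr_mono2) auto

lemma r_square: "(r k)\<^sup>2 = real k powr (2 * \<alpha>)"
  unfolding r_def by (simp add: power2_eq_square flip: powr_add)

lemma d_nonneg: "0 \<le> d k"
  unfolding d_def using r_mono[of k] by simp

lemma d_le: "d k \<le> real (Suc k) powr (\<alpha> - 1)"
  unfolding d_def r_def using alpha by (intro powr_increment_le) auto

lemma d_antimono: "d (Suc k) \<le> d k"
  unfolding d_def r_def using alpha by (intro powr_increment_antimono) auto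

lemma d_over_r: "d k / r (Suc k) \<le> 1 / real (Suc k)"
proof -
  have "d k / r (Suc k) \<le> real (Suc k) powr (\<alpha> - 1) / r (Suc k)"
    by (intro divide_right_mono d_le) (use r_pos[of "Suc k"] in auto)
  also have "\<dots> = 1 / real (Suc k)"
    unfolding r_def by (simp add: powr_diff)
  finally show ?thesis .
qed

lemma r_Suc_le: assumes "1 \<le> k" shows "r (Suc k) \<le> 2 * r k"
proof -
  have "r (Suc k) \<le> (2 * real k) powr \<alpha>" unfolding r_def using alpha assms by (intro powr_mono2) auto
  also have "\<dots> = 2 powr \<alpha> * r k" unfolding r_def by (simp add: powr_mult)
  also have "\<dots> \<le> 2 powr 1 * r k" using alpha r_pos[OF assms] by (intro mult_right_mono powr_mono) auto
  finally show ?thesis by simp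
qed

lemma d_over_r': assumes "1 \<le> k" shows "d k / r k \<le> 2 / real k"
proof -
  have "d k / r k = d k / r (Suc k) * (r (Suc k) / r k)" using r_pos[of "Suc k"] by simp
  also have "\<dots> \<le> 1 / real (Suc k) * 2"
    by (intro mult_mono d_over_r) (use r_Suc_le[OF assms] r_pos[OF assms] r_pos[of "Suc k"] in \<open>auto simp: field_simps\<close>)
  also have "\<dots> \<le> 2 / real k" using assms by (simp add: field_simps)
  finally show ?thesis .
qed

lemma d_tendsto_0: "d \<longlonglongrightarrow> 0"
proof (rule tendsto_sandwich[of "\<lambda>_. 0"])
  show "(\<lambda>k. real (Suc k) powr (\<alpha> - 1)) \<longlonglongrightarrow> 0"
    using alpha by real_asymp
qed (use d_le d_nonneg in auto)

lemma summable_inv_r: "summable (\<lambda>k. (1 / r k)\<^sup>2)"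
proof -
  have "summable (\<lambda>k. real k powr (- 2 * \<alpha>))" by (subst summable_real_powr_iff) (use alpha in auto)
  then show ?thesis by (simp add: power_divide r_square powr_minus_divide)
qed

lemma summable_inv_sq: "summable (\<lambda>k. (1 / real k)\<^sup>2)"
  using inverse_power_summable[of 2, where 'a=real] by (simp add: power_divide inverse_eq_divide)

lemma energy_nonneg: "0 \<le> energy x k"
  unfolding energy_def r_def by auto

lemma energy_pos: assumes "1 \<le> k" shows "0 < energy x k"
proof -
  have nz: "u x k \<noteq> 0 \<or> v x k \<noteq> 0" for k
  proof (induction k)
    case 0 then show ?case using beta u0 by simp
  next
    case (Suc k) then show ?case using uS[of x k] vS[of x k] by (cases "u x (Suc k) = 0") auto
  qed
  show ?thesis unfolding energy_def using nz[of k] r_pos[OF assms]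
    by (auto intro: add_pos_nonneg add_nonneg_pos)
qed

lemma uv_le_energy: "1 \<le> k \<Longrightarrow> \<bar>u x k * v x k\<bar> \<le> energy x k / 2"
  unfolding energy_def by (rule mult_le_energy[OF r_pos])

lemma v_le_energy: "1 \<le> k \<Longrightarrow> (v x k)\<^sup>2 \<le> energy x k / r k"
  unfolding energy_def using r_pos[of k] by (simp add: field_simps)

lemma u_step: "u x k = u x (Suc k) + x * v x k"
  using uS by simp

lemma v_step: "v x (Suc k) = v x k + x * u x (Suc k) / (r (Suc k))\<^sup>2"
  using vS by (simp add: r_square)

text \<open>
  A crude bound of order \<open>1 / k\<close>. It is not summable, but over a range of indices whose endpoints
  have bounded ratio it changes the energy only by a bounded factor.
\<close>

lemma energy_step:
  assumes k: "1 \<le> k" and x: "0 < x" "x \<le> X"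
  shows "\<bar>energy x (Suc k) - energy x k\<bar> \<le> 7 * (1 + X) ^ 4 / real k * energy x k"
proof -
  define C where "C = (1 + X)\<^sup>2"
  have C1: "1 \<le> C" unfolding C_def using x by (auto simp: power2_eq_square algebra_simps)
  have C2: "C \<le> C\<^sup>2" using C1 by (simp add: power2_eq_square)
  let ?r = "r (Suc k)" and ?r' = "r k" and ?S = "energy x k"
  let ?U = "u x (Suc k)" and ?V = "v x k" and ?d = "d k"
  have r: "1 \<le> ?r'" "?r' \<le> ?r" using r_ge_1[OF k] r_mono by auto
  have S: "?r' * ?V\<^sup>2 + (?U + x * ?V)\<^sup>2 / ?r' = ?S" unfolding energy_def u_step[of x k] ..
  note b = step_bounds[OF r x, where V' = ?V and U = ?U, folded d_def, unfolded S, folded C_def]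
  define R where "R = - 2 * x * ?d * ?U * ?V / (?r * ?r') + x\<^sup>2 * (?U\<^sup>2 / ?r ^ 3 - ?V\<^sup>2 / ?r')"
  have id: "energy x (Suc k) - ?S = ?d * (?V\<^sup>2 - ?U\<^sup>2 / (?r * ?r')) + R"
    unfolding energy_def R_def v_step[of x k] d_def u_step[of x k]
    by (rule step_identity(1)) (use r x in auto)
  have S0: "0 \<le> ?S" by (rule energy_nonneg)
  have dd: "?d / ?r \<le> 1 / k" "0 \<le> ?d / ?r"
    using d_over_r[of k] k d_nonneg[of k] r by (auto intro: order_trans simp: field_simps)
  have k1: "(1 / real k)\<^sup>2 \<le> 1 / real k" using k by (simp add: power2_eq_square field_simps)
  have "(x / ?r')\<^sup>2 \<le> X\<^sup>2 / real k"
  proof -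
    have "real k powr 1 \<le> real k powr (2 * \<alpha>)" using k alpha by (intro powr_mono) auto
    then have "real k \<le> (?r')\<^sup>2" using k by (simp add: r_square)
    then show ?thesis unfolding power_divide using k x by (intro frac_le power_mono) auto
  qed
  also have "\<dots> \<le> C / real k" unfolding C_def using x by (intro divide_right_mono power_mono) auto
  finally have xr: "(x / ?r')\<^sup>2 \<le> C / real k" .
  have dr2: "(?d / ?r)\<^sup>2 \<le> 1 / real k" using power_mono[OF dd, of 2] k1 by linarith
  have R: "\<bar>R\<bar> \<le> (C * (1 / k) + 3 * C * (C / k)) * ?S"
    using b(4) unfolding R_def
    by (rule order_trans) (intro mult_right_mono add_mono mult_left_mono dr2 xr, use C1 S0 in auto)
  have "?d * ?V\<^sup>2 \<le> ?d * (?S / ?r')" by (intro mult_left_mono b d_nonneg)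
  also have "\<dots> = (?d / ?r') * ?S" by simp
  also have "\<dots> \<le> (2 / k) * ?S" by (intro mult_right_mono d_over_r' k S0)
  finally have t1: "?d * ?V\<^sup>2 \<le> (2 / k) * ?S" .
  have "?d * (?U\<^sup>2 / (?r * ?r')) \<le> ?d * ((C * ?r' * ?S) / (?r * ?r'))"
    by (intro mult_left_mono divide_right_mono b d_nonneg) (use r in auto)
  also have "\<dots> = (?d / ?r) * (C * ?S)" using r by simp
  also have "\<dots> \<le> (1 / k) * (C * ?S)" by (intro mult_right_mono dd) (use C1 S0 in auto)
  finally have t2: "?d * (?U\<^sup>2 / (?r * ?r')) \<le> (C / k) * ?S" by simp
  have nn: "0 \<le> ?d * ?V\<^sup>2" "0 \<le> ?d * (?U\<^sup>2 / (?r * ?r'))" using d_nonneg[of k] r by auto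
  have "\<bar>energy x (Suc k) - ?S\<bar> \<le> (2 / k) * ?S + (C / k) * ?S + (C * (1 / k) + 3 * C * (C / k)) * ?S"
    unfolding id right_diff_distrib using t1 t2 R nn by linarith
  also have "\<dots> = ((2 + 2 * C + 3 * C\<^sup>2) / k) * ?S"
    by (simp add: add_divide_distrib power2_eq_square algebra_simps)
  also have "\<dots> \<le> ((7 * C\<^sup>2) / k) * ?S"
    by (intro mult_right_mono divide_right_mono S0) (use C1 C2 in linarith)+
  finally show ?thesis unfolding C_def by (simp flip: power_mult)
qed

lemma corrected_energy_step:
  assumes k: "1 \<le> k" and x: "0 < x" "x \<le> X"
  shows "\<bar>corrected_energy x (Suc k) - corrected_energy x k + (d (k - 1) - d k) / x * (u x k * v x k)\<bar>
    \<le> 3 * (1 + X)\<^sup>2 * ((1 / real k)\<^sup>2 + (x / r k)\<^sup>2) * energy x k"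
proof -
  define C where "C = (1 + X)\<^sup>2"
  have C1: "1 \<le> C" unfolding C_def using x by (auto simp: power2_eq_square algebra_simps)
  let ?r = "r (Suc k)" and ?r' = "r k" and ?S = "energy x k"
  let ?U = "u x (Suc k)" and ?V = "v x k" and ?d = "d k"
  have r: "1 \<le> ?r'" "?r' \<le> ?r" using r_ge_1[OF k] r_mono by auto
  have S: "?r' * ?V\<^sup>2 + (?U + x * ?V)\<^sup>2 / ?r' = ?S" unfolding energy_def u_step[of x k] ..
  note b = step_bounds[OF r x, where V' = ?V and U = ?U, folded d_def, unfolded S, folded C_def]
  define R where "R = - 2 * x * ?d * ?U * ?V / (?r * ?r') + x\<^sup>2 * (?U\<^sup>2 / ?r ^ 3 - ?V\<^sup>2 / ?r')"
  have "corrected_energy x (Suc k) - corrected_energy x k = - ((d (k - 1) - d k) / x * (u x k * v x k)) + (- ?d\<^sup>2 * ?U\<^sup>2 / (?r\<^sup>2 * ?r') + R)"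
    unfolding corrected_energy_def energy_def R_def v_step[of x k] diff_Suc_1 u_step[of x k]
    unfolding d_def[of k]
    by (rule step_identity(2)) (use r x in auto)
  then have id: "corrected_energy x (Suc k) - corrected_energy x k + (d (k - 1) - d k) / x * (u x k * v x k) = - (?d\<^sup>2 * ?U\<^sup>2 / (?r\<^sup>2 * ?r')) + R"
    by simp
  have S0: "0 \<le> ?S" by (rule energy_nonneg)
  have dd: "?d / ?r \<le> 1 / k" "0 \<le> ?d / ?r"
    using d_over_r[of k] k d_nonneg[of k] r by (auto intro: order_trans simp: field_simps)
  have nn: "0 \<le> ?d\<^sup>2 * ?U\<^sup>2 / (?r\<^sup>2 * ?r')" using r by auto
  have "\<bar>- (?d\<^sup>2 * ?U\<^sup>2 / (?r\<^sup>2 * ?r')) + R\<bar> \<le> C * (?d / ?r)\<^sup>2 * ?S + (C * (?d / ?r)\<^sup>2 + 3 * C * (x / ?r')\<^sup>2) * ?S"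
    using b(3,4) nn unfolding R_def[symmetric] by linarith
  also have "\<dots> = (2 * C * (?d / ?r)\<^sup>2 + 3 * C * (x / ?r')\<^sup>2) * ?S" by (simp add: algebra_simps)
  also have "\<dots> \<le> (3 * C * (1 / real k)\<^sup>2 + 3 * C * (x / ?r')\<^sup>2) * ?S"
    by (intro mult_right_mono add_mono mult_mono power_mono dd S0) (use C1 dd in auto)
  finally show ?thesis unfolding id C_def by (simp add: algebra_simps)
qed

definition rel_err :: "real \<Rightarrow> real \<Rightarrow> nat \<Rightarrow> real" where
  "rel_err X x k = (d (k - 1) - d k) / x + 6 * (1 + X)\<^sup>2 * ((1 / real k)\<^sup>2 + (x / r k)\<^sup>2)"

lemma d_diff_nonneg: "0 \<le> d (k - 1) - d k"
  using d_antimono[of "k - 1"] by (cases k) auto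

lemma rel_err_nonneg: "0 < x \<Longrightarrow> 0 \<le> rel_err X x k"
  unfolding rel_err_def using d_diff_nonneg[of k] by auto

lemma d_antimono': "m \<le> n \<Longrightarrow> d n \<le> d m"
  using lift_Suc_antimono_le[of d, OF d_antimono] by simp

lemma corrected_energy_close:
  assumes k: "1 \<le> k" and x: "0 < x" and d: "d (k - 1) \<le> x"
  shows "\<bar>corrected_energy x k - energy x k\<bar> \<le> d (k - 1) / x * energy x k / 2"
    and "energy x k \<le> 2 * corrected_energy x k" "corrected_energy x k \<le> 3 / 2 * energy x k"
proof -
  have "\<bar>d (k - 1) / x * (u x k * v x k)\<bar> = d (k - 1) / x * \<bar>u x k * v x k\<bar>"
    using x d_nonneg[of "k - 1"] by (simp add: abs_mult)
  also have "\<dots> \<le> d (k - 1) / x * (energy x k / 2)"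
    by (intro mult_left_mono uv_le_energy k) (use x d_nonneg[of "k - 1"] in auto)
  finally have *: "\<bar>corrected_energy x k - energy x k\<bar> \<le> d (k - 1) / x * (energy x k / 2)"
    unfolding corrected_energy_def by simp
  then show "\<bar>corrected_energy x k - energy x k\<bar> \<le> d (k - 1) / x * energy x k / 2" by simp
  have "d (k - 1) / x * (energy x k / 2) \<le> 1 * (energy x k / 2)"
    by (intro mult_right_mono) (use x d energy_nonneg in auto)
  with * show "energy x k \<le> 2 * corrected_energy x k" "corrected_energy x k \<le> 3 / 2 * energy x k" by linarith+
qed

text \<open>
  The term containing \<open>d (k - 1) - d k\<close> telescopes when summed, and the remaining two are summable
  because \<open>2 \<alpha> > 1\<close>.
\<close>

lemma corrected_energy_rel:
  assumes k: "1 \<le> k" and x: "0 < x" "x \<le> X" and d: "d (k - 1) \<le> x"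
  shows "\<bar>corrected_energy x (Suc k) - corrected_energy x k\<bar> \<le> rel_err X x k * corrected_energy x k"
proof -
  let ?D = "(d (k - 1) - d k) / x"
  have D0: "0 \<le> ?D" using x d_diff_nonneg[of k] by auto
  have "\<bar>?D * (u x k * v x k)\<bar> = ?D * \<bar>u x k * v x k\<bar>" by (simp only: abs_mult abs_of_nonneg[OF D0])
  also have "\<dots> \<le> ?D * (energy x k / 2)" by (intro mult_left_mono uv_le_energy k D0)
  finally have "\<bar>corrected_energy x (Suc k) - corrected_energy x k\<bar> \<le> ?D * (energy x k / 2) + 3 * (1 + X)\<^sup>2 * ((1 / real k)\<^sup>2 + (x / r k)\<^sup>2) * energy x k"
    using corrected_energy_step[OF k x] by linarith
  also have "\<dots> = rel_err X x k / 2 * energy x k" unfolding rel_err_def by (simp add: algebra_simps add_divide_distrib)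
  also have "\<dots> \<le> rel_err X x k / 2 * (2 * corrected_energy x k)"
    by (intro mult_left_mono corrected_energy_close k x d) (use rel_err_nonneg x in auto)
  finally show ?thesis by simp
qed

definition total_err :: "real \<Rightarrow> real" where
  "total_err X = 1 + 6 * (1 + X)\<^sup>2 * ((\<Sum>k. (1 / real k)\<^sup>2) + X\<^sup>2 * (\<Sum>k. (1 / r k)\<^sup>2))"

lemma sum_rel_err_le:
  assumes x: "0 < x" "x \<le> X" and K: "1 \<le> K" "K \<le> n" and d: "d (K - 1) \<le> x"
  shows "sum (rel_err X x) {K..<n} \<le> total_err X"
proof -
  have tel: "(\<Sum>k\<in>{K..<n}. d (k - 1) - d k) = d (K - 1) - d (n - 1)"
    using K(2) K(1) by (induction n rule: dec_induct) auto
  have a: "(\<Sum>k\<in>{K..<n}. (1 / real k)\<^sup>2) \<le> (\<Sum>k. (1 / real k)\<^sup>2)"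
    by (rule sum_le_suminf[OF summable_inv_sq]) auto
  have b: "(\<Sum>k\<in>{K..<n}. (1 / r k)\<^sup>2) \<le> (\<Sum>k. (1 / r k)\<^sup>2)"
    by (rule sum_le_suminf[OF summable_inv_r]) auto
  have "sum (rel_err X x) {K..<n} = (\<Sum>k\<in>{K..<n}. d (k - 1) - d k) / x +
     6 * (1 + X)\<^sup>2 * ((\<Sum>k\<in>{K..<n}. (1 / real k)\<^sup>2) + x\<^sup>2 * (\<Sum>k\<in>{K..<n}. (1 / r k)\<^sup>2))"
    unfolding rel_err_def
    by (simp add: sum.distrib sum_distrib_left sum_divide_distrib power_divide distrib_left)
  also have "\<dots> \<le> 1 + 6 * (1 + X)\<^sup>2 * ((\<Sum>k. (1 / real k)\<^sup>2) + X\<^sup>2 * (\<Sum>k. (1 / r k)\<^sup>2))"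
    by (intro add_mono mult_left_mono mult_mono power_mono a b)
      (use x d d_nonneg[of "n - 1"] tel in \<open>auto intro!: sum_nonneg\<close>)
  finally show ?thesis unfolding total_err_def .
qed

text \<open>
  Two-sided Gronwall bounds for the corrected energy. The hypotheses on \<open>K\<close> make the correction
  small against the energy and each relative increment at most \<open>1 / 2\<close>; the factor \<open>3\<close> pays for
  passing between the energy and the corrected energy twice.
\<close>

lemma energy_control:
  assumes x: "0 < x" "x \<le> X" and K: "1 \<le> K" and d: "d (K - 1) \<le> x / 4"
    and small: "6 * (1 + X)\<^sup>2 * ((1 / real K)\<^sup>2 + (X / r K)\<^sup>2) \<le> 1 / 4"
  shows "K \<le> n \<Longrightarrow> energy x K \<le> 3 * exp (2 * total_err X) * energy x n"
    and "K \<le> n \<Longrightarrow> energy x n \<le> 3 * exp (2 * total_err X) * energy x K"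
    and "convergent (energy x)"
proof -
  have dk: "d (k - 1) \<le> x" if "K \<le> k" for k
    using d_antimono'[of "K - 1" "k - 1"] that d x by (simp add: diff_le_mono)
  have e: "0 \<le> rel_err X x k \<and> rel_err X x k \<le> 1 / 2" if "K \<le> k" for k
  proof -
    have "(d (k - 1) - d k) / x \<le> 1 / 4"
      using d_antimono'[of "K - 1" "k - 1"] that d x d_nonneg[of k] by (simp add: field_simps diff_le_mono)
    moreover have "r K \<le> r k" unfolding r_def using that alpha by (intro powr_mono2) auto
    then have "6 * (1 + X)\<^sup>2 * ((1 / real k)\<^sup>2 + (x / r k)\<^sup>2) \<le> 6 * (1 + X)\<^sup>2 * ((1 / real K)\<^sup>2 + (X / r K)\<^sup>2)"
      by (intro mult_left_mono add_mono power_mono frac_le) (use that K x r_pos[OF K] in auto)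
    ultimately show ?thesis using small rel_err_nonneg[OF x(1), of X k] unfolding rel_err_def by linarith
  qed
  have rel: "\<bar>corrected_energy x (Suc k) - corrected_energy x k\<bar> \<le> rel_err X x k * corrected_energy x k" if "K \<le> k" for k
    by (rule corrected_energy_rel) (use that K x dk in auto)
  have E0: "0 \<le> corrected_energy x K" using corrected_energy_close(2)[OF K x(1) dk] energy_nonneg[of x K] by simp
  define Z where "Z = total_err X"
  have Z0: "0 \<le> Z" unfolding Z_def total_err_def using x
    by (auto intro!: add_nonneg_nonneg mult_nonneg_nonneg suminf_nonneg summable_inv_sq summable_inv_r)
  have both: "energy x K \<le> 3 * exp (2 * Z) * energy x n \<and> energy x n \<le> 3 * exp (2 * Z) * energy x K"
    if n: "K \<le> n" for n
  proof -
    let ?s = "sum (rel_err X x) {K..<n}"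
    have s: "?s \<le> Z" unfolding Z_def by (rule sum_rel_err_le) (use x K n dk in auto)
    have g: "exp (- 2 * ?s) * corrected_energy x K \<le> corrected_energy x n \<and> corrected_energy x n \<le> exp ?s * corrected_energy x K"
      by (rule gronwall_two_sided) (use rel e E0 n in auto)
    have K3: "energy x K \<le> 2 * corrected_energy x K" "corrected_energy x K \<le> 3 / 2 * energy x K"
      using corrected_energy_close[OF K x(1) dk] by auto
    have n3: "energy x n \<le> 2 * corrected_energy x n" "corrected_energy x n \<le> 3 / 2 * energy x n"
      using corrected_energy_close[OF _ x(1) dk, of n] n K by auto
    have "corrected_energy x K \<le> exp (2 * ?s) * corrected_energy x n"
      using g by (simp add: exp_minus field_simps)
    also have "\<dots> \<le> exp (2 * Z) * corrected_energy x n"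
      by (intro mult_right_mono) (use s n3 energy_nonneg[of x n] in auto)
    finally have "energy x K \<le> 2 * (exp (2 * Z) * (3 / 2 * energy x n))"
      using K3(1) mult_left_mono[OF n3(2) exp_ge_zero[of "2 * Z"]] by linarith
    moreover have "exp ?s * corrected_energy x K \<le> exp (2 * Z) * corrected_energy x K"
      by (intro mult_right_mono) (use s Z0 E0 in auto)
    then have "energy x n \<le> 2 * (exp (2 * Z) * (3 / 2 * energy x K))"
      using g n3(1) mult_left_mono[OF K3(2) exp_ge_zero[of "2 * Z"]] by linarith
    ultimately show ?thesis by (simp add: mult_ac)
  qed
  show "K \<le> n \<Longrightarrow> energy x K \<le> 3 * exp (2 * total_err X) * energy x n"
    and "K \<le> n \<Longrightarrow> energy x n \<le> 3 * exp (2 * total_err X) * energy x K"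
    using both unfolding Z_def by auto
  have sd: "summable (\<lambda>k. d (k - 1) - d k)"
  proof -
    have "summable (\<lambda>k. d (Suc k) - d k)" using telescope_summable[OF d_tendsto_0] .
    then have "summable (\<lambda>k. - (d (Suc k) - d k))" by (rule summable_minus)
    then have "summable (\<lambda>k. d (Suc k - 1) - d (Suc k))" by simp
    then show ?thesis by (subst (asm) summable_Suc_iff)
  qed
  have "summable (rel_err X x)"
    unfolding rel_err_def
    using summable_mult[OF summable_inv_r, of "x\<^sup>2"]
    by (intro summable_add summable_mult summable_divide sd summable_inv_sq) (simp add: power_divide)
  then have "convergent (corrected_energy x)"
    by (rule convergent_if_summable_relative_increments[OF rel e E0, rotated 2])
  moreover have "(\<lambda>k. corrected_energy x k - energy x k) \<longlonglongrightarrow> 0"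
  proof (rule Lim_null_comparison)
    show "\<forall>\<^sub>F k in sequentially. norm (corrected_energy x k - energy x k) \<le> d (k - 1) * (3 * exp (2 * Z) * energy x K / (2 * x))"
      using eventually_ge_at_top[of K]
    proof eventually_elim
      case (elim k)
      have "\<bar>corrected_energy x k - energy x k\<bar> \<le> d (k - 1) / x * energy x k / 2"
        by (rule corrected_energy_close) (use elim K x dk in auto)
      also have "\<dots> \<le> d (k - 1) / x * (3 * exp (2 * Z) * energy x K) / 2"
        by (intro divide_right_mono mult_left_mono) (use both[OF elim] d_nonneg x in auto)
      finally show ?case by simp
    qed
    have "(\<lambda>k. d (Suc k - 1)) \<longlonglongrightarrow> 0" using d_tendsto_0 by simp
    then have "(\<lambda>k. d (k - 1)) \<longlonglongrightarrow> 0" by (rule LIMSEQ_imp_Suc)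
    then show "(\<lambda>k. d (k - 1) * (3 * exp (2 * Z) * energy x K / (2 * x))) \<longlonglongrightarrow> 0"
      using tendsto_mult_left_zero by blast
  qed
  ultimately show "convergent (energy x)"
    using tendsto_diff[of "corrected_energy x" _ sequentially "\<lambda>k. corrected_energy x k - energy x k" 0]
    by (auto simp: convergent_def)
qed

lemma eventually_step_errors_small:
  "\<forall>\<^sub>F K in sequentially. 6 * (1 + X)\<^sup>2 * ((1 / real K)\<^sup>2 + (X / r K)\<^sup>2) \<le> 1 / 4"
proof -
  have "filterlim r at_top sequentially"
    unfolding r_def using alpha by real_asymp
  then have "(\<lambda>K. 6 * (1 + X)\<^sup>2 * ((1 / real K)\<^sup>2 + (X / r K)\<^sup>2)) \<longlonglongrightarrow> 6 * (1 + X)\<^sup>2 * (0\<^sup>2 + 0\<^sup>2)"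
    by (intro tendsto_intros real_tendsto_divide_at_top[OF tendsto_const] filterlim_real_sequentially)
  then have "\<forall>\<^sub>F K in sequentially. 6 * (1 + X)\<^sup>2 * ((1 / real K)\<^sup>2 + (X / r K)\<^sup>2) < 1 / 4"
    by (rule order_tendstoD) simp
  then show ?thesis by eventually_elim simp
qed

definition limit_energy :: "real \<Rightarrow> real" where "limit_energy x = lim (energy x)"

lemma energy_eventually_controlled:
  assumes "0 < p" "p \<le> X"
  obtains K where "1 \<le> K" "\<And>x n. p \<le> x \<Longrightarrow> x \<le> X \<Longrightarrow> K \<le> n \<Longrightarrow> energy x K \<le> 3 * exp (2 * total_err X) * energy x n"
    "\<And>x. p \<le> x \<Longrightarrow> x \<le> X \<Longrightarrow> convergent (energy x)"
proof -
  have "(\<lambda>k. d (Suc k - 1)) \<longlonglongrightarrow> 0" using d_tendsto_0 by simp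
  then have "(\<lambda>k. d (k - 1)) \<longlonglongrightarrow> 0" by (rule LIMSEQ_imp_Suc)
  then have "\<forall>\<^sub>F k in sequentially. d (k - 1) < p / 4" by (rule order_tendstoD) (use assms in simp)
  then have "\<forall>\<^sub>F k in sequentially. 1 \<le> k \<and> d (k - 1) < p / 4 \<and> 6 * (1 + X)\<^sup>2 * ((1 / real k)\<^sup>2 + (X / r k)\<^sup>2) \<le> 1 / 4"
    using eventually_step_errors_small[of X] eventually_ge_at_top[of 1] by eventually_elim simp
  then obtain K where K: "1 \<le> K" "d (K - 1) < p / 4" "6 * (1 + X)\<^sup>2 * ((1 / real K)\<^sup>2 + (X / r K)\<^sup>2) \<le> 1 / 4"
    by (auto simp: eventually_at_top_linorder)
  show ?thesis
  proof (rule that[OF K(1)])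
    fix x n assume "p \<le> x" "x \<le> X"
    then show "convergent (energy x)" and "K \<le> n \<Longrightarrow> energy x K \<le> 3 * exp (2 * total_err X) * energy x n"
      using assms energy_control[of x X K] K by auto
  qed
qed

lemma energy_tendsto_limit: assumes "0 < x" shows "energy x \<longlonglongrightarrow> limit_energy x"
proof -
  obtain K where "\<And>y. x \<le> y \<Longrightarrow> y \<le> x \<Longrightarrow> convergent (energy y)"
    using energy_eventually_controlled[OF assms order_refl] by metis
  then show ?thesis unfolding limit_energy_def by (simp add: convergent_LIMSEQ_iff)
qed

lemma limit_energy_pos: assumes "0 < x" shows "0 < limit_energy x"
proof -
  obtain K where K: "1 \<le> K" "\<And>n. K \<le> n \<Longrightarrow> energy x K \<le> 3 * exp (2 * total_err x) * energy x n"
    using energy_eventually_controlled[OF assms order_refl] by (metis order_refl)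
  have "energy x K \<le> 3 * exp (2 * total_err x) * limit_energy x"
    by (rule LIMSEQ_le_const[OF tendsto_mult_left[OF energy_tendsto_limit[OF assms]]]) (use K in auto)
  then have "0 < 3 * exp (2 * total_err x) * limit_energy x" using energy_pos[OF K(1), of x] by linarith
  then show ?thesis by (simp add: zero_less_mult_iff)
qed

lemma continuous_uv: "continuous_on A (\<lambda>x. u x k) \<and> continuous_on A (\<lambda>x. v x k)"
proof (induction k)
  case 0 then show ?case using beta by (auto simp: u0 v0 intro!: continuous_intros)
next
  case (Suc k)
  then have "continuous_on A (\<lambda>x. u x (Suc k))" by (auto simp: uS intro!: continuous_intros)
  with Suc show ?case unfolding vS by (auto intro!: continuous_intros)
qed

lemma energy_bounded_below:
  assumes "0 < p" "p \<le> q"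
  obtains K c where "0 < c" "\<And>x n. p \<le> x \<Longrightarrow> x \<le> q \<Longrightarrow> K \<le> n \<Longrightarrow> c \<le> energy x n"
proof -
  define A where "A = 3 * exp (2 * total_err q)"
  have A: "0 < A" unfolding A_def by simp
  obtain K where K: "1 \<le> K" "\<And>x n. p \<le> x \<Longrightarrow> x \<le> q \<Longrightarrow> K \<le> n \<Longrightarrow> energy x K \<le> A * energy x n"
    using energy_eventually_controlled[OF assms] unfolding A_def by metis
  have "continuous_on {p..q} (\<lambda>x. energy x K)"
    unfolding energy_def using continuous_uv r_pos[OF K(1)] by (auto intro!: continuous_intros)
  then obtain x0 where x0: "x0 \<in> {p..q}" "\<And>x. x \<in> {p..q} \<Longrightarrow> energy x0 K \<le> energy x K"
    using continuous_attains_inf[of "{p..q}" "\<lambda>x. energy x K"] assms by auto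
  show ?thesis
  proof (rule that)
    show "0 < energy x0 K / A" using energy_pos[OF K(1)] A by simp
    show "energy x0 K / A \<le> energy x n" if "p \<le> x" "x \<le> q" "K \<le> n" for x n
      using order_trans[OF x0(2) K(2)] that A by (simp add: field_simps)
  qed
qed

end

section \<open>Small spectral parameter\<close>

context weighted_string begin

definition \<gamma> :: real where "\<gamma> = 2 - 2 * \<alpha>"

text \<open>
  As long as \<open>u\<close> stays near its initial value \<open>\<beta>\<close>, summing the second equation gives
  \<open>v x k \<approx> slope_part k * x\<close>.
\<close>

definition slope_part :: "nat \<Rightarrow> real" where "slope_part k = 1 / \<beta> + \<beta> * (\<Sum>j<k. (1 / r (Suc j))\<^sup>2)"

definition slope :: real where "slope = 1 / \<beta> + \<beta> * (\<Sum>j. (1 / r (Suc j))\<^sup>2)"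

lemma gamma_bounds: "0 < \<gamma>" "\<gamma> < 1"
  unfolding \<gamma>_def using alpha by auto

lemma summable_inv_r_Suc: "summable (\<lambda>j. (1 / r (Suc j))\<^sup>2)"
  using summable_inv_r by (rule summable_Suc_iff[THEN iffD2])

lemma slope_part_tendsto: "slope_part \<longlonglongrightarrow> slope"
  unfolding slope_part_def slope_def using summable_LIMSEQ[OF summable_inv_r_Suc] by (intro tendsto_intros)

lemma slope_part_le: "slope_part k \<le> slope" and slope_part_ge: "1 / \<beta> \<le> slope_part k" and slope_pos: "0 < slope"
proof -
  show "slope_part k \<le> slope" unfolding slope_part_def slope_def
    using sum_le_suminf[OF summable_inv_r_Suc, of "{..<k}"] beta by auto
  moreover show "1 / \<beta> \<le> slope_part k" unfolding slope_part_def using beta by (auto intro!: mult_nonneg_nonneg sum_nonneg)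
  moreover have "0 < 1 / \<beta>" using beta by simp
  ultimately show "0 < slope" by linarith
qed

lemma u_sum: "u x k = \<beta> - x * (\<Sum>j<k. v x j)"
  by (induction k) (auto simp: u0 uS algebra_simps)

lemma v_sum: "v x k = slope_part k * x + x * (\<Sum>j<k. (u x (Suc j) - \<beta>) * (1 / r (Suc j))\<^sup>2)"
proof (induction k)
  case 0 then show ?case by (simp add: v0 slope_part_def)
next
  case (Suc k)
  have "v x (Suc k) = v x k + x * u x (Suc k) * (1 / r (Suc k))\<^sup>2"
    unfolding v_step by (simp add: power_divide)
  then show ?case using Suc by (simp add: slope_part_def algebra_simps)
qed

text \<open>
  Bootstrap: the bound on \<open>v\<close> below \<open>k\<close> controls \<open>u - \<beta>\<close>, which in turn controls the deviation of
  \<open>v\<close> from \<open>slope_part k * x\<close> at \<open>k\<close>; the hypothesis on \<open>K\<close> makes that deviation smaller than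
  \<open>slope * x\<close>, and the induction closes.
\<close>

lemma early_bounds:
  assumes x: "0 < x" and K: "2 * x\<^sup>2 * real K powr \<gamma> \<le> \<gamma>" and k: "k \<le> K"
  shows "\<bar>v x k\<bar> \<le> 2 * slope * x" and "\<bar>u x k - \<beta>\<bar> \<le> 2 * slope * x\<^sup>2 * k"
    and "\<bar>v x k - slope_part k * x\<bar> \<le> 2 * slope * x ^ 3 * real k powr \<gamma> / \<gamma>"
proof -
  have u: "\<bar>u x k - \<beta>\<bar> \<le> 2 * slope * x\<^sup>2 * k" if "\<And>j. j < k \<Longrightarrow> \<bar>v x j\<bar> \<le> 2 * slope * x" for k
  proof -
    have "\<bar>\<Sum>j<k. v x j\<bar> \<le> (\<Sum>j<k. 2 * slope * x)"
      by (rule order_trans[OF sum_abs]) (intro sum_mono, use that in auto)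
    then have "x * \<bar>\<Sum>j<k. v x j\<bar> \<le> x * (k * (2 * slope * x))" using x by (intro mult_left_mono) auto
    then show ?thesis unfolding u_sum using x by (simp add: abs_mult power2_eq_square mult_ac)
  qed
  have v: "\<bar>v x k - slope_part k * x\<bar> \<le> 2 * slope * x ^ 3 * real k powr \<gamma> / \<gamma>"
    if *: "\<And>j. j < k \<Longrightarrow> \<bar>v x j\<bar> \<le> 2 * slope * x" for k
  proof -
    have "\<bar>\<Sum>j<k. (u x (Suc j) - \<beta>) * (1 / r (Suc j))\<^sup>2\<bar> \<le> (\<Sum>j<k. 2 * slope * x\<^sup>2 * real (Suc j) powr (\<gamma> - 1))"
    proof (rule order_trans[OF sum_abs], rule sum_mono)
      fix j assume "j \<in> {..<k}"
      then have "\<bar>u x (Suc j) - \<beta>\<bar> \<le> 2 * slope * x\<^sup>2 * real (Suc j)"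
        by (intro u) (use * in auto)
      then have "\<bar>u x (Suc j) - \<beta>\<bar> * (1 / r (Suc j))\<^sup>2 \<le> 2 * slope * x\<^sup>2 * real (Suc j) * (1 / r (Suc j))\<^sup>2"
        by (intro mult_right_mono) auto
      also have "real (Suc j) * (1 / r (Suc j))\<^sup>2 = real (Suc j) powr (\<gamma> - 1)"
      proof -
        have "real (Suc j) powr (\<gamma> - 1) = real (Suc j) powr (1 - 2 * \<alpha>)" by (simp add: \<gamma>_def)
        also have "\<dots> = real (Suc j) / real (Suc j) powr (2 * \<alpha>)" by (simp add: powr_diff)
        finally show ?thesis by (simp add: power_divide r_square)
      qed
      then have "2 * slope * x\<^sup>2 * real (Suc j) * (1 / r (Suc j))\<^sup>2 = 2 * slope * x\<^sup>2 * real (Suc j) powr (\<gamma> - 1)"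
        by (simp add: mult.assoc)
      finally show "\<bar>(u x (Suc j) - \<beta>) * (1 / r (Suc j))\<^sup>2\<bar> \<le> 2 * slope * x\<^sup>2 * real (Suc j) powr (\<gamma> - 1)"
        by (simp add: abs_mult)
    qed
    also have "\<dots> = 2 * slope * x\<^sup>2 * (\<Sum>j<k. real (Suc j) powr (\<gamma> - 1))" by (simp add: sum_distrib_left)
    also have "\<dots> \<le> 2 * slope * x\<^sup>2 * (real k powr \<gamma> / \<gamma>)"
      by (intro mult_left_mono sum_powr_le) (use gamma_bounds slope_pos in auto)
    finally have "x * \<bar>\<Sum>j<k. (u x (Suc j) - \<beta>) * (1 / r (Suc j))\<^sup>2\<bar> \<le> x * (2 * slope * x\<^sup>2 * (real k powr \<gamma> / \<gamma>))"
      using x by (intro mult_left_mono) auto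
    then show ?thesis unfolding v_sum[of x k] using x by (simp add: abs_mult power2_eq_square power3_eq_cube mult_ac)
  qed
  have main: "k \<le> K \<Longrightarrow> \<bar>v x k\<bar> \<le> 2 * slope * x" for k
  proof (induction k rule: less_induct)
    case (less k)
    have "\<bar>v x k - slope_part k * x\<bar> \<le> 2 * slope * x ^ 3 * real k powr \<gamma> / \<gamma>"
      by (rule v) (use less in auto)
    also have "\<dots> \<le> 2 * slope * x ^ 3 * real K powr \<gamma> / \<gamma>"
      by (intro divide_right_mono mult_left_mono powr_mono2) (use gamma_bounds slope_pos x less in auto)
    also have "\<dots> = slope * x * (2 * x\<^sup>2 * real K powr \<gamma> / \<gamma>)" by (simp add: power2_eq_square power3_eq_cube)
    also have "\<dots> \<le> slope * x * 1" by (intro mult_left_mono) (use K gamma_bounds slope_pos x in auto)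
    finally have "\<bar>v x k - slope_part k * x\<bar> \<le> slope * x" by simp
    moreover have "0 \<le> slope_part k * x" "slope_part k * x \<le> slope * x"
      using slope_part_le[of k] order_trans[OF _ slope_part_ge[of k], of 0] beta x by (auto intro: mult_right_mono)
    ultimately show ?case by linarith
  qed
  show "\<bar>v x k\<bar> \<le> 2 * slope * x" by (rule main[OF k])
  show "\<bar>u x k - \<beta>\<bar> \<le> 2 * slope * x\<^sup>2 * k" by (rule u) (use main k in auto)
  show "\<bar>v x k - slope_part k * x\<bar> \<le> 2 * slope * x ^ 3 * real k powr \<gamma> / \<gamma>" by (rule v) (use main k in auto)
qed

text \<open>
  The index scale on which \<open>x\<^sup>2 k powr \<gamma>\<close> is comparable to \<open>\<delta>\<^sup>2\<close>. Small values of \<open>\<delta>\<close> lie before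
  the first oscillation, and \<open>\<delta> = 4\<close> lies where the corrected energy takes over.
\<close>

definition crossover :: "real \<Rightarrow> real \<Rightarrow> nat" where
  "crossover \<delta> x = nat \<lceil>(\<delta> / x) powr (1 / (1 - \<alpha>))\<rceil>"

lemma crossover_ge: "(\<delta> / x) powr (1 / (1 - \<alpha>)) \<le> real (crossover \<delta> x)"
  unfolding crossover_def by linarith

lemma crossover_le:
  assumes "0 < x" "x \<le> \<delta>"
  shows "real (crossover \<delta> x) \<le> 2 * (\<delta> / x) powr (1 / (1 - \<alpha>))" and "1 \<le> crossover \<delta> x"
proof -
  have "1 \<le> (\<delta> / x) powr (1 / (1 - \<alpha>))"
    using assms alpha by (intro ge_one_powr_ge_zero) auto
  then show "real (crossover \<delta> x) \<le> 2 * (\<delta> / x) powr (1 / (1 - \<alpha>))" "1 \<le> crossover \<delta> x"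
    unfolding crossover_def by linarith+
qed

lemma crossover_powr:
  assumes "0 < x" "x \<le> \<delta>"
  shows "\<delta> / x \<le> real (crossover \<delta> x) powr (1 - \<alpha>)"
    and "\<delta>\<^sup>2 \<le> x\<^sup>2 * real (crossover \<delta> x) powr \<gamma>" and "x\<^sup>2 * real (crossover \<delta> x) powr \<gamma> \<le> 2 * \<delta>\<^sup>2"
proof -
  let ?y = "\<delta> / x" and ?K = "real (crossover \<delta> x)"
  have y: "0 < ?y" using assms by simp
  have "?y = (?y powr (1 / (1 - \<alpha>))) powr (1 - \<alpha>)" using y alpha assms by (simp add: powr_powr)
  also have "\<dots> \<le> ?K powr (1 - \<alpha>)" using alpha by (intro powr_mono2 crossover_ge) auto
  finally show 1: "?y \<le> ?K powr (1 - \<alpha>)" .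
  have g: "?K powr \<gamma> = (?K powr (1 - \<alpha>))\<^sup>2"
    unfolding \<gamma>_def by (simp add: power2_eq_square flip: powr_add)
  have "?y\<^sup>2 \<le> ?K powr \<gamma>" unfolding g using 1 y by (intro power_mono) auto
  then have "x\<^sup>2 * ?y\<^sup>2 \<le> x\<^sup>2 * ?K powr \<gamma>" by (intro mult_left_mono) auto
  then show "\<delta>\<^sup>2 \<le> x\<^sup>2 * ?K powr \<gamma>" using assms by (simp add: power_divide)
  have "?K powr \<gamma> \<le> (2 * ?y powr (1 / (1 - \<alpha>))) powr \<gamma>"
    using gamma_bounds by (intro powr_mono2 crossover_le assms) auto
  also have "\<dots> = 2 powr \<gamma> * ?y powr 2"
  proof -
    have "1 / (1 - \<alpha>) * \<gamma> = 2" unfolding \<gamma>_def using alpha by (simp add: field_simps)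
    then show ?thesis by (simp only: powr_mult powr_powr)
  qed
  also have "\<dots> \<le> 2 powr 1 * ?y\<^sup>2" using y gamma_bounds by (intro mult_mono powr_mono) auto
  finally have "x\<^sup>2 * ?K powr \<gamma> \<le> x\<^sup>2 * (2 * ?y\<^sup>2)" by (intro mult_left_mono) auto
  then show "x\<^sup>2 * ?K powr \<gamma> \<le> 2 * \<delta>\<^sup>2" using assms by (simp add: power_divide)
qed

lemma filterlim_crossover: assumes "0 < \<delta>" shows "filterlim (crossover \<delta>) at_top (at_right 0)"
proof -
  have "filterlim (\<lambda>x. (\<delta> / x) powr (1 / (1 - \<alpha>))) at_top (at_right 0)"
    using assms alpha by real_asymp
  then have "filterlim (\<lambda>x. real (crossover \<delta> x)) at_top (at_right 0)"
    by (rule filterlim_at_top_mono) (use crossover_ge in auto)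
  then show ?thesis unfolding filterlim_sequentially_iff_filterlim_real .
qed

lemma eventually_crossover:
  assumes "0 < \<delta>" "eventually P sequentially"
  shows "\<forall>\<^sub>F x in at_right 0. P (crossover \<delta> x)"
  using filterlim_crossover[OF assms(1)] assms(2) by (rule eventually_compose_filterlim[rotated])

lemma eventually_at_right_0: "0 < \<delta> \<Longrightarrow> \<forall>\<^sub>F x in at_right (0::real). 0 < x \<and> x \<le> \<delta>"
  unfolding eventually_at_right_field by (intro exI[of _ \<delta>]) auto

text \<open>
  Between \<open>crossover \<delta> x\<close> and \<open>crossover 4 x\<close> the ratio of the indices is bounded independently of
  \<open>x\<close>, so that the crude estimate of \<open>energy_step\<close> suffices; beyond, \<open>energy_control\<close> applies.
\<close>

lemma energy_comparable_to_crossover: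
  assumes \<delta>: "0 < \<delta>" "\<delta> \<le> 1"
  obtains C where "0 < C"
    "\<forall>\<^sub>F x in at_right 0. \<forall>n\<ge>crossover \<delta> x. energy x (crossover \<delta> x) \<le> C * energy x n \<and> energy x n \<le> C * energy x (crossover \<delta> x)"
proof -
  \<comment> \<open>The constant \<open>112 = 7 * 2 ^ 4\<close> is the one of \<open>energy_step\<close> for \<open>X = 1\<close>; indices from \<open>224\<close> on give increments of at most \<open>1 / 2\<close>.\<close>
  define B where "B = 112 * (2 * (4 / \<delta>) powr (1 / (1 - \<alpha>)))"
  define A where "A = 3 * exp (2 * total_err 1)"
  have B0: "0 \<le> B" unfolding B_def by simp
  have Z0: "0 \<le> total_err 1" unfolding total_err_def
    by (auto intro!: add_nonneg_nonneg mult_nonneg_nonneg suminf_nonneg summable_inv_sq summable_inv_r)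
  have A1: "1 \<le> A" unfolding A_def using Z0 by (smt (verit) one_le_exp_iff)
  have "\<forall>\<^sub>F x in at_right 0. \<forall>n\<ge>crossover \<delta> x. energy x (crossover \<delta> x) \<le> A * exp (2 * B) * energy x n \<and> energy x n \<le> A * exp (2 * B) * energy x (crossover \<delta> x)"
    using eventually_at_right_0[OF \<delta>(1)]
      eventually_crossover[OF \<delta>(1) eventually_ge_at_top[of 224]]
      eventually_crossover[OF zero_less_numeral[of "num.Bit0 (num.Bit0 num.One)"] eventually_step_errors_small[of 1]]
  proof eventually_elim
    case (elim x)
    then have x: "0 < x" "x \<le> \<delta>" "x \<le> 1" "x \<le> 4" and K0: "224 \<le> crossover \<delta> x"
      and small: "6 * (1 + 1)\<^sup>2 * ((1 / real (crossover 4 x))\<^sup>2 + (1 / r (crossover 4 x))\<^sup>2) \<le> 1 / 4" using \<delta> by auto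
    define K where "K = crossover \<delta> x"
    define M where "M = crossover 4 x"
    have KM: "K \<le> M" unfolding K_def M_def crossover_def
      by (intro nat_mono ceiling_mono powr_mono2 divide_right_mono) (use x alpha \<delta> in auto)
    have K1: "1 \<le> K" using K0 K_def by simp
    then have M1: "1 \<le> M" using KM by simp
    have dM: "d (M - 1) \<le> x / 4"
    proof -
      have "4 / x \<le> real M powr (1 - \<alpha>)" unfolding M_def using crossover_powr(1) x by simp
      then have "inverse (real M powr (1 - \<alpha>)) \<le> inverse (4 / x)" using x by (intro le_imp_inverse_le) auto
      also have "inverse (real M powr (1 - \<alpha>)) = real M powr (\<alpha> - 1)" by (simp add: powr_minus[symmetric])
      finally show ?thesis using d_le[of "M - 1"] M1 by simp
    qed
    have sB: "(\<Sum>k\<in>{K..<n}. 112 / real k) \<le> B" if "n \<le> M" for n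
    proof -
      have "(\<Sum>k\<in>{K..<n}. 112 / real k) \<le> (\<Sum>k\<in>{K..<n}. 112 / real K)"
        by (intro sum_mono divide_left_mono) (use K1 in auto)
      also have "\<dots> = real (n - K) * (112 / real K)" by simp
      also have "\<dots> \<le> (2 * (4 / x) powr (1 / (1 - \<alpha>))) * (112 / ((\<delta> / x) powr (1 / (1 - \<alpha>))))"
      proof (intro mult_mono divide_left_mono)
        show "real (n - K) \<le> 2 * (4 / x) powr (1 / (1 - \<alpha>))"
          using crossover_le(1)[of x 4] x that unfolding M_def by linarith
        show "(\<delta> / x) powr (1 / (1 - \<alpha>)) \<le> real K" unfolding K_def by (rule crossover_ge)
      qed (use x \<delta> K1 in auto)
      also have "\<dots> = B"
        unfolding B_def using x \<delta> by (simp add: powr_divide)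
      finally show ?thesis .
    qed
    have first: "exp (- 2 * B) * energy x K \<le> energy x n \<and> energy x n \<le> exp B * energy x K"
      if n: "K \<le> n" "n \<le> M" for n
    proof -
      let ?s = "\<Sum>k\<in>{K..<n}. 112 / real k"
      have g: "exp (- 2 * ?s) * energy x K \<le> energy x n \<and> energy x n \<le> exp ?s * energy x K"
      proof (rule gronwall_two_sided)
        fix k assume k: "K \<le> k" "k < n"
        show "\<bar>energy x (Suc k) - energy x k\<bar> \<le> 112 / real k * energy x k"
          using energy_step[of k x 1] k K1 x by simp
        show "0 \<le> 112 / real k \<and> 112 / real k \<le> 1 / 2"
          using k K0 unfolding K_def by (simp add: field_simps)
      qed (use energy_nonneg n in auto)
      have "exp (- 2 * B) * energy x K \<le> exp (- 2 * ?s) * energy x K" "exp ?s * energy x K \<le> exp B * energy x K"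
        using sB[OF n(2)] energy_nonneg by (auto intro!: mult_right_mono)
      then show ?thesis using g by linarith
    qed
    have later: "energy x M \<le> A * energy x n" "energy x n \<le> A * energy x M" if "M \<le> n" for n
      unfolding A_def using energy_control[of x 1 M] x M1 dM small that unfolding M_def by auto
    show ?case unfolding K_def[symmetric]
    proof (intro allI impI)
      fix n assume n: "K \<le> n"
      have firstM: "energy x K \<le> exp (2 * B) * energy x m" "energy x m \<le> exp (2 * B) * energy x K" if "K \<le> m" "m \<le> M" for m
      proof -
        show "energy x K \<le> exp (2 * B) * energy x m"
          using first[OF that] by (simp add: exp_minus field_simps)
        have "exp B * energy x K \<le> exp (2 * B) * energy x K" using B0 energy_nonneg by (intro mult_right_mono) auto
        then show "energy x m \<le> exp (2 * B) * energy x K" using first[OF that] by linarith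
      qed
      show "energy x K \<le> A * exp (2 * B) * energy x n \<and> energy x n \<le> A * exp (2 * B) * energy x K"
      proof (cases "n \<le> M")
        case True
        have "exp (2 * B) * energy x n \<le> A * (exp (2 * B) * energy x n)" "exp (2 * B) * energy x K \<le> A * (exp (2 * B) * energy x K)"
          using mult_right_mono[OF A1, of "exp (2 * B) * energy x n"] mult_right_mono[OF A1, of "exp (2 * B) * energy x K"]
            energy_nonneg by auto
        then show ?thesis using firstM[OF n True] unfolding mult.assoc by linarith
      next
        case False
        then have l: "energy x M \<le> A * energy x n" "energy x n \<le> A * energy x M" using later by auto
        have "exp (2 * B) * energy x M \<le> exp (2 * B) * (A * energy x n)" using l by (intro mult_left_mono) auto
        moreover have "A * energy x M \<le> A * (exp (2 * B) * energy x K)" using firstM[of M] KM A1 by (intro mult_left_mono) auto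
        moreover have "energy x K \<le> exp (2 * B) * energy x M" by (rule firstM[OF KM order_refl])
        moreover have "exp (2 * B) * (A * energy x n) = A * exp (2 * B) * energy x n" by simp
        ultimately show ?thesis using l unfolding mult.assoc by linarith
      qed
    qed
  qed
  moreover have "0 < A * exp (2 * B)" using A1 by simp
  ultimately show ?thesis using that by blast
qed

lemma limit_energy_comparable:
  assumes "0 < \<delta>" "\<delta> \<le> 1"
  obtains C where "0 < C"
    "\<forall>\<^sub>F x in at_right 0. energy x (crossover \<delta> x) \<le> C * limit_energy x \<and> limit_energy x \<le> C * energy x (crossover \<delta> x)"
proof -
  obtain C where C: "0 < C"
    "\<forall>\<^sub>F x in at_right 0. \<forall>n\<ge>crossover \<delta> x. energy x (crossover \<delta> x) \<le> C * energy x n \<and> energy x n \<le> C * energy x (crossover \<delta> x)"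
    by (rule energy_comparable_to_crossover[OF assms])
  have "\<forall>\<^sub>F x in at_right 0. energy x (crossover \<delta> x) \<le> C * limit_energy x \<and> limit_energy x \<le> C * energy x (crossover \<delta> x)"
    using C(2) eventually_at_right_0[OF zero_less_one]
  proof eventually_elim
    case (elim x)
    then have t: "energy x \<longlonglongrightarrow> limit_energy x" using energy_tendsto_limit by blast
    have E: "energy x (crossover \<delta> x) \<le> C * energy x n" "energy x n \<le> C * energy x (crossover \<delta> x)" if "crossover \<delta> x \<le> n" for n
      using elim that by blast+
    have "energy x (crossover \<delta> x) \<le> C * limit_energy x"
      by (rule LIMSEQ_le_const[OF tendsto_mult_left[OF t]]) (use E in blast)
    moreover have "limit_energy x \<le> C * energy x (crossover \<delta> x)"
      by (rule LIMSEQ_le_const2[OF t]) (use E in blast)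
    ultimately show ?case ..
  qed
  then show ?thesis using C(1) that by blast
qed

lemma crossover_bounds:
  assumes x: "0 < x" "x \<le> \<delta>" and \<delta>: "4 * \<delta>\<^sup>2 \<le> \<gamma>"
  defines "K \<equiv> crossover \<delta> x"
  shows "\<bar>v x K\<bar> \<le> 2 * slope * x" and "\<bar>u x K - \<beta>\<bar> \<le> 2 * slope * x\<^sup>2 * K"
    and "\<bar>v x K - slope_part K * x\<bar> \<le> 4 * slope * \<delta>\<^sup>2 / \<gamma> * x"
    and "r K * (v x K)\<^sup>2 \<le> 8 * slope\<^sup>2 * \<delta>\<^sup>2 * real K powr (3 * \<alpha> - 2)"
    and "(u x K)\<^sup>2 / r K \<le> 32 * slope\<^sup>2 * \<delta> ^ 4 * real K powr (3 * \<alpha> - 2) + 2 * \<beta>\<^sup>2 * real K powr (- \<alpha>)"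
proof -
  have K1: "1 \<le> K" unfolding K_def by (rule crossover_le(2)[OF x])
  have g: "x\<^sup>2 * real K powr \<gamma> \<le> 2 * \<delta>\<^sup>2" unfolding K_def by (rule crossover_powr(3)[OF x])
  then have K: "2 * x\<^sup>2 * real K powr \<gamma> \<le> \<gamma>" using \<delta> by linarith
  note e = early_bounds[OF x(1) K order_refl]
  show v: "\<bar>v x K\<bar> \<le> 2 * slope * x" and u: "\<bar>u x K - \<beta>\<bar> \<le> 2 * slope * x\<^sup>2 * K" by (rule e)+
  have "2 * slope * x ^ 3 * real K powr \<gamma> / \<gamma> = 2 * slope * x / \<gamma> * (x\<^sup>2 * real K powr \<gamma>)"
    by (simp add: power2_eq_square power3_eq_cube)
  also have "\<dots> \<le> 2 * slope * x / \<gamma> * (2 * \<delta>\<^sup>2)" by (intro mult_left_mono g) (use slope_pos x gamma_bounds in auto)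
  finally show "\<bar>v x K - slope_part K * x\<bar> \<le> 4 * slope * \<delta>\<^sup>2 / \<gamma> * x" using e(3) by (simp add: mult_ac)
  have rK: "r K = real K powr \<gamma> * real K powr (3 * \<alpha> - 2)"
    unfolding r_def \<gamma>_def by (simp flip: powr_add)
  have "(v x K)\<^sup>2 \<le> (2 * slope * x)\<^sup>2" using power_mono[OF v abs_ge_zero, of 2] by simp
  then have "r K * (v x K)\<^sup>2 \<le> r K * (2 * slope * x)\<^sup>2" using r_pos[OF K1] by (intro mult_left_mono) auto
  also have "\<dots> = 4 * slope\<^sup>2 * (x\<^sup>2 * real K powr \<gamma>) * real K powr (3 * \<alpha> - 2)" unfolding rK by (simp add: power_mult_distrib)
  also have "\<dots> \<le> 4 * slope\<^sup>2 * (2 * \<delta>\<^sup>2) * real K powr (3 * \<alpha> - 2)" by (intro mult_right_mono mult_left_mono g) auto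
  finally show "r K * (v x K)\<^sup>2 \<le> 8 * slope\<^sup>2 * \<delta>\<^sup>2 * real K powr (3 * \<alpha> - 2)" by simp
  define w where "w = u x K - \<beta>"
  have "(u x K)\<^sup>2 \<le> 2 * \<beta>\<^sup>2 + 2 * w\<^sup>2"
    unfolding w_def using sum_squares_bound[of \<beta> "u x K - \<beta>"] by (simp add: power2_eq_square algebra_simps)
  moreover have "w\<^sup>2 \<le> (2 * slope * x\<^sup>2 * K)\<^sup>2" unfolding w_def
    using u by (metis abs_ge_zero power2_abs power_mono)
  ultimately have "(u x K)\<^sup>2 / r K \<le> (2 * \<beta>\<^sup>2 + 2 * (2 * slope * x\<^sup>2 * K)\<^sup>2) / r K"
    using r_pos[OF K1] by (intro divide_right_mono) auto
  also have "\<dots> = 2 * \<beta>\<^sup>2 / r K + 8 * slope\<^sup>2 * (x\<^sup>2 * x\<^sup>2 * ((real K)\<^sup>2 / r K))"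
    by (simp add: add_divide_distrib power_mult_distrib power2_eq_square)
  finally have 1: "(u x K)\<^sup>2 / r K \<le> 2 * \<beta>\<^sup>2 / r K + 8 * slope\<^sup>2 * (x\<^sup>2 * x\<^sup>2 * ((real K)\<^sup>2 / r K))" .
  have "(real K)\<^sup>2 / r K = real K powr (2 - \<alpha>)" unfolding r_def using K1 by (simp add: powr_diff)
  also have "\<dots> = real K powr (\<gamma> + \<gamma> + (3 * \<alpha> - 2))" by (simp add: \<gamma>_def)
  finally have "x\<^sup>2 * x\<^sup>2 * ((real K)\<^sup>2 / r K) = (x\<^sup>2 * real K powr \<gamma>) * (x\<^sup>2 * real K powr \<gamma>) * real K powr (3 * \<alpha> - 2)"
    by (simp only: powr_add mult_ac)
  also have "\<dots> \<le> (2 * \<delta>\<^sup>2) * (2 * \<delta>\<^sup>2) * real K powr (3 * \<alpha> - 2)"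
    by (intro mult_right_mono mult_mono g) auto
  finally have "8 * slope\<^sup>2 * (x\<^sup>2 * x\<^sup>2 * ((real K)\<^sup>2 / r K)) \<le> 8 * slope\<^sup>2 * ((2 * \<delta>\<^sup>2) * (2 * \<delta>\<^sup>2) * real K powr (3 * \<alpha> - 2))"
    by (intro mult_left_mono) auto
  also have "\<dots> = 32 * slope\<^sup>2 * \<delta> ^ 4 * real K powr (3 * \<alpha> - 2)"
    by (simp add: power4_eq_xxxx power2_eq_square)
  finally show "(u x K)\<^sup>2 / r K \<le> 32 * slope\<^sup>2 * \<delta> ^ 4 * real K powr (3 * \<alpha> - 2) + 2 * \<beta>\<^sup>2 * real K powr (- \<alpha>)"
    using 1 unfolding r_def by (simp add: powr_minus_divide)
qed

text \<open>
  The energy at the crossover is at most of order \<open>k powr (3 \<alpha> - 2) + k powr (- \<alpha>)\<close>, and both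
  exponents are negative.
\<close>

lemma limit_energy_tendsto_0:
  assumes "\<alpha> < 2 / 3"
  shows "(limit_energy \<longlongrightarrow> 0) (at_right 0)"
proof -
  define \<delta> where "\<delta> = sqrt \<gamma> / 2"
  have \<delta>: "0 < \<delta>" "\<delta> \<le> 1" "4 * \<delta>\<^sup>2 \<le> \<gamma>"
  proof -
    have "sqrt \<gamma> \<le> 1" using gamma_bounds by simp
    then show "\<delta> \<le> 1" unfolding \<delta>_def by linarith
    show "0 < \<delta>" "4 * \<delta>\<^sup>2 \<le> \<gamma>" unfolding \<delta>_def using gamma_bounds by (auto simp: power_divide)
  qed
  obtain C where C: "0 < C"
    "\<forall>\<^sub>F x in at_right 0. energy x (crossover \<delta> x) \<le> C * limit_energy x \<and> limit_energy x \<le> C * energy x (crossover \<delta> x)"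
    by (rule limit_energy_comparable[OF \<delta>(1,2)])
  define F where "F k = C * ((8 * slope\<^sup>2 * \<delta>\<^sup>2 + 32 * slope\<^sup>2 * \<delta> ^ 4) * real k powr (3 * \<alpha> - 2) + 2 * \<beta>\<^sup>2 * real k powr (- \<alpha>))" for k :: nat
  have "F \<longlonglongrightarrow> C * ((8 * slope\<^sup>2 * \<delta>\<^sup>2 + 32 * slope\<^sup>2 * \<delta> ^ 4) * 0 + 2 * \<beta>\<^sup>2 * 0)"
    unfolding F_def using assms alpha
    by (intro tendsto_intros tendsto_neg_powr filterlim_real_sequentially) auto
  then have "F \<longlonglongrightarrow> 0" by simp
  then have F: "((\<lambda>x. F (crossover \<delta> x)) \<longlongrightarrow> 0) (at_right 0)"
    using filterlim_compose filterlim_crossover[OF \<delta>(1)] by blast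
  show ?thesis
  proof (rule tendsto_sandwich[OF _ _ tendsto_const F])
    show "\<forall>\<^sub>F x in at_right 0. 0 \<le> limit_energy x"
      using eventually_at_right_0[OF zero_less_one] by eventually_elim (auto intro!: less_imp_le limit_energy_pos)
    show "\<forall>\<^sub>F x in at_right 0. limit_energy x \<le> F (crossover \<delta> x)"
      using C(2) eventually_at_right_0[OF \<delta>(1)]
    proof eventually_elim
      case (elim x)
      note b = crossover_bounds(4,5)[OF _ _ \<delta>(3), of x]
      have "C * energy x (crossover \<delta> x) \<le> F (crossover \<delta> x)"
        unfolding F_def energy_def using b elim C(1) by (intro mult_left_mono) (auto simp: algebra_simps)
      then show ?case using elim by linarith
    qed
  qed
qed

text \<open>
  It suffices to bound the term \<open>r k * v\<^sup>2\<close> of the energy from below.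
\<close>

lemma limit_energy_at_top:
  assumes "2 / 3 < \<alpha>"
  shows "filterlim limit_energy at_top (at_right 0)"
proof -
  \<comment> \<open>So small that the error in \<open>v x k \<approx> slope_part k * x\<close> is at most half of the main term, using \<open>slope_part k \<ge> 1 / \<beta>\<close>.\<close>
  define \<delta> where "\<delta> = sqrt (min \<gamma> (\<gamma> / (2 * slope * \<beta>))) / 2"
  have m: "0 < min \<gamma> (\<gamma> / (2 * slope * \<beta>))" "min \<gamma> (\<gamma> / (2 * slope * \<beta>)) \<le> 1" using gamma_bounds slope_pos beta by auto
  have \<delta>: "0 < \<delta>" "\<delta> \<le> 1" "4 * \<delta>\<^sup>2 \<le> \<gamma>" "4 * \<delta>\<^sup>2 \<le> \<gamma> / (2 * slope * \<beta>)"
  proof -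
    show "0 < \<delta>" unfolding \<delta>_def using m by simp
    have "sqrt (min \<gamma> (\<gamma> / (2 * slope * \<beta>))) \<le> 1" using m by simp
    then show "\<delta> \<le> 1" unfolding \<delta>_def by linarith
    have "4 * \<delta>\<^sup>2 = min \<gamma> (\<gamma> / (2 * slope * \<beta>))" unfolding \<delta>_def using m by (simp add: power_divide)
    then show "4 * \<delta>\<^sup>2 \<le> \<gamma>" "4 * \<delta>\<^sup>2 \<le> \<gamma> / (2 * slope * \<beta>)" by auto
  qed
  obtain C where C: "0 < C"
    "\<forall>\<^sub>F x in at_right 0. energy x (crossover \<delta> x) \<le> C * limit_energy x \<and> limit_energy x \<le> C * energy x (crossover \<delta> x)"
    by (rule limit_energy_comparable[OF \<delta>(1,2)])
  define F where "F k = \<delta>\<^sup>2 / (4 * \<beta>\<^sup>2) / C * real k powr (3 * \<alpha> - 2)" for k :: nat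
  have "0 < \<delta>\<^sup>2 / (4 * \<beta>\<^sup>2) / C" using \<delta> beta C by simp
  moreover have "filterlim (\<lambda>k. real k powr (3 * \<alpha> - 2)) at_top sequentially"
    using assms by real_asymp
  ultimately have "filterlim F at_top sequentially"
    unfolding F_def by (intro filterlim_tendsto_pos_mult_at_top[OF tendsto_const])
  then have F: "filterlim (\<lambda>x. F (crossover \<delta> x)) at_top (at_right 0)"
    using filterlim_compose filterlim_crossover[OF \<delta>(1)] by blast
  show ?thesis
  proof (rule filterlim_at_top_mono[OF F])
    show "\<forall>\<^sub>F x in at_right 0. F (crossover \<delta> x) \<le> limit_energy x"
      using C(2) eventually_at_right_0[OF \<delta>(1)]
    proof eventually_elim
      case (elim x)
      let ?K = "crossover \<delta> x"
      have K1: "1 \<le> ?K" using crossover_le(2) elim by auto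
      have "4 * slope * \<delta>\<^sup>2 / \<gamma> * x \<le> (1 / (2 * \<beta>)) * x"
        using \<delta>(4) slope_pos beta gamma_bounds elim by (intro mult_right_mono) (auto simp: field_simps)
      moreover have "1 / \<beta> * x \<le> slope_part ?K * x" using slope_part_ge elim by (intro mult_right_mono) auto
      moreover have "1 / \<beta> * x = 2 * ((1 / (2 * \<beta>)) * x)" by simp
      moreover have "\<bar>v x ?K - slope_part ?K * x\<bar> \<le> 4 * slope * \<delta>\<^sup>2 / \<gamma> * x"
        by (rule crossover_bounds(3)) (use elim \<delta> in auto)
      ultimately have "(1 / (2 * \<beta>)) * x \<le> v x ?K" by linarith
      then have "((1 / (2 * \<beta>)) * x)\<^sup>2 \<le> (v x ?K)\<^sup>2" using elim beta by (intro power_mono) auto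
      then have v2: "x\<^sup>2 / (4 * \<beta>\<^sup>2) \<le> (v x ?K)\<^sup>2" by (simp add: power_mult_distrib power_divide)
      have "\<delta>\<^sup>2 / (4 * \<beta>\<^sup>2) * real ?K powr (3 * \<alpha> - 2) \<le> (x\<^sup>2 * real ?K powr \<gamma>) / (4 * \<beta>\<^sup>2) * real ?K powr (3 * \<alpha> - 2)"
        by (intro mult_right_mono divide_right_mono crossover_powr) (use elim in auto)
      also have "\<dots> = (x\<^sup>2 / (4 * \<beta>\<^sup>2)) * (real ?K powr \<gamma> * real ?K powr (3 * \<alpha> - 2))" by simp
      also have "real ?K powr \<gamma> * real ?K powr (3 * \<alpha> - 2) = r ?K" unfolding r_def \<gamma>_def by (simp flip: powr_add)
      also have "x\<^sup>2 / (4 * \<beta>\<^sup>2) * r ?K \<le> (v x ?K)\<^sup>2 * r ?K" using v2 r_pos[OF K1] by (intro mult_right_mono) auto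
      also have "\<dots> \<le> energy x ?K" unfolding energy_def using r_pos[OF K1] by simp
      also have "\<dots> \<le> C * limit_energy x" using elim by simp
      finally have "\<delta>\<^sup>2 / (4 * \<beta>\<^sup>2) * real ?K powr (3 * \<alpha> - 2) / C \<le> limit_energy x"
        using C(1) by (simp only: pos_divide_le_eq mult.commute)
      then show ?case unfolding F_def by simp
    qed
  qed
qed

end

section \<open>The critical exponent\<close>

text \<open>
  The second difference of \<open>k powr (2 / 3)\<close> agrees with its second derivative
  \<open>2 / 9 * k powr (- 4 / 3)\<close>, up to sign, to order \<open>k powr (- 7 / 3)\<close>. The two meet in \<open>invariant_step\<close>,
  where the difference has to be summable.
\<close>

lemma cbrt_second_difference:
  "(\<lambda>k. (2 / 9 * real (Suc k) powr (- 4 / 3)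
     - ((real k powr (2 / 3) - real (k - 1) powr (2 / 3)) - (real (Suc k) powr (2 / 3) - real k powr (2 / 3)))) * (real k)\<^sup>2) \<longlonglongrightarrow> 0"
proof -
  have "((\<lambda>x::real. (2 / 9 * (x + 1) powr (- 4 / 3)
     - ((x powr (2 / 3) - (x - 1) powr (2 / 3)) - ((x + 1) powr (2 / 3) - x powr (2 / 3)))) * x\<^sup>2) \<longlongrightarrow> 0) at_top"
    by real_asymp
  from filterlim_compose[OF this filterlim_real_sequentially]
  show ?thesis
  proof (rule Lim_transform_eventually)
    show "\<forall>\<^sub>F k in sequentially. (2 / 9 * (real k + 1) powr (- 4 / 3)
     - ((real k powr (2 / 3) - (real k - 1) powr (2 / 3)) - ((real k + 1) powr (2 / 3) - real k powr (2 / 3)))) * (real k)\<^sup>2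
     = (2 / 9 * real (Suc k) powr (- 4 / 3)
     - ((real k powr (2 / 3) - real (k - 1) powr (2 / 3)) - (real (Suc k) powr (2 / 3) - real k powr (2 / 3)))) * (real k)\<^sup>2"
      using eventually_ge_at_top[of 1] by eventually_elim (simp add: of_nat_diff add.commute)
  qed
qed

context weighted_string begin

text \<open>
  For \<open>\<alpha> = 2 / 3\<close> the derivative of \<open>v\<^sup>2 / (9 x\<^sup>2)\<close> along the differential equation is
  \<open>2 / 9 * t powr (- 4 / 3) * u v / x\<close>, which cancels the slow drift of the corrected energy.
\<close>

definition invariant :: "real \<Rightarrow> nat \<Rightarrow> real" where
  "invariant x k = corrected_energy x k + (v x k)\<^sup>2 / (9 * x\<^sup>2)"

lemma invariant_step_identity:
  fixes q U V x :: real
  assumes "x \<noteq> 0"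
  shows "((V + x * U * q)\<^sup>2 - V\<^sup>2) / (9 * x\<^sup>2) = (2 / 9 * q) / x * ((U + x * V) * V) - 2 / 9 * (q * V\<^sup>2) + q\<^sup>2 * U\<^sup>2 / 9"
  using assms by (simp add: field_simps power2_eq_square)

text \<open>
  Every error term is at most \<open>(1 / k)\<^sup>2\<close> or \<open>(x / r k)\<^sup>2\<close> times the energy, except the mismatch of
  the second differences, which carries an additional \<open>1 / x\<close>; the constant \<open>15\<close> collects all terms
  with \<open>(1 / k)\<^sup>2\<close>.
\<close>

lemma invariant_step:
  assumes al: "\<alpha> = 2 / 3"
  obtains D K0 where "0 < D" "1 \<le> K0"
    "\<And>x k. 0 < x \<Longrightarrow> x \<le> 1 \<Longrightarrow> K0 \<le> k \<Longrightarrow>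
      \<bar>invariant x (Suc k) - invariant x k\<bar> \<le> (D / x * (1 / real k)\<^sup>2 + 12 * x\<^sup>2 * (1 / r k)\<^sup>2) * energy x k"
proof -
  have r23: "r k = real k powr (2 / 3)" for k unfolding r_def by (simp add: al)
  have "\<forall>\<^sub>F k in sequentially. norm ((2 / 9 * real (Suc k) powr (- 4 / 3)
     - ((real k powr (2 / 3) - real (k - 1) powr (2 / 3)) - (real (Suc k) powr (2 / 3) - real k powr (2 / 3)))) * (real k)\<^sup>2) < 1"
    using order_tendstoD(2)[OF tendsto_norm_zero[OF cbrt_second_difference], of 1] by simp
  then obtain K1 where K1: "\<And>k. K1 \<le> k \<Longrightarrow> norm ((2 / 9 * real (Suc k) powr (- 4 / 3)
     - ((real k powr (2 / 3) - real (k - 1) powr (2 / 3)) - (real (Suc k) powr (2 / 3) - real k powr (2 / 3)))) * (real k)\<^sup>2) < 1"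
    unfolding eventually_sequentially by blast
  show ?thesis
  proof (rule that)
    show "0 < (15 :: real)" by simp
    show "1 \<le> max 1 K1" by simp
    fix x :: real and k :: nat assume x: "0 < x" "x \<le> 1" and k0: "max 1 K1 \<le> k"
    have k: "1 \<le> k" using k0 by simp
    have aux: "a \<le> 38 / 3 * w + 1 / 2 * y + t \<Longrightarrow> w \<le> y \<Longrightarrow> 0 \<le> y \<Longrightarrow> a \<le> 15 * y + t" for a w y t :: real
      by linarith
    define q where "q = real (Suc k) powr (- 4 / 3)"
    define S where "S = energy x k"
    define \<Delta> where "\<Delta> = d (k - 1) - d k"
    let ?U = "u x (Suc k)" and ?V = "v x k"
    have S0: "0 \<le> S" unfolding S_def by (rule energy_nonneg)
    have r: "1 \<le> r k" "r k \<le> r (Suc k)" using r_ge_1[OF k] r_mono by auto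
    have d: "\<bar>2 / 9 * q - \<Delta>\<bar> \<le> (1 / real k)\<^sup>2"
    proof -
      have "\<bar>2 / 9 * q - \<Delta>\<bar> * (real k)\<^sup>2 \<le> 1"
        using K1[of k] k0 k unfolding q_def \<Delta>_def d_def r23 by (simp add: abs_mult)
      then show ?thesis using k by (simp add: power_divide field_simps)
    qed
    have q0: "0 \<le> q" unfolding q_def by simp
    have qr: "q = 1 / (r (Suc k))\<^sup>2"
    proof -
      have "2 * \<alpha> = 4 / 3" using al by simp
      then have "(r (Suc k))\<^sup>2 = real (Suc k) powr (4 / 3)" unfolding r_square by (simp only:)
      then show ?thesis unfolding q_def by (simp add: powr_minus_divide)
    qed
    have qk: "q \<le> real k powr (- 4 / 3)" unfolding q_def using k by (intro powr_mono2') auto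
    have k43: "real k powr (- 4 / 3) / r k = (1 / real k)\<^sup>2"
      unfolding r23 using k by (simp add: powr_minus_divide power_divide flip: powr_add)
    have k83: "(real k powr (- 4 / 3))\<^sup>2 * r k = (1 / real k)\<^sup>2"
    proof -
      have "(real k powr (- 4 / 3))\<^sup>2 * r k = real k powr (-2)"
        unfolding r23 power2_eq_square by (simp flip: powr_add)
      then show ?thesis using k by (simp add: powr_minus_divide power_divide)
    qed
    have S: "r k * ?V\<^sup>2 + (?U + x * ?V)\<^sup>2 / r k = S" unfolding S_def energy_def u_step[of x k] ..
    note b = step_bounds(1,2)[OF r x, where V' = ?V and U = ?U, unfolded S]
    have V: "q * ?V\<^sup>2 \<le> (1 / real k)\<^sup>2 * S"
    proof -
      have "q * ?V\<^sup>2 \<le> real k powr (- 4 / 3) * (S / r k)" by (intro mult_mono b qk) auto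
      also have "\<dots> = real k powr (- 4 / 3) / r k * S" by simp
      finally show ?thesis unfolding k43 .
    qed
    have U: "q\<^sup>2 * ?U\<^sup>2 \<le> 4 * ((1 / real k)\<^sup>2 * S)"
    proof -
      have "q\<^sup>2 * ?U\<^sup>2 \<le> (real k powr (- 4 / 3))\<^sup>2 * ((1 + 1)\<^sup>2 * r k * S)"
        by (intro mult_mono power_mono b qk q0) auto
      also have "\<dots> = 4 * ((real k powr (- 4 / 3))\<^sup>2 * r k * S)" by simp
      finally show ?thesis unfolding k83 .
    qed
    have uv: "\<bar>(2 / 9 * q - \<Delta>) / x * (u x k * ?V)\<bar> \<le> (1 / real k)\<^sup>2 / x * (S / 2)"
      unfolding abs_mult abs_divide S_def
      using x by (intro mult_mono divide_mono d uv_le_energy[OF k, unfolded abs_mult]) (auto intro: energy_nonneg)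
    have e: "\<bar>corrected_energy x (Suc k) - corrected_energy x k + \<Delta> / x * (u x k * ?V)\<bar>
      \<le> 12 * ((1 / real k)\<^sup>2 + (x / r k)\<^sup>2) * S"
      using corrected_energy_step[OF k x] unfolding \<Delta>_def S_def by simp
    have "(v x (Suc k))\<^sup>2 - ?V\<^sup>2 = (?V + x * ?U * q)\<^sup>2 - ?V\<^sup>2" unfolding v_step[of x k] qr by simp
    then have id: "((v x (Suc k))\<^sup>2 - ?V\<^sup>2) / (9 * x\<^sup>2) =
       (2 / 9 * q) / x * (u x k * ?V) - 2 / 9 * (q * ?V\<^sup>2) + q\<^sup>2 * ?U\<^sup>2 / 9"
      using invariant_step_identity[of x ?V ?U q] x unfolding u_step[of x k] by simp
    have "invariant x (Suc k) - invariant x k = (corrected_energy x (Suc k) - corrected_energy x k) + ((v x (Suc k))\<^sup>2 - ?V\<^sup>2) / (9 * x\<^sup>2)"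
      unfolding invariant_def by (simp add: diff_divide_distrib)
    also have "\<dots> = (corrected_energy x (Suc k) - corrected_energy x k + \<Delta> / x * (u x k * ?V)) + (2 / 9 * q - \<Delta>) / x * (u x k * ?V)
        - 2 / 9 * (q * ?V\<^sup>2) + q\<^sup>2 * ?U\<^sup>2 / 9"
      unfolding id by (simp add: diff_divide_distrib left_diff_distrib)
    finally have "\<bar>invariant x (Suc k) - invariant x k\<bar> \<le> 12 * ((1 / real k)\<^sup>2 + (x / r k)\<^sup>2) * S
       + (1 / real k)\<^sup>2 / x * (S / 2) + 2 / 9 * ((1 / real k)\<^sup>2 * S) + 4 * ((1 / real k)\<^sup>2 * S) / 9"
      using e uv U V mult_nonneg_nonneg[OF q0 zero_le_power2[of ?V]] mult_nonneg_nonneg[OF zero_le_power2[of q] zero_le_power2[of ?U]]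
      by linarith
    also have "\<dots> = 38 / 3 * ((1 / real k)\<^sup>2 * S) + 1 / 2 * ((1 / real k)\<^sup>2 * S / x) + 12 * x\<^sup>2 * (1 / r k)\<^sup>2 * S"
      by (simp add: algebra_simps power_divide)
    finally have "\<bar>invariant x (Suc k) - invariant x k\<bar> \<le> 38 / 3 * ((1 / real k)\<^sup>2 * S) + 1 / 2 * ((1 / real k)\<^sup>2 * S / x) + 12 * x\<^sup>2 * (1 / r k)\<^sup>2 * S" .
    moreover have "(1 / real k)\<^sup>2 * S \<le> (1 / real k)\<^sup>2 * S / x"
      using divide_left_mono[of x 1 "(1 / real k)\<^sup>2 * S"] x S0 by simp
    moreover have "0 \<le> (1 / real k)\<^sup>2 * S / x" using S0 x by simp
    ultimately have "\<bar>invariant x (Suc k) - invariant x k\<bar> \<le> 15 * ((1 / real k)\<^sup>2 * S / x) + 12 * x\<^sup>2 * (1 / r k)\<^sup>2 * S"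
      using aux by blast
    also have "\<dots> = (15 / x * (1 / real k)\<^sup>2 + 12 * x\<^sup>2 * (1 / r k)\<^sup>2) * S" by (simp add: algebra_simps)
    finally show "\<bar>invariant x (Suc k) - invariant x k\<bar> \<le> (15 / x * (1 / real k)\<^sup>2 + 12 * x\<^sup>2 * (1 / r k)\<^sup>2) * energy x k"
      unfolding S_def .
  qed
qed

lemma invariant_tendsto_limit:
  assumes x: "0 < x" shows "invariant x \<longlonglongrightarrow> limit_energy x"
proof -
  have t: "energy x \<longlonglongrightarrow> limit_energy x" by (rule energy_tendsto_limit[OF x])
  have "(\<lambda>k. invariant x k - energy x k) \<longlonglongrightarrow> 0"
  proof (rule Lim_null_comparison)
    show "\<forall>\<^sub>F k in sequentially. norm (invariant x k - energy x k) \<le> (d (k - 1) / (2 * x) + 1 / (9 * x\<^sup>2) * (1 / r k)) * energy x k"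
      using eventually_ge_at_top[of 1]
    proof eventually_elim
      case (elim k)
      have "\<bar>d (k - 1) / x * (u x k * v x k)\<bar> \<le> d (k - 1) / x * (energy x k / 2)"
        unfolding abs_mult[of "d (k - 1) / x"]
        using x d_nonneg[of "k - 1"] by (intro mult_mono uv_le_energy elim) auto
      moreover have "(v x k)\<^sup>2 / (9 * x\<^sup>2) \<le> (energy x k / r k) / (9 * x\<^sup>2)"
        by (intro divide_right_mono v_le_energy elim) auto
      moreover have "0 \<le> (v x k)\<^sup>2 / (9 * x\<^sup>2)" by simp
      ultimately have "\<bar>invariant x k - energy x k\<bar> \<le> d (k - 1) / x * (energy x k / 2) + (energy x k / r k) / (9 * x\<^sup>2)"
        unfolding invariant_def corrected_energy_def by linarith
      then show ?case by (simp add: algebra_simps)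
    qed
    have "(\<lambda>k. d (Suc k - 1)) \<longlonglongrightarrow> 0" using d_tendsto_0 by simp
    then have d0: "(\<lambda>k. d (k - 1)) \<longlonglongrightarrow> 0" by (rule LIMSEQ_imp_Suc)
    have r0: "(\<lambda>k. 1 / r k) \<longlonglongrightarrow> 0" unfolding r_def using alpha by real_asymp
    have "(\<lambda>k. (d (k - 1) / (2 * x) + 1 / (9 * x\<^sup>2) * (1 / r k)) * energy x k) \<longlonglongrightarrow> (0 / (2 * x) + 1 / (9 * x\<^sup>2) * 0) * limit_energy x"
      by (intro tendsto_intros d0 r0 t) (use x in auto)
    then show "(\<lambda>k. (d (k - 1) / (2 * x) + 1 / (9 * x\<^sup>2) * (1 / r k)) * energy x k) \<longlonglongrightarrow> 0" by simp
  qed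
  from tendsto_add[OF this t] show ?thesis by simp
qed

text \<open>
  From the crossover on the energy is bounded uniformly in \<open>x\<close>, so the errors of
  \<open>invariant_step\<close> can be summed. Since the crossover index is at least \<open>(\<delta> / x) ^ 3\<close>, the sum of
  \<open>(1 / k)\<^sup>2 / x\<close> beyond it vanishes with \<open>x\<close>.
\<close>

lemma limit_energy_close_to_invariant:
  assumes al: "\<alpha> = 2 / 3" and \<delta>: "0 < \<delta>" "\<delta> \<le> 1" "4 * \<delta>\<^sup>2 \<le> \<gamma>"
  shows "((\<lambda>x. limit_energy x - invariant x (crossover \<delta> x)) \<longlongrightarrow> 0) (at_right 0)"
proof -
  obtain C where C: "0 < C"
    "\<forall>\<^sub>F x in at_right 0. \<forall>n\<ge>crossover \<delta> x. energy x (crossover \<delta> x) \<le> C * energy x n \<and> energy x n \<le> C * energy x (crossover \<delta> x)"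
    by (rule energy_comparable_to_crossover[OF \<delta>(1,2)])
  obtain D K0 where D: "0 < D" "1 \<le> K0" and step:
    "\<And>x k. 0 < x \<Longrightarrow> x \<le> 1 \<Longrightarrow> K0 \<le> k \<Longrightarrow>
      \<bar>invariant x (Suc k) - invariant x k\<bar> \<le> (D / x * (1 / real k)\<^sup>2 + 12 * x\<^sup>2 * (1 / r k)\<^sup>2) * energy x k"
    using invariant_step[OF al] by blast
  define M where "M = C * (40 * slope\<^sup>2 + 2 * \<beta>\<^sup>2)"
  have M0: "0 \<le> M" unfolding M_def using C by simp
  define Z where "Z = (\<Sum>k. real k powr (- 3 / 2))"
  define Y where "Y = (\<Sum>k. (1 / r k)\<^sup>2)"
  have sZ: "summable (\<lambda>k. real k powr (- 3 / 2))" by (subst summable_real_powr_iff) auto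
  have Z0: "0 \<le> Z" unfolding Z_def by (rule suminf_nonneg[OF sZ]) auto
  define F where "F x = (D * Z * ((\<delta> / x) powr (- 3 / 2) / x) + 12 * x\<^sup>2 * Y) * M" for x
  have "\<forall>\<^sub>F x in at_right 0. norm (limit_energy x - invariant x (crossover \<delta> x)) \<le> F x"
    using C(2) eventually_at_right_0[OF \<delta>(1)] eventually_crossover[OF \<delta>(1) eventually_ge_at_top[of K0]]
  proof eventually_elim
    case (elim x)
    define K where "K = crossover \<delta> x"
    have x: "0 < x" "x \<le> 1" "x \<le> \<delta>" using elim \<delta> by auto
    have K: "K0 \<le> K" "1 \<le> K" using elim D unfolding K_def by auto
    have EK: "energy x K \<le> 40 * slope\<^sup>2 + 2 * \<beta>\<^sup>2"
    proof -
      have p: "real K powr (3 * \<alpha> - 2) = 1" "real K powr (- \<alpha>) \<le> 1"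
      proof -
        have "3 * \<alpha> - 2 = 0" using al by simp
        then show "real K powr (3 * \<alpha> - 2) = 1" using K by simp
        show "real K powr (- \<alpha>) \<le> 1" using K al by (simp add: powr_minus_divide ge_one_powr_ge_zero)
      qed
      have "\<delta> ^ 4 \<le> 1" "\<delta>\<^sup>2 \<le> 1" using \<delta> by (auto intro: power_le_one)
      then have "8 * slope\<^sup>2 * \<delta>\<^sup>2 \<le> 8 * slope\<^sup>2 * 1" "32 * slope\<^sup>2 * \<delta> ^ 4 \<le> 32 * slope\<^sup>2 * 1" "2 * \<beta>\<^sup>2 * real K powr (- \<alpha>) \<le> 2 * \<beta>\<^sup>2 * 1"
        using p by (intro mult_left_mono; simp)+
      then show ?thesis
        using crossover_bounds(4,5)[OF x(1,3) \<delta>(3)] unfolding energy_def K_def[symmetric] p by linarith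
    qed
    have En: "energy x n \<le> M" if "K \<le> n" for n
    proof -
      have "energy x n \<le> C * energy x K" using elim that unfolding K_def by blast
      also have "\<dots> \<le> M" unfolding M_def using C EK by (intro mult_left_mono) auto
      finally show ?thesis .
    qed
    have Kinv: "real K powr (- 1 / 2) \<le> (\<delta> / x) powr (- 3 / 2)"
    proof -
      have "1 / (1 - \<alpha>) = 3" by (simp add: al)
      then have "(\<delta> / x) powr 3 \<le> real K" using crossover_ge[of \<delta> x] unfolding K_def by simp
      then have "real K powr (- 1 / 2) \<le> ((\<delta> / x) powr 3) powr (- 1 / 2)"
        by (intro powr_mono2') (use x \<delta> in auto)
      then show ?thesis by (simp add: powr_powr)
    qed
    have S1: "(\<Sum>k\<in>{K..<n}. (1 / real k)\<^sup>2) \<le> (\<delta> / x) powr (- 3 / 2) * Z" for n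
    proof -
      have "(\<Sum>k\<in>{K..<n}. (1 / real k)\<^sup>2) \<le> (\<Sum>k\<in>{K..<n}. (\<delta> / x) powr (- 3 / 2) * real k powr (- 3 / 2))"
      proof (rule sum_mono)
        fix k assume k: "k \<in> {K..<n}"
        have "(1 / real k)\<^sup>2 = real k powr (- 2)" using k K by (simp add: powr_minus_divide power_divide)
        \<comment> \<open>Half a power is spent on smallness in \<open>x\<close>, the rest on summability.\<close>
        also have "\<dots> = real k powr (- 1 / 2) * real k powr (- 3 / 2)" by (simp flip: powr_add)
        also have "\<dots> \<le> (\<delta> / x) powr (- 3 / 2) * real k powr (- 3 / 2)"
          using k K by (intro mult_right_mono order_trans[OF _ Kinv] powr_mono2') auto
        finally show "(1 / real k)\<^sup>2 \<le> (\<delta> / x) powr (- 3 / 2) * real k powr (- 3 / 2)" .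
      qed
      also have "\<dots> = (\<delta> / x) powr (- 3 / 2) * (\<Sum>k\<in>{K..<n}. real k powr (- 3 / 2))" by (simp add: sum_distrib_left)
      also have "\<dots> \<le> (\<delta> / x) powr (- 3 / 2) * Z"
        unfolding Z_def by (intro mult_left_mono sum_le_suminf[OF sZ]) auto
      finally show ?thesis .
    qed
    have S2: "(\<Sum>k\<in>{K..<n}. (1 / r k)\<^sup>2) \<le> Y" for n
      unfolding Y_def by (rule sum_le_suminf[OF summable_inv_r]) auto
    have B: "\<bar>invariant x n - invariant x K\<bar> \<le> F x" if n: "K \<le> n" for n
    proof -
      have "\<bar>invariant x n - invariant x K\<bar> = \<bar>\<Sum>k\<in>{K..<n}. invariant x (Suc k) - invariant x k\<bar>"
        by (simp only: sum_Suc_diff'[OF n])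
      also have "\<dots> \<le> (\<Sum>k\<in>{K..<n}. (D / x * (1 / real k)\<^sup>2 + 12 * x\<^sup>2 * (1 / r k)\<^sup>2) * M)"
      proof (rule order_trans[OF sum_abs], rule sum_mono)
        fix k assume k: "k \<in> {K..<n}"
        have "\<bar>invariant x (Suc k) - invariant x k\<bar> \<le> (D / x * (1 / real k)\<^sup>2 + 12 * x\<^sup>2 * (1 / r k)\<^sup>2) * energy x k"
          by (rule step) (use x k K in auto)
        also have "\<dots> \<le> (D / x * (1 / real k)\<^sup>2 + 12 * x\<^sup>2 * (1 / r k)\<^sup>2) * M"
          by (intro mult_left_mono En) (use k x D in auto)
        finally show "\<bar>invariant x (Suc k) - invariant x k\<bar> \<le> (D / x * (1 / real k)\<^sup>2 + 12 * x\<^sup>2 * (1 / r k)\<^sup>2) * M" .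
      qed
      also have "\<dots> = (D / x * (\<Sum>k\<in>{K..<n}. (1 / real k)\<^sup>2) + 12 * x\<^sup>2 * (\<Sum>k\<in>{K..<n}. (1 / r k)\<^sup>2)) * M"
        by (simp only: sum_distrib_right[symmetric] sum.distrib sum_distrib_left[symmetric])
      also have "\<dots> \<le> (D / x * ((\<delta> / x) powr (- 3 / 2) * Z) + 12 * x\<^sup>2 * Y) * M"
        by (intro mult_right_mono add_mono mult_left_mono S1 S2 M0) (use D x in auto)
      also have "\<dots> = F x" unfolding F_def by (simp add: mult_ac)
      finally show ?thesis .
    qed
    have "(\<lambda>n. \<bar>invariant x n - invariant x K\<bar>) \<longlonglongrightarrow> \<bar>limit_energy x - invariant x K\<bar>"
      by (intro tendsto_intros invariant_tendsto_limit x)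
    then have "\<bar>limit_energy x - invariant x K\<bar> \<le> F x"
      by (rule LIMSEQ_le_const2) (use B in blast)
    then show ?case unfolding K_def by simp
  qed
  moreover have "(F \<longlongrightarrow> 0) (at_right 0)"
  proof -
    have "((\<lambda>x. (\<delta> / x) powr (- 3 / 2) / x) \<longlongrightarrow> 0) (at_right 0)" using \<delta>(1) by real_asymp
    then have "(F \<longlongrightarrow> (D * Z * 0 + 12 * 0\<^sup>2 * Y) * M) (at_right 0)"
      unfolding F_def by (intro tendsto_intros)
    then show ?thesis by simp
  qed
  ultimately show ?thesis by (rule Lim_null_comparison)
qed

text \<open>
  Before the first oscillation \<open>v\<^sup>2 / (9 x\<^sup>2)\<close> is close to \<open>slope\<^sup>2 / 9\<close>, and the other terms are of
  order \<open>\<delta>\<^sup>2\<close> or vanish with \<open>x\<close>.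
\<close>

lemma invariant_at_crossover:
  assumes al: "\<alpha> = 2 / 3" and \<delta>: "0 < \<delta>" "\<delta> \<le> 1" "4 * \<delta>\<^sup>2 \<le> \<gamma>" and x: "0 < x" "x \<le> \<delta>"
  defines "K \<equiv> crossover \<delta> x"
  shows "\<bar>invariant x K - slope\<^sup>2 / 9\<bar> \<le> 50 * slope\<^sup>2 * \<delta>\<^sup>2 + (2 * \<beta>\<^sup>2 * real K powr (- 2 / 3) + 2 * slope * \<beta> * real K powr (- 1 / 3) + slope * (slope - slope_part K))"
proof -
  note b = crossover_bounds[OF x \<delta>(3), folded K_def]
  have K1: "1 \<le> K" unfolding K_def by (rule crossover_le(2)[OF x])
  have pa: "real K powr (- \<alpha>) = real K powr (- 2 / 3)" by (simp add: al)
  have g: "\<gamma> = 2 / 3" using al unfolding \<gamma>_def by simp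
  have "3 * \<alpha> - 2 = 0" using al by simp
  then have p: "real K powr (3 * \<alpha> - 2) = 1" using K1 by simp
  have "\<delta>\<^sup>2 \<le> 1" using \<delta> by (auto intro: power_le_one)
  then have "\<delta> ^ 4 \<le> \<delta>\<^sup>2" using mult_left_mono[of "\<delta>\<^sup>2" 1 "\<delta>\<^sup>2"] by (simp add: power4_eq_xxxx power2_eq_square mult_ac)
  then have "32 * slope\<^sup>2 * \<delta> ^ 4 \<le> 32 * slope\<^sup>2 * \<delta>\<^sup>2" by (intro mult_left_mono) auto
  then have E: "energy x K \<le> 40 * slope\<^sup>2 * \<delta>\<^sup>2 + 2 * \<beta>\<^sup>2 * real K powr (- 2 / 3)"
    using b(4,5) \<open>32 * slope\<^sup>2 * \<delta> ^ 4 \<le> 32 * slope\<^sup>2 * \<delta>\<^sup>2\<close> unfolding energy_def p pa mult_1_right by linarith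
  have u: "\<bar>u x K\<bar> \<le> \<beta> + 2 * slope * x\<^sup>2 * K" using b(2) beta by linarith
  have uv: "\<bar>d (K - 1) / x * (u x K * v x K)\<bar> \<le> 2 * slope * \<beta> * real K powr (- 1 / 3) + 8 * slope\<^sup>2 * \<delta>\<^sup>2"
  proof -
    have "d (K - 1) \<le> real K powr (- 1 / 3)" using d_le[of "K - 1"] K1 by (simp add: al)
    then have "\<bar>d (K - 1) / x * (u x K * v x K)\<bar> \<le> real K powr (- 1 / 3) / x * ((\<beta> + 2 * slope * x\<^sup>2 * K) * (2 * slope * x))"
      unfolding abs_mult abs_divide
      using x d_nonneg[of "K - 1"] beta slope_pos by (intro mult_mono divide_mono b(1) u) auto
    also have "\<dots> = 2 * slope * \<beta> * real K powr (- 1 / 3) + 4 * slope\<^sup>2 * (x\<^sup>2 * (real K powr (- 1 / 3) * real K powr 1))"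
      using x by (simp add: field_simps power2_eq_square)
    also have "real K powr (- 1 / 3) * real K powr 1 = real K powr \<gamma>" unfolding g by (subst powr_add[symmetric]) simp
    also have "4 * slope\<^sup>2 * (x\<^sup>2 * real K powr \<gamma>) \<le> 4 * slope\<^sup>2 * (2 * \<delta>\<^sup>2)"
      unfolding K_def by (intro mult_left_mono crossover_powr x) auto
    finally show ?thesis by simp
  qed
  define w where "w = v x K / x"
  have w1: "\<bar>w\<bar> \<le> 2 * slope" using b(1) x by (simp add: w_def field_simps)
  have w2: "\<bar>w - slope\<bar> \<le> 6 * slope * \<delta>\<^sup>2 + (slope - slope_part K)"
  proof -
    have "w - slope_part K = (v x K - slope_part K * x) / x" unfolding w_def using x by (simp add: field_simps)
    then have "\<bar>w - slope_part K\<bar> = \<bar>v x K - slope_part K * x\<bar> / x" using x by simp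
    also have "\<dots> \<le> 6 * slope * \<delta>\<^sup>2" using b(3) x unfolding g by (simp add: field_simps)
    finally show ?thesis using slope_part_le[of K] by linarith
  qed
  have "\<bar>w\<^sup>2 - slope\<^sup>2\<bar> = \<bar>w - slope\<bar> * \<bar>w + slope\<bar>" by (simp add: power2_eq_square algebra_simps flip: abs_mult)
  also have "\<dots> \<le> (6 * slope * \<delta>\<^sup>2 + (slope - slope_part K)) * (3 * slope)"
    using w1 w2 slope_pos by (intro mult_mono) auto
  finally have "\<bar>w\<^sup>2 - slope\<^sup>2\<bar> / 9 \<le> (6 * slope * \<delta>\<^sup>2 + (slope - slope_part K)) * (3 * slope) / 9" by (intro divide_right_mono) auto
  also have "\<dots> = 2 * slope\<^sup>2 * \<delta>\<^sup>2 + slope * (slope - slope_part K) / 3" by (simp add: power2_eq_square field_simps)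
  also have "\<dots> \<le> 2 * slope\<^sup>2 * \<delta>\<^sup>2 + slope * (slope - slope_part K)"
    using slope_part_le[of K] slope_pos by simp
  finally have w3: "\<bar>w\<^sup>2 / 9 - slope\<^sup>2 / 9\<bar> \<le> 2 * slope\<^sup>2 * \<delta>\<^sup>2 + slope * (slope - slope_part K)" by (simp flip: diff_divide_distrib)
  have "invariant x K - slope\<^sup>2 / 9 = energy x K + d (K - 1) / x * (u x K * v x K) + (w\<^sup>2 / 9 - slope\<^sup>2 / 9)"
    unfolding invariant_def corrected_energy_def w_def by (simp add: power_divide)
  then show ?thesis using E uv w3 energy_nonneg[of x K] by linarith
qed

lemma limit_energy_tendsto_const:
  assumes al: "\<alpha> = 2 / 3"
  shows "(limit_energy \<longlongrightarrow> slope\<^sup>2 / 9) (at_right 0)"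
proof (rule tendstoI)
  fix e :: real assume e: "0 < e"
  define \<delta> where "\<delta> = min (1 / 4) (sqrt (e / (150 * slope\<^sup>2)))"
  have \<delta>: "0 < \<delta>" "\<delta> \<le> 1" "4 * \<delta>\<^sup>2 \<le> \<gamma>" "50 * slope\<^sup>2 * \<delta>\<^sup>2 \<le> e / 3"
  proof -
    show d0: "0 < \<delta>" "\<delta> \<le> 1" unfolding \<delta>_def using e slope_pos by auto
    have "\<delta>\<^sup>2 \<le> (1 / 4)\<^sup>2" using d0 by (intro power_mono) (auto simp: \<delta>_def)
    then show "4 * \<delta>\<^sup>2 \<le> \<gamma>" using al unfolding \<gamma>_def by (simp add: power_divide)
    have "\<delta>\<^sup>2 \<le> (sqrt (e / (150 * slope\<^sup>2)))\<^sup>2" using d0 by (intro power_mono) (auto simp: \<delta>_def)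
    also have "\<dots> = e / (150 * slope\<^sup>2)" using e by simp
    finally show "50 * slope\<^sup>2 * \<delta>\<^sup>2 \<le> e / 3" using slope_pos by (simp add: field_simps)
  qed
  define F where "F k = 2 * \<beta>\<^sup>2 * real k powr (- 2 / 3) + 2 * slope * \<beta> * real k powr (- 1 / 3) + slope * (slope - slope_part k)" for k
  have "F \<longlonglongrightarrow> 2 * \<beta>\<^sup>2 * 0 + 2 * slope * \<beta> * 0 + slope * (slope - slope)"
    unfolding F_def
    by (intro tendsto_intros slope_part_tendsto tendsto_neg_powr filterlim_real_sequentially) auto
  then have "\<forall>\<^sub>F k in sequentially. F k < e / 3" using e by (intro order_tendstoD) auto
  from eventually_crossover[OF \<delta>(1) this] 
  have F: "\<forall>\<^sub>F x in at_right 0. F (crossover \<delta> x) < e / 3" .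
  have L: "\<forall>\<^sub>F x in at_right 0. dist (limit_energy x - invariant x (crossover \<delta> x)) 0 < e / 3"
    using tendstoD[OF limit_energy_close_to_invariant[OF al \<delta>(1-3)], of "e / 3"] e by simp
  show "\<forall>\<^sub>F x in at_right 0. dist (limit_energy x) (slope\<^sup>2 / 9) < e"
    using F L eventually_at_right_0[OF \<delta>(1)]
  proof eventually_elim
    case (elim x)
    have "\<bar>invariant x (crossover \<delta> x) - slope\<^sup>2 / 9\<bar> \<le> 50 * slope\<^sup>2 * \<delta>\<^sup>2 + F (crossover \<delta> x)"
      unfolding F_def by (rule invariant_at_crossover) (use al \<delta> elim in auto)
    then show ?case using elim \<delta>(4) unfolding dist_real_def by linarith
  qed
qed

end

section \<open>The spectral density\<close>

context jacobi_weights begin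

lemma poly_differentiable:
  "(\<lambda>z. opoly b z n) field_differentiable at (z :: complex)" "(\<lambda>z. spoly b z n) field_differentiable at (z :: complex)"
proof -
  have nz: "b n \<noteq> 0" for n using b_pos[of n] by simp
  have 1: "(\<lambda>z. opoly b z n) field_differentiable at z \<and> (\<lambda>z. opoly b z (Suc n)) field_differentiable at z" for n
    by (induction n) (auto simp: opoly_def nz intro!: derivative_intros)
  have 2: "(\<lambda>z. spoly b z n) field_differentiable at z \<and> (\<lambda>z. spoly b z (Suc n)) field_differentiable at z" for n
    by (induction n) (auto simp: spoly_def nz intro!: derivative_intros)
  show "(\<lambda>z. opoly b z n) field_differentiable at z" "(\<lambda>z. spoly b z n) field_differentiable at z"
    using 1 2 by blast+
qed

lemma weyl_m_differentiable: assumes "0 \<le> Im z" shows "weyl_m N field_differentiable at z"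
proof -
  have "(\<lambda>z. - (spoly b z (Suc N) + \<i> * spoly b z N) / (opoly b z (Suc N) + \<i> * opoly b z N)) field_differentiable at z"
    using weyl_den_nonzero[OF assms, of N] unfolding weyl_den_def by (intro derivative_intros poly_differentiable)
  then show ?thesis unfolding weyl_m_def[abs_def] weyl_den_def by simp
qed

end

context weighted_string begin

lemma uv_even: "u (- x) k = u x k \<and> v (- x) k = - v x k"
  by (induction k) (simp_all add: u0 v0 uS vS)

lemma energy_even: "energy (- x) k = energy x k"
  unfolding energy_def using uv_even by simp

lemma energy_abs: "energy \<bar>x\<bar> k = energy x k"
  using energy_even[of x] by (cases "0 \<le> x") simp_all

end

text \<open>
  The points near \<open>0\<close> at which a continuous function violates a closed condition form an open set,
  which is empty if it is negligible.
\<close>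

lemma closed_condition_from_AE:
  fixes f w :: "real \<Rightarrow> real"
  assumes f: "continuous_on (- {0}) f" and AE: "AE x in lborel. x \<noteq> 0 \<longrightarrow> f x = w x"
    and K: "closed K" and w: "\<forall>\<^sub>F y in at 0. w y \<in> K"
  shows "\<forall>\<^sub>F x in at 0. f x \<in> K"
proof -
  obtain \<delta> where \<delta>: "0 < \<delta>" "\<And>y. y \<noteq> 0 \<Longrightarrow> \<bar>y\<bar> < \<delta> \<Longrightarrow> w y \<in> K"
    using w unfolding eventually_at by (auto simp: dist_real_def)
  have "f x \<in> K" if x: "x \<noteq> 0" "\<bar>x\<bar> < \<delta>" for x
  proof (rule ccontr)
    assume nK: "f x \<notin> K"
    define U where "U = (- {0}) \<inter> f -` (- K)"
    have U: "open U" unfolding U_def by (rule continuous_open_preimage[OF f]) (use K in auto)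
    define V where "V = U \<inter> ball 0 \<delta>"
    have V: "open V" "x \<in> V" unfolding V_def using U nK x by (auto simp: U_def dist_real_def)
    have "AE y in lborel. y \<notin> V" using AE
    proof eventually_elim
      case (elim y)
      then show ?case using \<delta>(2)[of y] by (auto simp: V_def U_def dist_real_def)
    qed
    then have "V \<in> null_sets lborel" using V(1) by (subst AE_iff_null_sets) auto
    then have "negligible V" unfolding negligible_iff_null_sets by (rule null_sets_completionI)
    then show False using open_not_negligible[OF V(1)] V(2) by auto
  qed
  then show ?thesis unfolding eventually_at using \<delta>(1) by (auto simp: dist_real_def)
qed

text \<open>
  The zero diagonal decouples even and odd indices; equality of \<open>b (2 * k - 1)\<close> and \<open>b (2 * k)\<close>
  turns the recurrence into the string equation.
\<close>

locale doubled_power_weights =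
  fixes \<alpha> :: real and b :: "nat \<Rightarrow> real"
  assumes alpha: "1 / 2 < \<alpha>" "\<alpha> < 1" and b0: "0 < b 0"
    and b_odd: "1 \<le> k \<Longrightarrow> b (2 * k - 1) = real k powr \<alpha>"
    and b_even: "1 \<le> k \<Longrightarrow> b (2 * k) = real k powr \<alpha>"
begin

lemma b_odd': "b (Suc (2 * k)) = real (Suc k) powr \<alpha>"
  using b_odd[of "Suc k"] by simp

lemma b_even': "b (Suc (Suc (2 * k))) = real (Suc k) powr \<alpha>"
  using b_even[of "Suc k"] by simp

sublocale carleman_weights b
proof
  show "0 < b n" for n
  proof (cases n rule: parity_cases)
    case even
    then obtain k where "n = 2 * k" by blast
    then show ?thesis using b0 b_even[of k] by (cases "k = 0") auto
  next
    case odd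
    then obtain k where "n = Suc (2 * k)" using oddE by fastforce
    then show ?thesis using b_odd'[of k] by simp
  qed
  then have pos: "0 < b n" for n .
  show "\<not> summable (\<lambda>n. 1 / b n)"
  proof
    assume "summable (\<lambda>n. 1 / b n)"
    then have "summable ((\<lambda>n. 1 / b n) \<circ> (\<lambda>k. 2 * k))"
      by (rule summable_reindex) (auto simp: inj_on_def less_imp_le[OF pos])
    then have s: "summable (\<lambda>k. 1 / b (2 * k))" by (simp add: o_def)
    have "summable (\<lambda>k. real k powr (- \<alpha>))"
    proof (rule summable_comparison_test'[OF s])
      show "norm (real k powr - \<alpha>) \<le> 1 / b (2 * k)" if "1 \<le> k" for k
        using b_even[OF that] by (simp add: powr_minus_divide)
    qed
    then show False using alpha by (subst (asm) summable_real_powr_iff) auto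
  qed
qed

definition even_part :: "real \<Rightarrow> nat \<Rightarrow> real" where "even_part x k = (-1) ^ k * (b (2 * k) * opoly b x (2 * k))"

definition odd_part :: "real \<Rightarrow> nat \<Rightarrow> real" where "odd_part x k = (-1) ^ k * opoly b x (Suc (2 * k))"

sublocale weighted_string \<alpha> "b 0" even_part odd_part
proof
  show "even_part x 0 = b 0" "odd_part x 0 = x / b 0" for x
    unfolding even_part_def odd_part_def by (simp_all add: opoly_def)
  fix x k
  have 1: "b (2 * k) * opoly b x (2 * k) + b (Suc (2 * k)) * opoly b x (Suc (Suc (2 * k))) = x * opoly b x (Suc (2 * k))"
    using opoly_rec[of "2 * k" x] by simp
  have bb: "b (Suc (Suc (2 * k))) = b (Suc (2 * k))" unfolding b_odd' b_even' ..
  show U: "even_part x (Suc k) = even_part x k - x * odd_part x k"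
  proof -
    have "even_part x (Suc k) = - ((-1) ^ k * (b (Suc (2 * k)) * opoly b x (Suc (Suc (2 * k)))))"
      unfolding even_part_def by (simp add: bb)
    also have "b (Suc (2 * k)) * opoly b x (Suc (Suc (2 * k))) = x * opoly b x (Suc (2 * k)) - b (2 * k) * opoly b x (2 * k)"
      using 1 by simp
    finally show ?thesis unfolding even_part_def odd_part_def by (simp add: algebra_simps)
  qed
  let ?r = "b (Suc (2 * k))"
  have r: "0 < ?r" "real (Suc k) powr (2 * \<alpha>) = ?r * ?r" using b_pos by (auto simp: b_odd' simp flip: powr_add)
  have 2: "?r * opoly b x (Suc (2 * k)) + ?r * opoly b x (Suc (Suc (Suc (2 * k)))) = x * opoly b x (Suc (Suc (2 * k)))"
    using opoly_rec[of "Suc (2 * k)" x] by (simp add: bb)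
  have p3: "opoly b x (Suc (Suc (Suc (2 * k)))) = x * opoly b x (Suc (Suc (2 * k))) / ?r - opoly b x (Suc (2 * k))"
    using 2 r(1) by (simp add: field_simps)
  have "odd_part x (Suc k) = - ((-1) ^ k * opoly b x (Suc (Suc (Suc (2 * k)))))"
    unfolding odd_part_def by simp
  also have "\<dots> = odd_part x k - (-1) ^ k * (x * opoly b x (Suc (Suc (2 * k))) / ?r)"
    unfolding p3 odd_part_def by (simp add: right_diff_distrib)
  also have "(-1) ^ k * (x * opoly b x (Suc (Suc (2 * k))) / ?r) = - (x * even_part x (Suc k) / (?r * ?r))"
    unfolding even_part_def using r(1) by (simp add: bb)
  finally show "odd_part x (Suc k) = odd_part x k + x * even_part x (Suc k) / real (Suc k) powr (2 * \<alpha>)" unfolding r(2) by simp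
qed (use alpha b0 in auto)

lemma Im_weyl_m_eq_energy: assumes "1 \<le> k" shows "Im (weyl_m (2 * k) (of_real x)) = 1 / energy x k"
proof -
  have r: "r k = b (2 * k)" "0 < r k" using b_even[OF assms] r_pos[OF assms] by (auto simp: r_def)
  have sgn: "((- 1) ^ k)\<^sup>2 = (1 :: real)" by (cases "even k") auto
  have "energy x k = b (2 * k) * ((opoly b x (Suc (2 * k)))\<^sup>2 + (opoly b x (2 * k))\<^sup>2)"
    unfolding energy_def even_part_def odd_part_def using r sgn
    by (simp add: power_mult_distrib power2_eq_square[of "b (2 * k)"] distrib_left)
  then show ?thesis unfolding Im_weyl_m_real by simp
qed

definition limit_density :: "real \<Rightarrow> real" where "limit_density x = 1 / (pi * limit_energy \<bar>x\<bar>)"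

context
  fixes E f
  assumes E: "is_spectral_measure E (jacobi_dom b) (jacobi_map b)"
    and f: "is_ac_density (scalar_measure E e0) f"
begin

text \<open>
  The energy is bounded below on compact intervals away from \<open>0\<close>, which dominates the imaginary
  parts of the functions \<open>weyl_m\<close> on the real line.
\<close>

lemma density_on_interval:
  assumes PQ: "P < R" "R < Q" and sign: "0 < P \<or> Q < 0"
  shows "AE x in lborel. x \<in> {P<..R} \<longrightarrow> f x = limit_density x"
proof -
  let ?\<sigma> = "scalar_measure E e0"
  interpret pvm E by unfold_locales (use E in \<open>simp add: is_spectral_measure_def\<close>)
  define p' where "p' = min \<bar>P\<bar> \<bar>Q\<bar>"
  define q' where "q' = max \<bar>P\<bar> \<bar>Q\<bar>"
  have pq': "0 < p'" "p' \<le> q'" unfolding p'_def q'_def using sign PQ by auto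
  have x': "p' \<le> \<bar>x\<bar> \<and> \<bar>x\<bar> \<le> q'" if "x \<in> {P..Q}" for x using that sign unfolding p'_def q'_def by auto
  obtain K e where e: "0 < e" "\<And>x n. p' \<le> x \<Longrightarrow> x \<le> q' \<Longrightarrow> K \<le> n \<Longrightarrow> e \<le> energy x n"
    by (rule energy_bounded_below[OF pq'], metis)
  have eb: "e \<le> energy x n" if "x \<in> {P..Q}" "K \<le> n" for x n
    using e(2)[of "\<bar>x\<bar>" n] x'[OF that(1)] that(2) by (simp add: energy_abs)
  have et: "energy x \<longlonglongrightarrow> limit_energy \<bar>x\<bar>" "0 < limit_energy \<bar>x\<bar>" if "x \<in> {P..Q}" for x
  proof -
    have "0 < \<bar>x\<bar>" using x'[OF that] pq' by linarith
    have ea: "energy \<bar>x\<bar> = energy x" by (rule ext) (rule energy_abs)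
    show "energy x \<longlonglongrightarrow> limit_energy \<bar>x\<bar>" "0 < limit_energy \<bar>x\<bar>" 
      using energy_tendsto_limit[OF \<open>0 < \<bar>x\<bar>\<close>] limit_energy_pos[OF \<open>0 < \<bar>x\<bar>\<close>] ea by auto
  qed
  \<comment> \<open>The index starts at \<open>1\<close> because the energy at \<open>0\<close> is not the reciprocal of an imaginary part.\<close>
  define m where "m n = weyl_m (2 * Suc n)" for n
  have Im_m: "Im (m n (of_real x)) = 1 / energy x (Suc n)" for n x
    unfolding m_def by (rule Im_weyl_m_eq_energy) simp
  have real: "(\<lambda>n. Im (m n (of_real x))) \<longlonglongrightarrow> pi * limit_density x" if "x \<in> {P..Q}" for x
  proof -
    have "(\<lambda>n. 1 / energy x (Suc n)) \<longlonglongrightarrow> 1 / limit_energy \<bar>x\<bar>"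
      by (rule tendsto_divide[OF tendsto_const LIMSEQ_Suc[OF et(1)[OF that]]]) (use et(2)[OF that] in simp)
    then show ?thesis unfolding Im_m limit_density_def by simp
  qed
  have dom: "\<bar>Im (m n (of_real x))\<bar> \<le> 1 / e" if "K \<le> n" "x \<in> {P..Q}" for n x
    unfolding Im_m using eb[OF that(2), of "Suc n"] that(1) e(1) by (simp add: frac_le)
  have conv: "(\<lambda>n. m n z) \<longlonglongrightarrow> (\<integral>t. 1 / (of_real t - z) \<partial>?\<sigma>)" if "0 < Im z" for z
  proof -
    have "strict_mono (\<lambda>n::nat. 2 * Suc n)" by (rule strict_monoI) simp
    from LIMSEQ_subseq_LIMSEQ[OF weyl_m_tendsto_Stieltjes[OF E that] this] show ?thesis
      unfolding m_def by (simp add: o_def)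
  qed
  have dens0: "0 \<le> limit_density x" "limit_density x \<le> 1 / (pi * e)" if "x \<in> {P..Q}" for x
  proof -
    have "e \<le> limit_energy \<bar>x\<bar>" by (rule LIMSEQ_le_const[OF et(1)[OF that]]) (use eb[OF that] in blast)
    then show "0 \<le> limit_density x" "limit_density x \<le> 1 / (pi * e)" using e(1) unfolding limit_density_def by (auto intro!: frac_le)
  qed
  have meas: "(\<lambda>x. indicator {P..Q} x * limit_density x) \<in> borel_measurable borel"
  proof (rule borel_measurable_LIMSEQ_real)
    show "(\<lambda>n. indicator {P..Q} x * (1 / (pi * energy x (Suc n)))) \<longlonglongrightarrow> indicator {P..Q} x * limit_density x" for x
    proof (cases "x \<in> {P..Q}")
      case True
      then show ?thesis unfolding limit_density_def using et(2)[OF True] by (intro tendsto_intros LIMSEQ_Suc[OF et(1)]) auto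
    qed simp
    have "(\<lambda>x. energy x (Suc n)) \<in> borel_measurable borel" for n
      unfolding energy_def using continuous_uv[of UNIV] r_pos[of "Suc n"]
      by (intro borel_measurable_continuous_onI continuous_intros) auto
    then show "(\<lambda>x. indicator {P..Q} x * (1 / (pi * energy x (Suc n)))) \<in> borel_measurable borel" for n
      by measurable
  qed
  have w: "integrable lborel (\<lambda>x. indicator {P..Q} x * limit_density x)"
  proof (rule Bochner_Integration.integrable_bound)
    show "integrable lborel (\<lambda>x. indicator {P..Q} x * (1 / (pi * e)) :: real)"
      by (intro integrable_mult_left integrable_real_indicator) (use PQ in auto)
    show "AE x in lborel. norm (indicator {P..Q} x * limit_density x) \<le> norm (indicator {P..Q} x * (1 / (pi * e)))"
      using dens0 e(1) by (intro AE_I2) (auto simp: indicator_def)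
  qed (use meas in simp)
  have hats: "(\<integral>t. hat a c t \<partial>?\<sigma>) = (\<integral>x. hat a c x * limit_density x \<partial>lborel)" if ac: "P \<le> a" "a \<le> c" "c \<le> Q" for a c
    unfolding hat_def
  proof (rule Stieltjes_inversion_bump[OF finite_measure_scalar[OF e0_l2] sets_scalar ac(2)])
    show "m n field_differentiable at z" if "0 \<le> Im z" for n z unfolding m_def by (rule weyl_m_differentiable[OF that])
    show "cmod (m n z) \<le> 1 / Im z" if "0 < Im z" for n z unfolding m_def by (rule weyl_m_bound[OF that])
    show "(\<lambda>n. Im (m n (of_real x))) \<longlonglongrightarrow> pi * limit_density x" if "a \<le> x" "x \<le> c" for x
      by (rule real) (use that ac in auto)
    show "\<bar>Im (m n (of_real x))\<bar> \<le> 1 / e" if "K \<le> n" "a \<le> x" "x \<le> c" for n x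
      by (rule dom) (use that ac in auto)
  qed (rule conv)
  show ?thesis
    by (rule ac_density_from_hats[OF finite_measure_scalar[OF e0_l2] sets_scalar PQ w dens0(1) hats f])
qed

lemma density_AE: "AE x in lborel. x \<noteq> 0 \<longrightarrow> f x = limit_density x"
proof -
  have "AE x in lborel. \<forall>n. (x \<in> {1 / real (Suc n)<..real (Suc n) + 1} \<longrightarrow> f x = limit_density x)
      \<and> (x \<in> {- real (Suc n) - 2<..- (1 / real (Suc n))} \<longrightarrow> f x = limit_density x)"
  proof (subst AE_all_countable, intro allI AE_conjI)
    fix n
    have "1 / real (Suc n) \<le> 1" by simp
    then have a: "1 / real (Suc n) < real (Suc n) + 1" by linarith
    show "AE x in lborel. x \<in> {1 / real (Suc n)<..real (Suc n) + 1} \<longrightarrow> f x = limit_density x"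
      by (rule density_on_interval[of _ _ "real (Suc n) + 2"]) (use a in auto)
    show "AE x in lborel. x \<in> {- real (Suc n) - 2<..- (1 / real (Suc n))} \<longrightarrow> f x = limit_density x"
      by (rule density_on_interval[of _ _ "- (1 / real (Suc n)) / 2"]) (use a in \<open>auto simp: field_simps\<close>)
  qed
  then show ?thesis
  proof eventually_elim
    case (elim x)
    show ?case
    proof
      assume x: "x \<noteq> 0"
      obtain n :: nat where n: "max (1 / \<bar>x\<bar>) \<bar>x\<bar> \<le> real n" using real_arch_simple by blast
      then have "1 / \<bar>x\<bar> < real (Suc n)" "\<bar>x\<bar> < real (Suc n)" by auto
      then have "1 / real (Suc n) < \<bar>x\<bar>" "\<bar>x\<bar> < real (Suc n)" using x by (auto simp: field_simps)
      then have "x \<in> {1 / real (Suc n)<..real (Suc n) + 1} \<or> x \<in> {- real (Suc n) - 2<..- (1 / real (Suc n))}"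
        by (cases "0 < x") auto
      then show "f x = limit_density x" using elim by blast
    qed
  qed
qed

lemma density_eventually:
  assumes "continuous_on (- {0}) f" "closed K" "\<forall>\<^sub>F x in at_right 0. 1 / (pi * limit_energy x) \<in> K"
  shows "\<forall>\<^sub>F x in at 0. f x \<in> K"
proof (rule closed_condition_from_AE[OF assms(1) density_AE assms(2)])
  obtain d where "0 < d" "\<And>x. 0 < x \<Longrightarrow> x < d \<Longrightarrow> 1 / (pi * limit_energy x) \<in> K"
    using assms(3) unfolding eventually_at_right_field by auto
  then show "\<forall>\<^sub>F y in at 0. limit_density y \<in> K"
    unfolding eventually_at limit_density_def by (intro exI[of _ d]) (auto simp: dist_real_def)
qed

lemma density_tendsto:
  assumes "continuous_on (- {0}) f" "((\<lambda>x. 1 / (pi * limit_energy x)) \<longlongrightarrow> l) (at_right 0)"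
  shows "(f \<longlongrightarrow> l) (at 0)"
proof (rule tendstoI)
  fix e :: real assume e: "0 < e"
  have "\<forall>\<^sub>F x in at_right 0. dist (1 / (pi * limit_energy x)) l < e / 2" by (rule tendstoD[OF assms(2)]) (use e in simp)
  then have "\<forall>\<^sub>F x in at_right 0. 1 / (pi * limit_energy x) \<in> cball l (e / 2)"
    by eventually_elim (simp add: dist_commute)
  from density_eventually[OF assms(1) _ this] have "\<forall>\<^sub>F x in at 0. f x \<in> cball l (e / 2)" by simp
  then show "\<forall>\<^sub>F x in at 0. dist (f x) l < e"
    by eventually_elim (use e in \<open>simp add: dist_commute\<close>)
qed

lemma density_at_top:
  assumes "continuous_on (- {0}) f" "filterlim (\<lambda>x. 1 / (pi * limit_energy x)) at_top (at_right 0)"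
  shows "filterlim f at_top (at 0)"
  unfolding filterlim_at_top
proof
  fix Z
  have "\<forall>\<^sub>F x in at_right 0. 1 / (pi * limit_energy x) \<in> {Z..}" using assms(2) unfolding filterlim_at_top by simp
  from density_eventually[OF assms(1) _ this] show "\<forall>\<^sub>F x in at 0. Z \<le> f x" by simp
qed

end

end

theorem mainTheorem2:
  fixes \<alpha> :: real
    and b :: "nat \<Rightarrow> real"
    and E :: "real set \<Rightarrow> (nat \<Rightarrow> complex) \<Rightarrow> (nat \<Rightarrow> complex)"
    and f :: "real \<Rightarrow> real"
  assumes "1 / 2 < \<alpha>" and "\<alpha> < 1"
    and "0 < b 0"
    and "\<And>k. 1 \<le> k \<Longrightarrow> b (2 * k - 1) = real k powr \<alpha>"
    and "\<And>k. 1 \<le> k \<Longrightarrow> b (2 * k) = real k powr \<alpha>"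
    and "is_spectral_measure E (jacobi_dom b) (jacobi_map b)"
    and "is_ac_density (scalar_measure E e0) f"
    and "continuous_on (- {0}) f"
  shows "(1 / 2 < \<alpha> \<and> \<alpha> < 2 / 3 \<longrightarrow> filterlim f at_top (at 0)) \<and>
         (\<alpha> = 2 / 3 \<longrightarrow> (\<exists>f0. f0 \<noteq> 0 \<and> (f \<longlongrightarrow> f0) (at 0))) \<and>
         (2 / 3 < \<alpha> \<and> \<alpha> < 1 \<longrightarrow> (f \<longlongrightarrow> 0) (at 0))"
proof -
  interpret W: doubled_power_weights \<alpha> b
    by unfold_locales (use assms in auto)
  have pos: "\<forall>\<^sub>F x in at_right 0. 0 < pi * W.limit_energy x"
    using W.eventually_at_right_0[OF zero_less_one] by eventually_elim (simp add: W.limit_energy_pos)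
  show ?thesis
  proof (intro conjI impI)
    assume "1 / 2 < \<alpha> \<and> \<alpha> < 2 / 3"
    then have "((\<lambda>x. pi * W.limit_energy x) \<longlongrightarrow> pi * 0) (at_right 0)" by (intro tendsto_intros W.limit_energy_tendsto_0) simp
    then have "filterlim (\<lambda>x. inverse (pi * W.limit_energy x)) at_top (at_right 0)"
      using pos by (intro filterlim_inverse_at_top) simp_all
    then show "filterlim f at_top (at 0)"
      by (intro W.density_at_top[OF assms(6-8)]) (simp add: inverse_eq_divide)
  next
    assume a: "\<alpha> = 2 / 3"
    have l: "((\<lambda>x. 1 / (pi * W.limit_energy x)) \<longlongrightarrow> 1 / (pi * (W.slope\<^sup>2 / 9))) (at_right 0)"
      by (intro tendsto_intros W.limit_energy_tendsto_const a) (use W.slope_pos in simp)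
    show "\<exists>f0. f0 \<noteq> 0 \<and> (f \<longlongrightarrow> f0) (at 0)"
      by (rule exI[of _ "1 / (pi * (W.slope\<^sup>2 / 9))"], intro conjI W.density_tendsto[OF assms(6-8)] l) (use W.slope_pos in simp)
  next
    assume "2 / 3 < \<alpha> \<and> \<alpha> < 1"
    then have "filterlim W.limit_energy at_top (at_right 0)" by (intro W.limit_energy_at_top) simp
    then have "filterlim (\<lambda>x. pi * W.limit_energy x) at_top (at_right 0)"
      by (intro filterlim_tendsto_pos_mult_at_top[OF tendsto_const pi_gt_zero])
    then have "((\<lambda>x. 1 / (pi * W.limit_energy x)) \<longlongrightarrow> 0) (at_right 0)"
      by (intro real_tendsto_divide_at_top[OF tendsto_const])
    then show "(f \<longlongrightarrow> 0) (at 0)" by (rule W.density_tendsto[OF assms(6-8)])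
  qed
qed

end
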